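(* Let $\mathbb{K}$ be a field, $S=\mathbb{K}[x_1,\ldots,x_\ell]$, and let $\mathcal{A}$ be a free arrangement in $\mathbb{K}^\ell$ with $\exp(\mathcal{A})=(d_1,d_2,\ldots,d_\ell)$, $d_1=1$. Let $H_1=\ker\alpha_1$, $H_2=\ker\alpha_2$ be two distinct hyperplanes of $\mathcal{A}$, put $\mathcal{A}_1=\mathcal{A}\setminus\{H_1\}$, $\mathcal{A}_2=\mathcal{A}\setminus\{H_2\}$, $\mathcal{A}_{1,2}=\mathcal{A}\setminus\{H_1,H_2\}$, and assume that $\mathcal{A}_j$ is SPOG with $\mathrm{POexp}(\mathcal{A}_j)=(d_1,\ldots,d_\ell)$ and level $c_j$ for $j=1,2$, with $c_1\le c_2$. Assume $|\mathrm{DS}(\mathcal{A}_{1,2})|>\ell+2$, with $\mathrm{DS}(\mathcal{A}_{1,2})=(d_1,\ldots,d_\ell,c_1,c_2,\ldots,c_r)$. Then, for a suitable choice of homogeneous bases, the minimal free resolution $$0\to M_k\xrightarrow{R_k}M_{k-1}\xrightarrow{R_{k-1}}\cdots\xrightarrow{R_2}M_1\xrightarrow{R_1}M_0\to D(\mathcal{A}_{1,2})\to0,\qquad M_0=\Big(\bigoplus_{i=1}^{\ell}S[-d_i]\Big)\oplus\Big(\bigoplus_{j=1}^{r}S[-c_j]\Big),$$ satisfies the following. (1) $\bigoplus_{j=1}^rS[-c_j-1]\subsetneq M_1$, and there exist $h_{ij}\in S$ ($1\le i\le\ell$, $1\le j\le r$) and $h_j\in S$ with $h_j\ne0$ ($3\le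 j\le r$) such that the first $r$ rows of $R_1$ are $$R_1(1)=(h_{11},\ldots,h_{\ell1},\alpha_1,0,\ldots,0),$$ $$R_1(2)=(h_{12},\ldots,h_{\ell2},0,\alpha_2,0,\ldots,0),$$ $$R_1(j)=(h_{1j},\ldots,h_{\ell j},h_j,0,\ldots,0,\alpha_2,0,\ldots,0)\quad(j=3,\ldots,r),$$ where in $R_1(j)$ the entry $\alpha_2$ is in position $\ell+j$ for $j=3,\ldots,r$. (2) Write $R_1=(\psi_1,\ldots,\psi_r,\phi_1,\ldots,\phi_t)^T$ and $M_1=\big(\bigoplus_{j=1}^rS[-c_j-1]\big)\oplus\big(\bigoplus_{i=1}^tS[-e_i]\big)$ with some $t>0$, where $\psi_j$ is the row $R_1(j)$ of (1) for $j=1,\ldots,r$. Then $\bigoplus_{i=1}^tS[-e_i-1]\subset M_2$; in particular $M_2\ne0$. Moreover, for $i=1,\ldots,t$ the row $R_2(i)$ has the form $(f_{1i},\ldots,f_{ri},0,\ldots,0,\alpha_2,0,\ldots,0)$ with $f_{ji}\in S$ and with the entry $\alpha_2$ in position $r+i$. When $\bigoplus_{i=1}^tS[-e_i-1]=M_2$, we have $t=r-2$ and $M_3=0$.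
   Context: Let $V=\mathbb{K}^\ell$ and $S=\mathbb{K}[x_1,\ldots,x_\ell]$ with the usual grading, $S[-d]$ the graded free module with generator in degree $d$. A (central) hyperplane arrangement $\mathcal{A}$ is a finite set of linear hyperplanes in $V$; $\alpha_H\in S_1$ is a linear form with $H=\ker\alpha_H$. $D(\mathcal{A})=\{\theta\in\mathrm{Der}\,S\mid\theta(\alpha_H)\in S\alpha_H\ \forall H\in\mathcal{A}\}$, $\mathrm{Der}\,S=\bigoplus_iS\partial_{x_i}$; $\sum f_i\partial_{x_i}$ is homogeneous of degree $d$ if all $f_i\in S_d$. $\mathcal{A}$ is free with $\exp(\mathcal{A})=(d_1,\ldots,d_\ell)$ if $D(\mathcal{A})$ is free over $S$ with a homogeneous basis of degrees $d_1,\ldots,d_\ell$. $\mathrm{DS}(\mathcal{B})$ is the unordered sequence of degrees of a minimal set of homogeneous generators of $D(\mathcal{B})$ and $|\mathrm{DS}(\mathcal{B})|$ is the number of these generators. $\mathcal{B}$ is SPOG (strictly plus-one generated) with exponents $\mathrm{POexp}(\mathcal{B})=(p_1,\ldots,p_\ell)$ and level $d$ if there exist $f_1,\ldots,f_\ell,\alpha\in S$, $\alpha\ne0$, such that $D(\mathcal{B})$ has a minimal free resolution $0\to S[-d-1]\xrightarrow{(\alpha,f_1,\ldots,f_\ell)}S[-d]\oplus\bigoplus_{i=1}^\ell S[-p_i]\to D(\mathcal{B})\to0$. In the minimal free resolution, $k=\mathrm{pd}_S(D(\mathcal{A}_{1,2}))$ and $M_i=0$ for $i>k$. The maps $R_i$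 are represented by matrices; $R_i(j)$ denotes the $j$-th row of $R_i$, i.e. the image in $M_{i-1}$ (in coordinates) of the $j$-th basis element of $M_i$; thus rows of $R_1$ are relations among the minimal generators of $D(\mathcal{A}_{1,2})$, with coordinates ordered as in $M_0$ above. Inclusions such as $\bigoplus_jS[-c_j-1]\subset M_1$ mean inclusion as the graded summand spanned by part of the chosen homogeneous basis (here the part indexing the listed rows). *)

theory Defs
  imports
    "HOL-Analysis.Cartesian_Space"
    "HOL-Library.Poly_Mapping"
    "HOL-Library.Multiset"
    "Jordan_Normal_Form.Matrix"
begin

hide_const (open) Finite_Cartesian_Product.row Finite_Cartesian_Product.mat

subsection \<open>The graded polynomial ring\<close>

text \<open>Polynomials over \<open>'k\<close> in variables indexed by \<open>'n\<close>; for finite \<open>'n\<close> this is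
  \<open>S = K[x\<^sub>1, \<dots>, x\<^sub>l]\<close> with \<open>l = CARD('n)\<close>. A linear order on \<open>'n\<close> numbers the variables
  and provides the library's \<open>idom\<close> instance; it plays no role in the definitions.\<close>

type_synonym ('n, 'k) mpoly = "('n \<Rightarrow>\<^sub>0 nat) \<Rightarrow>\<^sub>0 'k"

text \<open>As usual, \<open>0\<close> is homogeneous of every degree.\<close>

definition homogeneous :: "nat \<Rightarrow> ('n::finite, 'k::zero) mpoly \<Rightarrow> bool" where
  "homogeneous d p \<longleftrightarrow> (\<forall>m \<in> Poly_Mapping.keys p. (\<Sum>i\<in>UNIV. Poly_Mapping.lookup m i) = d)"

definition peval :: "('n::finite, 'k::comm_semiring_1) mpoly \<Rightarrow> 'k ^ 'n \<Rightarrow> 'k" where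
  "peval p v = (\<Sum>m\<in>Poly_Mapping.keys p. Poly_Mapping.lookup p m * (\<Prod>i\<in>UNIV. vec_nth v i ^ Poly_Mapping.lookup m i))"

definition partial_deriv :: "'n \<Rightarrow> ('n, 'k::comm_semiring_1) mpoly \<Rightarrow> ('n, 'k) mpoly" where
  "partial_deriv i p =
     (\<Sum>m\<in>Poly_Mapping.keys p. Poly_Mapping.single (m - Poly_Mapping.single i 1) (of_nat (Poly_Mapping.lookup m i) * Poly_Mapping.lookup p m))"

subsection \<open>Derivations\<close>

text \<open>The derivation \<open>\<Sum>\<^sub>i f\<^sub>i \<partial>/\<partial>x\<^sub>i\<close> is represented by its coefficient vector.\<close>

type_synonym ('n, 'k) der = "(('n, 'k) mpoly) ^ 'n"

definition der_apply :: "('n::finite, 'k::comm_ring_1) der \<Rightarrow> ('n, 'k) mpoly \<Rightarrow> ('n, 'k) mpoly" where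
  "der_apply \<theta> p = (\<Sum>i\<in>UNIV. vec_nth \<theta> i * partial_deriv i p)"

definition homogeneous_der :: "nat \<Rightarrow> ('n::finite, 'k::zero) der \<Rightarrow> bool" where
  "homogeneous_der d \<theta> \<longleftrightarrow> (\<forall>i. homogeneous d (vec_nth \<theta> i))"

global_interpretation der: Modules.module "(*s) :: ('n::finite, 'k::comm_ring_1) mpoly \<Rightarrow> ('n, 'k) der \<Rightarrow> ('n, 'k) der"
  by unfold_locales (vector algebra_simps)+

subsection \<open>Arrangements\<close>

definition hyperplane :: "('k::field ^ 'n::finite) set \<Rightarrow> bool" where
  "hyperplane H \<longleftrightarrow> vec.subspace H \<and> vec.dim H + 1 = CARD('n)"

definition arrangement :: "('k::field ^ 'n::finite) set set \<Rightarrow> bool" where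
  "arrangement A \<longleftrightarrow> finite A \<and> (\<forall>H\<in>A. hyperplane H)"

definition defining_form :: "('k::field ^ 'n::finite) set \<Rightarrow> ('n, 'k) mpoly \<Rightarrow> bool" where
  "defining_form H \<alpha> \<longleftrightarrow> homogeneous 1 \<alpha> \<and> H = {v. peval \<alpha> v = 0}"

text \<open>A defining form of a hyperplane is unique up to a nonzero scalar, so quantifying over all of
  them below does not depend on a choice.\<close>

definition D :: "('k::field ^ 'n::finite) set set \<Rightarrow> ('n, 'k) der set" where
  "D A = {\<theta>. \<forall>H\<in>A. \<forall>\<alpha>. defining_form H \<alpha> \<longrightarrow> \<alpha> dvd der_apply \<theta> \<alpha>}"

definition free_with_exp :: "('k::field ^ 'n::finite) set set \<Rightarrow> nat list \<Rightarrow> bool" where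
  "free_with_exp A ds \<longleftrightarrow> length ds = CARD('n) \<and>
     (\<exists>\<theta>s. list_all2 homogeneous_der ds \<theta>s \<and> distinct \<theta>s \<and>
           der.independent (set \<theta>s) \<and> der.span (set \<theta>s) = D A)"

text \<open>\<open>has_DS A X\<close>: \<open>X\<close> is the multiset of degrees of a minimal set of homogeneous generators
  of \<open>D A\<close>. (Members of a minimal generating set are nonzero, so their degrees are determined.)\<close>

definition has_DS :: "('k::field ^ 'n::finite) set set \<Rightarrow> nat multiset \<Rightarrow> bool" where
  "has_DS A X \<longleftrightarrow>
     (\<exists>es \<theta>s. X = mset es \<and> list_all2 homogeneous_der es \<theta>s \<and> distinct \<theta>s \<and>
           der.span (set \<theta>s) = D A \<and> (\<forall>G. G \<subset> set \<theta>s \<longrightarrow> der.span G \<noteq> D A))"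

subsection \<open>Graded free resolutions\<close>

text \<open>A list \<open>[a\<^sub>1, \<dots>, a\<^sub>m]\<close> stands for the graded free module \<open>S[-a\<^sub>1] \<oplus> \<dots> \<oplus> S[-a\<^sub>m]\<close> with its
  standard basis; its elements are the vectors in \<open>carrier_vec m\<close>. Maps are given by matrices
  whose \<open>j\<close>-th row is the image of the \<open>j\<close>-th basis element, i.e. they act on row vectors.
  Natural numbers suffice as degrees since \<open>D A\<close> lives in degrees \<open>\<ge> 0\<close>.\<close>

definition row_map :: "'a::comm_ring_1 mat \<Rightarrow> 'a Matrix.vec \<Rightarrow> 'a Matrix.vec" where
  "row_map P v = transpose_mat P *\<^sub>v v"

text \<open>Degree-preserving maps from the module \<open>as\<close> to the module \<open>bs\<close>:
  the entry \<open>(j, k)\<close> is homogeneous of degree \<open>as\<^sub>j - bs\<^sub>k\<close>, hence \<open>0\<close> if that is negative.\<close>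

definition graded_mat :: "nat list \<Rightarrow> nat list \<Rightarrow> ('n::finite, 'k::zero) mpoly mat \<Rightarrow> bool" where
  "graded_mat as bs P \<longleftrightarrow> P \<in> carrier_mat (length as) (length bs) \<and>
     (\<forall>j < length as. \<forall>k < length bs. P $$ (j, k) = 0 \<or>
        (\<exists>e. as ! j = bs ! k + e \<and> homogeneous e (P $$ (j, k))))"

text \<open>The map \<open>M\<^sub>0 \<rightarrow> Der S\<close> sending the \<open>j\<close>-th basis element to the \<open>j\<close>-th entry of a list.\<close>

definition der_comb :: "('n::finite, 'k::comm_ring_1) der list \<Rightarrow> ('n, 'k) mpoly Matrix.vec \<Rightarrow> ('n, 'k) der" where
  "der_comb gs v = (\<Sum>j < length gs. vec_index v j *s gs ! j)"

text \<open>\<open>0 \<rightarrow> M k \<rightarrow> \<dots> \<rightarrow> M 1 \<rightarrow> M 0 \<rightarrow> N \<rightarrow> 0\<close> is exact with degree-preserving maps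
  \<open>R i: M i \<rightarrow> M (i - 1)\<close> (\<open>i \<ge> 1\<close>; \<open>R 0\<close> is not used) and augmentation given by \<open>gs\<close>.\<close>

definition graded_free_resolution ::
  "('n::finite, 'k::field) der set \<Rightarrow> nat \<Rightarrow> (nat \<Rightarrow> nat list) \<Rightarrow> ('n, 'k) der list
     \<Rightarrow> (nat \<Rightarrow> ('n, 'k) mpoly mat) \<Rightarrow> bool" where
  "graded_free_resolution N k M gs R \<longleftrightarrow>
     (\<forall>i>k. M i = []) \<and>
     list_all2 homogeneous_der (M 0) gs \<and>
     (\<forall>i. graded_mat (M (Suc i)) (M i) (R (Suc i))) \<and>
     der_comb gs ` carrier_vec (length (M 0)) = N \<and>
     {v \<in> carrier_vec (length (M 0)). der_comb gs v = 0}
       = row_map (R 1) ` carrier_vec (length (M 1)) \<and>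
     (\<forall>i. {v \<in> carrier_vec (length (M (Suc i))). row_map (R (Suc i)) v = 0\<^sub>v (length (M i))}
       = row_map (R (Suc (Suc i))) ` carrier_vec (length (M (Suc (Suc i)))))"

text \<open>Minimality: the image of each \<open>R i\<close> lies in the irrelevant ideal times \<open>M (i - 1)\<close>,
  i.e. all entries of the \<open>R i\<close> have zero constant term.\<close>

definition minimal_free_resolution ::
  "('n::finite, 'k::field) der set \<Rightarrow> nat \<Rightarrow> (nat \<Rightarrow> nat list) \<Rightarrow> ('n, 'k) der list
     \<Rightarrow> (nat \<Rightarrow> ('n, 'k) mpoly mat) \<Rightarrow> bool" where
  "minimal_free_resolution N k M gs R \<longleftrightarrow> graded_free_resolution N k M gs R \<and>
     (\<forall>i. \<forall>j < length (M (Suc i)). \<forall>c < length (M i). Poly_Mapping.lookup (R (Suc i) $$ (j, c)) 0 = 0)"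

text \<open>Rewriting a resolution in other homogeneous bases: the \<open>j\<close>-th row of \<open>P i\<close> holds the
  coordinates of the \<open>j\<close>-th new basis element of the \<open>i\<close>-th module in the old basis, and
  \<open>Q i\<close> is the inverse of \<open>P i\<close>.\<close>

definition change_of_bases ::
  "(nat \<Rightarrow> nat list) \<Rightarrow> ('n::finite, 'k::field) der list \<Rightarrow> (nat \<Rightarrow> ('n, 'k) mpoly mat)
     \<Rightarrow> (nat \<Rightarrow> nat list) \<Rightarrow> ('n, 'k) der list \<Rightarrow> (nat \<Rightarrow> ('n, 'k) mpoly mat) \<Rightarrow> bool" where
  "change_of_bases M gs R M' gs' R' \<longleftrightarrow>
     (\<exists>P Q. (\<forall>i. graded_mat (M' i) (M i) (P i) \<and> graded_mat (M i) (M' i) (Q i) \<and>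
                P i * Q i = 1\<^sub>m (length (M' i)) \<and> Q i * P i = 1\<^sub>m (length (M i))) \<and>
            gs' = map (\<lambda>j. der_comb gs (row (P 0) j)) [0..<length (M' 0)] \<and>
            (\<forall>i. R' (Suc i) * P i = P (Suc i) * R (Suc i)))"

text \<open>Strictly plus-one generated with exponents \<open>ps\<close> and level \<open>d\<close>: minimal free resolution
  \<open>0 \<rightarrow> S[-d-1] \<rightarrow> S[-d] \<oplus> \<Oplus>\<^sub>i S[-p\<^sub>i] \<rightarrow> D A \<rightarrow> 0\<close> with matrix \<open>(\<alpha>, f\<^sub>1, \<dots>, f\<^sub>l)\<close>, \<open>\<alpha> \<noteq> 0\<close>.\<close>

definition SPOG :: "('k::field ^ 'n::finite) set set \<Rightarrow> nat list \<Rightarrow> nat \<Rightarrow> bool" where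
  "SPOG A ps d \<longleftrightarrow> length ps = CARD('n) \<and>
     (\<exists>M gs R \<alpha> f. \<alpha> \<noteq> 0 \<and> f \<in> carrier_vec CARD('n) \<and>
        M 0 = d # ps \<and> M 1 = [d + 1] \<and> row (R 1) 0 = vCons \<alpha> f \<and>
        minimal_free_resolution (D A) 1 M gs R)"

end

theory Submission
  imports Defs "HOL-Combinatorics.Permutations"
begin

text \<open>
  Write \<open>D\<^sub>1\<close>, \<open>D\<^sub>2\<close>, \<open>D\<^sub>1\<^sub>2\<close> for the derivation modules of the three deletions and \<open>\<theta>\<^sub>i\<close> for a basis of
  \<open>D(A)\<close>. The strictly plus-one generated resolution of \<open>D\<^sub>j\<close> forces \<open>D\<^sub>j / D(A)\<close> to be cyclic, so \<open>D\<^sub>j\<close> is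
  generated by the \<open>\<theta>\<^sub>i\<close> and one \<open>\<phi>\<^sub>j\<close> of degree \<open>c\<^sub>j\<close>, with the single relation
  \<open>\<alpha>\<^sub>j \<phi>\<^sub>j = \<Sum> f\<^sub>i \<theta>\<^sub>i\<close>. As \<open>D\<^sub>1\<^sub>2\<close> needs more than \<open>l + 2\<close> generators, it agrees with \<open>D\<^sub>1\<close> in degrees below \<open>c\<^sub>2\<close>,
  and hence the \<open>\<theta>\<^sub>i\<close>, \<open>\<phi>\<^sub>1\<close>, \<open>\<phi>\<^sub>2\<close> are part of a minimal system of generators; call the others \<open>\<eta>\<^sub>j\<close>.

  Since \<open>\<alpha>\<^sub>2 D\<^sub>1\<^sub>2\<close> lies in \<open>D\<^sub>1\<close> and \<open>\<alpha>\<^sub>1 D\<^sub>1\<^sub>2\<close> in \<open>D\<^sub>2\<close>, each \<open>\<eta>\<^sub>j\<close> gives two syzygies \<open>\<psi>\<^sub>j\<close> and \<open>\<chi>\<^sub>j\<close> with pivots \<open>\<alpha>\<^sub>2\<close>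
  and \<open>\<alpha>\<^sub>1\<close>. The linear pivots make these syzygies, and likewise the second syzygies below, independent
  modulo the square of the irrelevant ideal, so they belong to bases of the modules in the resolution. Multiplication by \<open>\<alpha>\<^sub>2\<close> maps every
  syzygy into the span of the \<open>\<psi>\<^sub>j\<close>, which yields the rows of \<open>R\<^sub>2\<close>; multiplication by \<open>\<alpha>\<^sub>1\<close> maps it into
  the span of the \<open>\<psi>\<^sub>j\<close> and \<open>\<chi>\<^sub>j\<close>. If \<open>M\<^sub>2\<close> has no further generators, a basis syzygy besides the \<open>\<psi>\<^sub>j\<close> and
  \<open>\<chi>\<^sub>j\<close> would thus force \<open>\<alpha>\<^sub>2\<close> to divide \<open>\<alpha>\<^sub>1\<close>.
\<close>

subsection \<open>Graded polynomials\<close>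

text \<open>The step from "agrees in low degrees" to "part of a minimal system" hides the main
  obstacle: an exponent \<open>d_i\<close> may exceed \<open>c2\<close>, and then low degrees say
  nothing about \<open>\<theta>_i\<close>. For such \<open>i\<close> the relations of both deletions
  have coefficient zero at \<open>\<theta>_i\<close> for degree reasons. Hence the coordinate at
  \<open>\<theta>_i\<close>, a priori defined on the double deletion only after multiplication by
  \<open>\<alpha>1 * \<alpha>2\<close>, has polynomial values, and it separates
  \<open>\<theta>_i\<close> from combinations with coefficients in the irrelevant ideal. In the
  comparison with the first deletion, the bound on the number of generators excludes a single case:
  an element of degree \<open>c2 - 1\<close> whose \<open>\<alpha>1\<close>-multiple involves
  \<open>\<phi>2\<close> with a nonzero constant. Together with the \<open>\<theta>_i\<close> and
  \<open>\<phi>1\<close> it would generate everything. Nakayama's lemma appears throughout as an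
  exchange argument: an entry of degree 0 in a graded matrix is a constant, so a nonzero constant
  term makes it a unit. Since the given resolution is arbitrary, its bases are adapted one module at
  a time, in homological degrees 0, 1 and 2.\<close>

abbreviation plookup :: "('n, 'k::zero) mpoly \<Rightarrow> ('n \<Rightarrow>\<^sub>0 nat) \<Rightarrow> 'k" where
  "plookup \<equiv> Poly_Mapping.lookup"

definition mdeg :: "('n::finite \<Rightarrow>\<^sub>0 nat) \<Rightarrow> nat" where
  "mdeg m = (\<Sum>i\<in>UNIV. Poly_Mapping.lookup m i)"

lemma mdeg_0 [simp]: "mdeg 0 = 0"
  and mdeg_add [simp]: "mdeg (m + m') = mdeg m + mdeg m'"
  by (simp_all add: mdeg_def lookup_add sum.distrib)

lemma mdeg_eq_0_iff [simp]: "mdeg m = 0 \<longleftrightarrow> m = 0"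
  by (auto simp: mdeg_def intro!: poly_mapping_eqI)

lemma mdeg_single [simp]: "mdeg (Poly_Mapping.single i e) = e"
  by (simp add: mdeg_def lookup_single when_def)

lemma single_Suc_0_eq_iff [simp]: "Poly_Mapping.single i (Suc 0) = Poly_Mapping.single j (Suc 0) \<longleftrightarrow> i = j"
  by (metis lookup_single_eq lookup_single_not_eq zero_neq_one One_nat_def)

lemma mdeg_eq_1_iff: "mdeg m = 1 \<longleftrightarrow> (\<exists>i. m = Poly_Mapping.single i 1)"
proof
  assume m: "mdeg m = 1"
  then obtain i where i: "Poly_Mapping.lookup m i = 1"
    and ni: "\<forall>j\<in>UNIV. i \<noteq> j \<longrightarrow> Poly_Mapping.lookup m j = 0"
    using sum_eq_1_iff[of UNIV "Poly_Mapping.lookup m"] unfolding mdeg_def by auto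
  have "m = Poly_Mapping.single i 1"
    using i ni by (intro poly_mapping_eqI) (auto simp: lookup_single when_def)
  then show "\<exists>i. m = Poly_Mapping.single i 1" ..
qed auto

text \<open>\<open>hom_shift a b\<close> describes the entries of a graded map from \<open>S[-a]\<close> to \<open>S[-b]\<close>; stating the degree
  condition additively avoids truncated subtraction when \<open>a < b\<close>.\<close>

definition hom_shift :: "nat \<Rightarrow> nat \<Rightarrow> ('n::finite, 'k::zero) mpoly \<Rightarrow> bool" where
  "hom_shift a b p \<longleftrightarrow> (\<forall>m \<in> Poly_Mapping.keys p. mdeg m + b = a)"

definition hom_part :: "nat \<Rightarrow> nat \<Rightarrow> ('n::finite, 'k::zero) mpoly \<Rightarrow> ('n, 'k) mpoly" where
  "hom_part a b p = Abs_poly_mapping (\<lambda>m. plookup p m when mdeg m + b = a)"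

definition const :: "'k::zero \<Rightarrow> ('n, 'k) mpoly" where
  "const c = Poly_Mapping.single 0 c"

definition const_term :: "('n, 'k::zero) mpoly \<Rightarrow> 'k" where
  "const_term p = plookup p 0"

text \<open>Membership in the square of the irrelevant ideal.\<close>

definition order2 :: "('n::finite, 'k::zero) mpoly \<Rightarrow> bool" where
  "order2 p \<longleftrightarrow> (\<forall>m \<in> Poly_Mapping.keys p. 2 \<le> mdeg m)"

lemma homogeneous_iff_hom_shift: "homogeneous d p \<longleftrightarrow> hom_shift d 0 p"
  by (simp add: homogeneous_def hom_shift_def mdeg_def)

lemma hom_shift_iff: "hom_shift a b p \<longleftrightarrow> p = 0 \<or> (\<exists>e. a = b + e \<and> homogeneous e p)"
proof
  assume *: "hom_shift a b p"
  show "p = 0 \<or> (\<exists>e. a = b + e \<and> homogeneous e p)"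
  proof (cases "p = 0")
    case False
    then obtain m where m: "m \<in> Poly_Mapping.keys p"
      by (metis in_keys_iff lookup_zero poly_mapping_eqI)
    have "homogeneous (mdeg m) p"
      unfolding homogeneous_iff_hom_shift hom_shift_def
    proof
      fix m' assume "m' \<in> Poly_Mapping.keys p"
      with * m have "mdeg m' + b = a" "mdeg m + b = a" by (auto simp: hom_shift_def)
      then show "mdeg m' + 0 = mdeg m" by simp
    qed
    moreover have "a = b + mdeg m" using * m by (auto simp: hom_shift_def)
    ultimately show ?thesis by blast
  qed auto
qed (auto simp: hom_shift_def homogeneous_def mdeg_def)

lemma lookup_hom_part: "plookup (hom_part a b p) m = (plookup p m when mdeg m + b = a)"
proof -
  have "finite {m. (plookup p m when mdeg m + b = a) \<noteq> 0}"
    by (rule finite_subset[OF _ finite_lookup[of p]]) auto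
  then show ?thesis by (simp add: hom_part_def)
qed

lemma hom_shift_0 [simp]: "hom_shift a b 0"
  by (simp add: hom_shift_def)

lemma hom_shift_add: "hom_shift a b p \<Longrightarrow> hom_shift a b q \<Longrightarrow> hom_shift a b (p + q)"
  using Poly_Mapping.keys_add[of p q] by (auto simp: hom_shift_def)

lemma hom_shift_uminus [simp]: "hom_shift a b (- p) \<longleftrightarrow> hom_shift a b (p :: ('n::finite, 'k::ab_group_add) mpoly)"
  by (simp add: hom_shift_def in_keys_iff)

lemma hom_shift_sum: "(\<And>i. i \<in> I \<Longrightarrow> hom_shift a b (f i)) \<Longrightarrow> hom_shift a b (sum f I)"
  by (induction I rule: infinite_finite_induct) (auto intro: hom_shift_add)

lemma hom_shift_mult: "hom_shift a b p \<Longrightarrow> hom_shift b c q \<Longrightarrow> hom_shift a c (p * q)"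
  using keys_mult[of p q] unfolding hom_shift_def by fastforce

lemma hom_shift_const [simp]: "hom_shift a a (const c)"
  by (simp add: hom_shift_def const_def)

lemma hom_shift_1 [simp]: "hom_shift a a (1 :: ('n::finite, 'k::zero_neq_one) mpoly)"
  by (simp add: hom_shift_def)

lemma hom_shift_add_cancel: "hom_shift (a + c) (b + c) p \<longleftrightarrow> hom_shift a b p"
  unfolding hom_shift_def by auto

lemma hom_shift_less: "hom_shift a b p \<Longrightarrow> a < b \<Longrightarrow> p = 0"
  by (auto simp: hom_shift_iff)

lemma hom_shift_hom_part [simp]: "hom_shift a b (hom_part a b p)"
  by (auto simp: hom_shift_def in_keys_iff lookup_hom_part)

lemma hom_part_id: "hom_shift a b p \<Longrightarrow> hom_part a b p = p"
  by (rule poly_mapping_eqI) (auto simp: lookup_hom_part hom_shift_def in_keys_iff when_def)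

lemma hom_part_0 [simp]: "hom_part a b 0 = 0"
  by (rule poly_mapping_eqI) (simp add: lookup_hom_part)

lemma hom_part_add: "hom_part a b (p + q) = hom_part a b p + hom_part a b q"
  by (rule poly_mapping_eqI) (simp add: lookup_hom_part lookup_add when_def)

lemma hom_part_sum: "hom_part a b (sum f I) = (\<Sum>i\<in>I. hom_part a b (f i))"
  by (induction I rule: infinite_finite_induct) (auto simp: hom_part_add)

lemma hom_part_mult:
  fixes p q :: "('n::finite, 'k::comm_ring_1) mpoly"
  assumes q: "hom_shift b c q"
  shows "hom_part a c (p * q) = hom_part a b p * q"
proof -
  \<comment> \<open>The remainder of \<open>p\<close> has no monomial of the selected degree, and
    \<open>q\<close>, being homogeneous, shifts all degrees by the same amount.\<close>
  have "hom_part a c ((p - hom_part a b p) * q) = 0"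
  proof (rule poly_mapping_eqI)
    fix m
    have "m \<notin> Poly_Mapping.keys ((p - hom_part a b p) * q)" if m: "mdeg m + c = a"
    proof
      assume "m \<in> Poly_Mapping.keys ((p - hom_part a b p) * q)"
      then obtain m1 m2 where m12: "m = m1 + m2" "m1 \<in> Poly_Mapping.keys (p - hom_part a b p)"
        "m2 \<in> Poly_Mapping.keys q" using keys_mult by blast
      then have "mdeg m2 + c = b" "mdeg m1 + b \<noteq> a"
        using q by (auto simp: hom_shift_def in_keys_iff lookup_minus lookup_hom_part when_def)
      with m m12 show False by auto
    qed
    then show "plookup (hom_part a c ((p - hom_part a b p) * q)) m = plookup 0 m"
      by (auto simp: lookup_hom_part when_def in_keys_iff)
  qed
  moreover have "p * q = (p - hom_part a b p) * q + hom_part a b p * q"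
    by (simp add: algebra_simps)
  ultimately have "hom_part a c (p * q) = hom_part a c (hom_part a b p * q)"
    using hom_part_add[of a c "(p - hom_part a b p) * q" "hom_part a b p * q"] by simp
  also have "\<dots> = hom_part a b p * q"
    by (intro hom_part_id hom_shift_mult[OF _ q]) simp
  finally show ?thesis .
qed

lemma const_0 [simp]: "const 0 = 0"
  and const_1 [simp]: "const 1 = (1 :: ('n, 'k::comm_ring_1) mpoly)"
  by (simp_all add: const_def)

lemma const_mult: "const a * const b = (const (a * b) :: ('n, 'k::comm_ring_1) mpoly)"
  by (simp add: const_def mult_single)

lemma const_add: "const (a + b) = const a + const (b :: 'k::comm_ring_1)"
  by (simp add: const_def single_add)

lemma const_term_const [simp]: "const_term (const c) = c"
  by (simp add: const_term_def const_def)

lemma const_inverse_mult [simp]: "c \<noteq> 0 \<Longrightarrow> const (inverse c) * const c = (1 :: ('n, 'k::field) mpoly)"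
  by (simp add: const_mult)

lemma const_eq_0_iff [simp]: "const c = 0 \<longleftrightarrow> c = 0"
  by (metis const_0 const_term_const)

lemma const_term_0 [simp]: "const_term 0 = 0"
  and const_term_add [simp]: "const_term (p + q) = const_term p + const_term q"
  and const_term_1 [simp]: "const_term 1 = (1 :: 'k::comm_ring_1)"
  by (simp_all add: const_term_def lookup_add)

lemma const_term_uminus [simp]: "const_term (- p) = - const_term (p :: ('n, 'k::ab_group_add) mpoly)"
  and const_term_diff [simp]: "const_term (p - q) = const_term p - const_term (q :: ('n, 'k::ab_group_add) mpoly)"
  by (simp_all add: const_term_def lookup_minus)

lemma const_term_sum [simp]: "const_term (sum f I) = (\<Sum>i\<in>I. const_term (f i))"
  by (simp add: const_term_def lookup_sum)

lemma const_term_mult [simp]: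
  fixes p q :: "('n::finite, 'k::comm_ring_1) mpoly"
  shows "const_term (p * q) = const_term p * const_term q"
proof -
  have *: "const_term (r * s) = 0" if r: "const_term r = 0" for r s :: "('n, 'k) mpoly"
  proof (rule ccontr)
    assume "const_term (r * s) \<noteq> 0"
    then have "0 \<in> Poly_Mapping.keys (r * s)" by (simp add: const_term_def in_keys_iff)
    then obtain m1 m2 where m: "0 = m1 + m2" "m1 \<in> Poly_Mapping.keys r" using keys_mult by blast
    from arg_cong[OF m(1), of mdeg] have "m1 = 0" by simp
    with r m show False by (simp add: const_term_def in_keys_iff)
  qed
  have p: "p = const (const_term p) + (p - const (const_term p))"
    and q: "q = const (const_term q) + (q - const (const_term q))" by auto
  have "const_term ((p - const (const_term p)) * q) = 0"
    "const_term (const (const_term p) * (q - const (const_term q))) = 0"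
    using *[of "p - const (const_term p)" q] *[of "q - const (const_term q)" "const (const_term p)"]
    by (simp_all add: mult.commute)
  moreover have "p * q = (p - const (const_term p)) * q
      + const (const_term p) * (q - const (const_term q)) + const (const_term p * const_term q)"
    by (simp add: algebra_simps const_mult)
  ultimately show ?thesis by simp
qed

lemma hom_shift_same_const: "hom_shift a a p \<Longrightarrow> p = const (const_term p)"
  by (rule poly_mapping_eqI)
    (auto simp: const_def const_term_def lookup_single when_def hom_shift_def in_keys_iff)

lemma hom_shift_const_term: "hom_shift a b p \<Longrightarrow> a \<noteq> b \<Longrightarrow> const_term p = 0"
  by (auto simp: hom_shift_def const_term_def in_keys_iff)

lemma const_term_hom_part: "const_term p = 0 \<Longrightarrow> const_term (hom_part a b p) = 0"
  by (auto simp: const_term_def lookup_hom_part)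

lemma order2_0 [simp]: "order2 0"
  by (simp add: order2_def)

lemma order2_add: "order2 p \<Longrightarrow> order2 q \<Longrightarrow> order2 (p + q)"
  using Poly_Mapping.keys_add[of p q] by (auto simp: order2_def)

lemma order2_sum: "(\<And>i. i \<in> I \<Longrightarrow> order2 (f i)) \<Longrightarrow> order2 (sum f I)"
  by (induction I rule: infinite_finite_induct) (auto intro: order2_add)

lemma order2_mult:
  assumes "const_term p = 0" "const_term q = 0"
  shows "order2 (p * q)"
  unfolding order2_def
proof
  fix m assume "m \<in> Poly_Mapping.keys (p * q)"
  then obtain m1 m2 where "m = m1 + m2" "m1 \<in> Poly_Mapping.keys p" "m2 \<in> Poly_Mapping.keys q"
    using keys_mult by blast
  moreover from this have "mdeg m1 > 0" "mdeg m2 > 0"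
    using assms by (auto simp: const_term_def in_keys_iff intro!: gr0I)
  ultimately show "2 \<le> mdeg m" unfolding mdeg_add by simp
qed

lemma order2_linear: "order2 p \<Longrightarrow> homogeneous 1 p \<Longrightarrow> p = 0"
  by (rule poly_mapping_eqI) (force simp: order2_def homogeneous_def mdeg_def in_keys_iff)

subsection \<open>Linear forms are prime\<close>

definition pvar :: "'n \<Rightarrow> ('n, 'k::comm_ring_1) mpoly" where
  "pvar i = Poly_Mapping.single (Poly_Mapping.single i 1) 1"

definition psubst :: "('n \<Rightarrow> ('n::finite, 'k::comm_ring_1) mpoly) \<Rightarrow> ('n, 'k) mpoly \<Rightarrow> ('n, 'k) mpoly" where
  "psubst g p = (\<Sum>m\<in>Poly_Mapping.keys p. const (plookup p m) * (\<Prod>i\<in>UNIV. g i ^ Poly_Mapping.lookup m i))"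

lemma psubst_superset:
  assumes "finite K" "Poly_Mapping.keys p \<subseteq> K"
  shows "psubst g p = (\<Sum>m\<in>K. const (plookup p m) * (\<Prod>i\<in>UNIV. g i ^ Poly_Mapping.lookup m i))"
  unfolding psubst_def using assms by (intro sum.mono_neutral_left) (auto simp: in_keys_iff)

lemma psubst_add: "psubst g (p + q) = psubst g p + psubst g q"
proof -
  let ?K = "Poly_Mapping.keys p \<union> Poly_Mapping.keys q"
  have "psubst g r = (\<Sum>m\<in>?K. const (plookup r m) * (\<Prod>i\<in>UNIV. g i ^ Poly_Mapping.lookup m i))"
    if "r \<in> {p, q, p + q}" for r
    using that Poly_Mapping.keys_add[of p q] by (intro psubst_superset) auto
  then show ?thesis by (simp add: lookup_add const_add algebra_simps sum.distrib)
qed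

lemma psubst_0 [simp]: "psubst g 0 = 0"
  by (simp add: psubst_def)

lemma psubst_sum: "psubst g (sum f I) = (\<Sum>i\<in>I. psubst g (f i))"
  by (induction I rule: infinite_finite_induct) (auto simp: psubst_add)

lemma psubst_single: "psubst g (Poly_Mapping.single m c) = const c * (\<Prod>i\<in>UNIV. g i ^ Poly_Mapping.lookup m i)"
  by (subst psubst_superset[of "{m}"]) auto

lemma sum_singles: "p = (\<Sum>m\<in>Poly_Mapping.keys p. Poly_Mapping.single m (plookup p m))"
  by (rule poly_mapping_eqI) (simp add: lookup_sum lookup_single when_def in_keys_iff)

lemma psubst_mult: "psubst g (p * q) = psubst g p * psubst g q"
proof -
  have "p * q = (\<Sum>m\<in>Poly_Mapping.keys p. \<Sum>m'\<in>Poly_Mapping.keys q.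
      Poly_Mapping.single (m + m') (plookup p m * plookup q m'))"
    by (subst sum_singles[of p], subst sum_singles[of q]) (simp add: sum_product mult_single)
  moreover have "psubst g (Poly_Mapping.single (m + m') (a * b))
      = (const a * (\<Prod>i\<in>UNIV. g i ^ Poly_Mapping.lookup m i)) * (const b * (\<Prod>i\<in>UNIV. g i ^ Poly_Mapping.lookup m' i))"
    for m m' and a b :: 'b
    by (simp add: psubst_single lookup_add power_add prod.distrib const_mult[symmetric] mult_ac)
  ultimately show ?thesis by (simp add: psubst_sum psubst_def[of g p] psubst_def[of g q] sum_product)
qed

lemma psubst_pvar [simp]: "psubst g (pvar i) = g i"
proof -
  have "(\<Prod>j\<in>UNIV. g j ^ Poly_Mapping.lookup (Poly_Mapping.single i 1) j) = (\<Prod>j\<in>UNIV. if j = i then g i else 1)"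
    by (rule prod.cong) (auto simp: lookup_single when_def)
  then show ?thesis by (simp add: pvar_def psubst_single)
qed

lemma psubst_const [simp]: "psubst g (const c) = const c"
  unfolding const_def psubst_single by (simp add: const_def)

lemma pvar_power: "pvar i ^ e = Poly_Mapping.single (Poly_Mapping.single i e) 1"
  by (induction e) (simp_all add: pvar_def mult_single flip: single_add)

lemma psubst_pvars:
  fixes p :: "('n::finite, 'k::comm_ring_1) mpoly"
  shows "psubst pvar p = p"
proof -
  have "(\<Prod>i\<in>I. pvar i ^ Poly_Mapping.lookup m i)
      = Poly_Mapping.single (\<Sum>i\<in>I. Poly_Mapping.single i (Poly_Mapping.lookup m i)) (1::'k)" if "finite I"
    for I :: "'n set" and m
    using that by (induction I) (auto simp: pvar_power mult_single)
  moreover have "(\<Sum>i\<in>UNIV. Poly_Mapping.single i (Poly_Mapping.lookup m i)) = m" for m :: "'n \<Rightarrow>\<^sub>0 nat"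
    by (rule poly_mapping_eqI) (simp add: lookup_sum lookup_single when_def)
  ultimately have "(\<Prod>i\<in>UNIV. pvar i ^ Poly_Mapping.lookup m i) = (Poly_Mapping.single m 1 :: ('n, 'k) mpoly)" for m
    by simp
  then have "psubst pvar p = (\<Sum>m\<in>Poly_Mapping.keys p. Poly_Mapping.single m (plookup p m))"
    by (simp add: psubst_def const_def mult_single)
  then show ?thesis using sum_singles[of p] by simp
qed

lemma dvd_prod_diff:
  fixes f g :: "'a \<Rightarrow> 'b::comm_ring_1"
  assumes "\<And>i. i \<in> I \<Longrightarrow> d dvd f i - g i"
  shows "d dvd prod f I - prod g I"
  using assms
proof (induction I rule: infinite_finite_induct)
  case (insert i I)
  then have "d dvd (f i - g i) * prod f I + g i * (prod f I - prod g I)"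
    by (intro dvd_add dvd_mult dvd_mult2) auto
  with insert show ?case by (simp add: algebra_simps)
qed auto

text \<open>Modulo \<open>d\<close> the substitution fixes every variable, hence it is the identity
  on the quotient ring.\<close>

lemma dvd_diff_psubst:
  fixes p :: "('n::finite, 'k::comm_ring_1) mpoly"
  assumes "\<And>i. d dvd pvar i - g i"
  shows "d dvd p - psubst g p"
proof -
  have "d dvd pvar i ^ e - g i ^ e" for i e
    using dvd_prod_diff[of "{..<e}" d "\<lambda>_. pvar i" "\<lambda>_. g i"] assms[of i] by simp
  then have "d dvd const c * ((\<Prod>i\<in>UNIV. pvar i ^ Poly_Mapping.lookup m i) - (\<Prod>i\<in>UNIV. g i ^ Poly_Mapping.lookup m i))"
    for c m by (intro dvd_mult dvd_prod_diff)
  then have "d dvd psubst pvar p - psubst g p"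
    unfolding psubst_def sum_subtractf[symmetric] by (intro dvd_sum) (simp add: algebra_simps)
  then show ?thesis by (simp add: psubst_pvars)
qed

definition lin_coeff :: "('n, 'k::zero) mpoly \<Rightarrow> 'n \<Rightarrow> 'k" where
  "lin_coeff p i = plookup p (Poly_Mapping.single i 1)"

lemma linear_form_eq:
  fixes \<alpha> :: "('n::finite, 'k::comm_ring_1) mpoly"
  assumes "homogeneous 1 \<alpha>"
  shows "\<alpha> = (\<Sum>i\<in>UNIV. const (lin_coeff \<alpha> i) * pvar i)"
proof (rule poly_mapping_eqI)
  fix m
  have e: "const (lin_coeff \<alpha> i) * pvar i = Poly_Mapping.single (Poly_Mapping.single i 1) (lin_coeff \<alpha> i)" for i
    by (simp add: const_def pvar_def mult_single)
  show "plookup \<alpha> m = plookup (\<Sum>i\<in>UNIV. const (lin_coeff \<alpha> i) * pvar i) m"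
  proof (cases "mdeg m = 1")
    case True
    then obtain i where "m = Poly_Mapping.single i 1" using mdeg_eq_1_iff by blast
    then show ?thesis unfolding lookup_sum e by (simp add: lookup_single when_def lin_coeff_def)
  next
    case False
    then have "m \<notin> Poly_Mapping.keys \<alpha>" using assms by (auto simp: homogeneous_def mdeg_def)
    moreover have "Poly_Mapping.single i 1 \<noteq> m" for i using False by auto
    ultimately show ?thesis unfolding lookup_sum e by (simp add: lookup_single when_def in_keys_iff)
  qed
qed

lemma linear_form_nonzero_coeff:
  fixes \<alpha> :: "('n::finite, 'k::comm_ring_1) mpoly"
  assumes "homogeneous 1 \<alpha>" "\<alpha> \<noteq> 0"
  obtains i where "lin_coeff \<alpha> i \<noteq> 0"
proof -
  have "\<exists>i. lin_coeff \<alpha> i \<noteq> 0"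
  proof (rule ccontr)
    assume "\<nexists>i. lin_coeff \<alpha> i \<noteq> 0"
    with linear_form_eq[OF assms(1)] have "\<alpha> = 0" by simp
    with assms(2) show False ..
  qed
  with that show thesis by blast
qed

lemma peval_linear:
  fixes \<alpha> :: "('n::finite, 'k::comm_ring_1) mpoly"
  assumes "homogeneous 1 \<alpha>"
  shows "peval \<alpha> v = (\<Sum>i\<in>UNIV. lin_coeff \<alpha> i * vec_nth v i)"
proof -
  let ?s = "\<lambda>i. Poly_Mapping.single i (1::nat)"
  have "Poly_Mapping.keys \<alpha> \<subseteq> range ?s"
  proof
    fix m assume "m \<in> Poly_Mapping.keys \<alpha>"
    then have "mdeg m = 1" using assms by (auto simp: homogeneous_def mdeg_def)
    then show "m \<in> range ?s" using mdeg_eq_1_iff by blast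
  qed
  then have "peval \<alpha> v = (\<Sum>m\<in>range ?s. plookup \<alpha> m * (\<Prod>i\<in>UNIV. vec_nth v i ^ Poly_Mapping.lookup m i))"
    unfolding peval_def by (intro sum.mono_neutral_left) (auto simp: in_keys_iff)
  also have "\<dots> = (\<Sum>j\<in>UNIV. plookup \<alpha> (?s j) * (\<Prod>i\<in>UNIV. vec_nth v i ^ Poly_Mapping.lookup (?s j) i))"
    by (subst sum.reindex) (auto simp: inj_on_def)
  also have "\<dots> = (\<Sum>i\<in>UNIV. lin_coeff \<alpha> i * vec_nth v i)"
  proof (rule sum.cong[OF refl])
    fix j
    have "(\<Prod>i\<in>UNIV. vec_nth v i ^ Poly_Mapping.lookup (?s j) i) = (\<Prod>i\<in>UNIV. if i = j then vec_nth v i else 1)"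
      by (rule prod.cong) (auto simp: lookup_single when_def)
    then show "plookup \<alpha> (?s j) * (\<Prod>i\<in>UNIV. vec_nth v i ^ Poly_Mapping.lookup (?s j) i) = lin_coeff \<alpha> j * vec_nth v j"
      by (simp add: lin_coeff_def)
  qed
  finally show ?thesis .
qed

text \<open>Substituting for one variable so as to kill the form identifies \<open>S / \<alpha>\<close> with a subring of the
  domain \<open>S\<close>.\<close>

lemma linear_form_prime:
  fixes \<alpha> p q :: "('n::{finite,linorder}, 'k::field) mpoly"
  assumes "homogeneous 1 \<alpha>" "\<alpha> \<noteq> 0" "\<alpha> dvd p * q"
  shows "\<alpha> dvd p \<or> \<alpha> dvd q"
proof -
  obtain k where k: "lin_coeff \<alpha> k \<noteq> 0" using linear_form_nonzero_coeff assms by blast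
  \<comment> \<open>This solves \<open>\<alpha> = 0\<close> for a variable that occurs in
    \<open>\<alpha>\<close>: each \<open>g i\<close> is congruent to the variable modulo
    \<open>\<alpha>\<close>, while \<open>\<alpha>\<close> itself is sent to 0.\<close>
  define g where "g i = (if i = k then pvar k - const (inverse (lin_coeff \<alpha> k)) * \<alpha> else pvar i)" for i
  have "\<alpha> dvd pvar i - g i" for i by (auto simp: g_def)
  then have d: "\<alpha> dvd r - psubst g r" for r by (rule dvd_diff_psubst)
  have "psubst g \<alpha> = (\<Sum>i\<in>UNIV. const (lin_coeff \<alpha> i) * g i)"
    by (subst linear_form_eq[OF assms(1)]) (simp add: psubst_sum psubst_mult)
  also have "\<dots> = (\<Sum>i\<in>UNIV. const (lin_coeff \<alpha> i) * pvar i - (if i = k then \<alpha> else 0))"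
  proof (rule sum.cong[OF refl])
    fix i
    have "const (lin_coeff \<alpha> k) * (const (inverse (lin_coeff \<alpha> k)) * \<alpha>) = \<alpha>"
      using k by (simp add: const_mult mult.assoc[symmetric])
    then show "const (lin_coeff \<alpha> i) * g i = const (lin_coeff \<alpha> i) * pvar i - (if i = k then \<alpha> else 0)"
      by (auto simp: g_def algebra_simps)
  qed
  also have "\<dots> = 0"
    using linear_form_eq[OF assms(1)] by (simp add: sum_subtractf)
  finally have 0: "psubst g \<alpha> = 0" .
  \<comment> \<open>The ideal of \<open>\<alpha>\<close> is the kernel of a ring map into a domain,
    hence prime.\<close>
  have iff: "\<alpha> dvd r \<longleftrightarrow> psubst g r = 0" for r
  proof
    assume "\<alpha> dvd r"
    then show "psubst g r = 0" by (auto simp: dvd_def psubst_mult 0)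
  qed (use d[of r] in auto)
  show ?thesis using assms(3) by (simp add: iff psubst_mult)
qed

subsection \<open>Defining forms of hyperplanes\<close>

lemma defining_form_nonzero:
  fixes H :: "('k::field ^ 'n::finite) set"
  assumes "hyperplane H" "defining_form H \<alpha>"
  shows "\<alpha> \<noteq> 0"
proof
  assume "\<alpha> = 0"
  then have "H = UNIV" using assms(2) by (auto simp: defining_form_def peval_def)
  then show False using assms(1) by (simp add: hyperplane_def vec.dim_UNIV card_cart_basis)
qed

lemma peval_const_mult:
  assumes "homogeneous 1 (\<alpha> :: ('n::finite, 'k::field) mpoly)"
  shows "peval (const c * \<alpha>) v = c * peval \<alpha> v"
proof -
  have h: "homogeneous 1 (const c * \<alpha>)"
    using assms hom_shift_mult[of 1 1 "const c" 0 \<alpha>] by (simp add: homogeneous_iff_hom_shift)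
  have "lin_coeff (const c * \<alpha>) i = c * lin_coeff \<alpha> i" for i
  proof -
    have "const c * \<alpha> = Poly_Mapping.map ((*) c) \<alpha>"
      by (simp add: mult_map_scale_conv_mult const_def)
    then show ?thesis by (simp add: lin_coeff_def Poly_Mapping.map.rep_eq when_def)
  qed
  then show ?thesis by (simp add: peval_linear[OF h] peval_linear[OF assms] sum_distrib_left mult.assoc)
qed

lemma defining_form_eqD:
  fixes \<alpha> \<beta> :: "('n::finite, 'k::field) mpoly"
  assumes "defining_form H \<alpha>" "defining_form H \<beta>" "\<alpha> \<noteq> 0"
  obtains c where "\<beta> = const c * \<alpha>"
proof -
  have h: "homogeneous 1 \<alpha>" "homogeneous 1 \<beta>" and H: "H = {v. peval \<alpha> v = 0}" "H = {v. peval \<beta> v = 0}"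
    using assms by (auto simp: defining_form_def)
  obtain k where k: "lin_coeff \<alpha> k \<noteq> 0" using linear_form_nonzero_coeff h assms(3) by blast
  have c: "lin_coeff \<beta> i = lin_coeff \<beta> k * inverse (lin_coeff \<alpha> k) * lin_coeff \<alpha> i" for i
  proof (cases "i = k")
    case False
    \<comment> \<open>A vector of the hyperplane supported on the two coordinates \<open>i\<close>
      and \<open>k\<close>; that \<open>\<beta>\<close> vanishes on it is the vanishing of a 2 by 2
      minor of the coefficients of \<open>\<alpha>\<close> and \<open>\<beta>\<close>.\<close>
    define v where "v = (\<chi> j. if j = i then lin_coeff \<alpha> k else if j = k then - lin_coeff \<alpha> i else 0)"
    have s: "(\<Sum>j\<in>UNIV. f j * vec_nth v j) = f i * lin_coeff \<alpha> k - f k * lin_coeff \<alpha> i" for f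
    proof -
      have "(\<Sum>j\<in>UNIV. f j * vec_nth v j)
          = (\<Sum>j\<in>UNIV. (if j = i then f i * lin_coeff \<alpha> k else 0) + (if j = k then - (f k * lin_coeff \<alpha> i) else 0))"
        using False by (intro sum.cong) (auto simp: v_def)
      then show ?thesis by (simp add: sum.distrib)
    qed
    have "peval \<alpha> v = 0" by (simp add: peval_linear[OF h(1)] s)
    then have "peval \<beta> v = 0" using H by blast
    then have "lin_coeff \<beta> i * lin_coeff \<alpha> k = lin_coeff \<beta> k * lin_coeff \<alpha> i"
      by (simp add: peval_linear[OF h(2)] s)
    then show ?thesis using k by (simp add: field_simps)
  qed (use k in simp)
  have "\<beta> = (\<Sum>i\<in>UNIV. const (lin_coeff \<beta> i) * pvar i)" by (rule linear_form_eq[OF h(2)])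
  also have "\<dots> = const (lin_coeff \<beta> k * inverse (lin_coeff \<alpha> k)) * (\<Sum>i\<in>UNIV. const (lin_coeff \<alpha> i) * pvar i)"
    by (subst c) (simp add: sum_distrib_left const_mult mult.assoc[symmetric])
  also have "\<dots> = const (lin_coeff \<beta> k * inverse (lin_coeff \<alpha> k)) * \<alpha>"
    using linear_form_eq[OF h(1)] by simp
  finally show thesis by (rule that)
qed

lemma linear_dvd_linear:
  fixes \<alpha> \<beta> :: "('n::finite, 'k::field) mpoly"
  assumes "homogeneous 1 \<alpha>" "homogeneous 1 \<beta>" "\<alpha> dvd \<beta>"
  obtains c where "\<beta> = const c * \<alpha>"
proof -
  obtain q where q: "\<beta> = q * \<alpha>" using assms(3) by (auto simp: dvd_def mult.commute)
  have "\<beta> = hom_part 1 0 \<beta>" using assms(2) by (simp add: hom_part_id homogeneous_iff_hom_shift)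
  also have "\<dots> = hom_part 1 1 q * \<alpha>"
    unfolding q using assms(1) by (intro hom_part_mult) (simp add: homogeneous_iff_hom_shift)
  also have "hom_part 1 1 q = const (const_term (hom_part 1 1 q))"
    by (rule hom_shift_same_const[of 1]) simp
  finally show thesis by (rule that)
qed

lemma defining_form_not_dvd:
  fixes \<alpha> \<beta> :: "('n::finite, 'k::field) mpoly"
  assumes "hyperplane H'" "defining_form H \<alpha>" "defining_form H' \<beta>" "H \<noteq> H'"
  shows "\<not> \<alpha> dvd \<beta>"
proof
  assume "\<alpha> dvd \<beta>"
  moreover have h: "homogeneous 1 \<alpha>" "homogeneous 1 \<beta>" using assms by (auto simp: defining_form_def)
  ultimately obtain c where c: "\<beta> = const c * \<alpha>" using linear_dvd_linear by blast
  then have "c \<noteq> 0" using defining_form_nonzero[OF assms(1,3)] by auto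
  then have "H = H'" using assms(2,3) by (simp add: defining_form_def c peval_const_mult[OF h(1)])
  with assms(4) show False ..
qed

subsection \<open>Graded matrices\<close>

lemma graded_mat_iff:
  "graded_mat as bs P \<longleftrightarrow> P \<in> carrier_mat (length as) (length bs) \<and>
     (\<forall>j < length as. \<forall>k < length bs. hom_shift (as ! j) (bs ! k) (P $$ (j, k)))"
  by (simp add: graded_mat_def hom_shift_iff)

lemma graded_mat_carrier: "graded_mat as bs P \<Longrightarrow> P \<in> carrier_mat (length as) (length bs)"
  by (simp add: graded_mat_def)

lemma graded_mat_index:
  "graded_mat as bs P \<Longrightarrow> j < length as \<Longrightarrow> k < length bs \<Longrightarrow> hom_shift (as ! j) (bs ! k) (P $$ (j, k))"
  by (simp add: graded_mat_iff)

lemma mat_mult_index: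
  "A \<in> carrier_mat m n \<Longrightarrow> B \<in> carrier_mat n q \<Longrightarrow> i < m \<Longrightarrow> j < q \<Longrightarrow>
     (A * B) $$ (i, j) = (\<Sum>l<n. A $$ (i, l) * B $$ (l, j))"
  by (simp add: scalar_prod_def lessThan_atLeast0)

lemma graded_mat_mult:
  fixes P :: "('n::finite, 'k::comm_ring_1) mpoly mat"
  assumes P: "graded_mat as bs P" and Q: "graded_mat bs cs Q"
  shows "graded_mat as cs (P * Q)"
  unfolding graded_mat_iff
proof (intro conjI allI impI)
  show "P * Q \<in> carrier_mat (length as) (length cs)"
    using graded_mat_carrier[OF P] graded_mat_carrier[OF Q] by simp
  fix j k assume "j < length as" "k < length cs"
  then show "hom_shift (as ! j) (cs ! k) ((P * Q) $$ (j, k))"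
    by (subst mat_mult_index[OF graded_mat_carrier[OF P] graded_mat_carrier[OF Q]])
      (auto intro!: hom_shift_sum hom_shift_mult graded_mat_index[OF P] graded_mat_index[OF Q])
qed

text \<open>A homogeneous change of basis together with its inverse. The equality of degree
  multisets is carried along so that ranks and the degrees of complementary basis elements can be
  read off.\<close>

definition graded_equiv ::
  "nat list \<Rightarrow> nat list \<Rightarrow> ('n::finite, 'k::comm_ring_1) mpoly mat \<Rightarrow> ('n, 'k) mpoly mat \<Rightarrow> bool" where
  "graded_equiv as bs P Q \<longleftrightarrow> graded_mat as bs P \<and> graded_mat bs as Q \<and> mset as = mset bs \<and>
     P * Q = 1\<^sub>m (length as) \<and> Q * P = 1\<^sub>m (length bs)"

lemma graded_equivD:
  assumes "graded_equiv as bs P Q"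
  shows "graded_mat as bs P" "graded_mat bs as Q" "mset as = mset bs" "length as = length bs"
    "P \<in> carrier_mat (length bs) (length bs)" "Q \<in> carrier_mat (length bs) (length bs)"
    "P * Q = 1\<^sub>m (length bs)" "Q * P = 1\<^sub>m (length bs)"
  using assms mset_eq_length[of as bs] by (auto simp: graded_equiv_def dest: graded_mat_carrier)

lemma graded_equiv_one: "graded_equiv as as (1\<^sub>m (length as)) (1\<^sub>m (length as))"
  unfolding graded_equiv_def graded_mat_iff by auto

lemma graded_equiv_trans:
  assumes PQ: "graded_equiv as bs P Q" and PQ': "graded_equiv bs cs P' Q'"
  shows "graded_equiv as cs (P * P') (Q' * Q)"
proof -
  note 1 = graded_equivD[OF PQ] and 2 = graded_equivD[OF PQ']
  define n where "n = length cs"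
  have n: "length bs = n" "length as = n" using 1 2 by (auto simp: n_def)
  have c: "P \<in> carrier_mat n n" "Q \<in> carrier_mat n n" "P' \<in> carrier_mat n n" "Q' \<in> carrier_mat n n"
    using 1 2 n by auto
  have "P * P' * (Q' * Q) = P * (P' * (Q' * Q))"
    using c by (intro assoc_mult_mat[of _ n n _ n _ n]) auto
  also have "P' * (Q' * Q) = (P' * Q') * Q"
    using c by (intro assoc_mult_mat[of _ n n _ n _ n, symmetric]) auto
  finally have a: "P * P' * (Q' * Q) = 1\<^sub>m n" using 1 2 n c by simp
  have "Q' * Q * (P * P') = Q' * (Q * (P * P'))"
    using c by (intro assoc_mult_mat[of _ n n _ n _ n]) auto
  also have "Q * (P * P') = (Q * P) * P'"
    using c by (intro assoc_mult_mat[of _ n n _ n _ n, symmetric]) auto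
  finally have b: "Q' * Q * (P * P') = 1\<^sub>m n" using 1 2 n c by simp
  show ?thesis
    using 1 2 n a b by (auto simp: graded_equiv_def intro: graded_mat_mult)
qed

section \<open>Elementary homogeneous basis changes and Steinitz exchange\<close>

lemma graded_equiv_perm:
  assumes \<sigma>: "bij_betw \<sigma> {..<n} {..<n}" and len: "length as = n" "length as' = n"
    and as': "\<And>i. i < n \<Longrightarrow> as' ! i = as ! \<sigma> i"
  shows "graded_equiv as' as (mat n n (\<lambda>(i, j). if j = \<sigma> i then 1 else 0))
     (mat n n (\<lambda>(i, j). if i = \<sigma> j then 1 else 0))" (is "graded_equiv _ _ ?P ?Q")
proof -
  have in_n: "\<sigma> i < n" if "i < n" for i using \<sigma> that by (auto dest: bij_betwE)
  have inj: "\<sigma> i = \<sigma> j \<longleftrightarrow> i = j" if "i < n" "j < n" for i j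
    using \<sigma> that by (auto simp: bij_betw_def inj_on_def)
  have "mset as' = image_mset (\<lambda>i. as ! \<sigma> i) (mset_set {..<n})"
  proof -
    have "as' = map (\<lambda>i. as ! \<sigma> i) [0..<n]" using as' len by (intro nth_equalityI) auto
    then show ?thesis by (simp add: lessThan_atLeast0)
  qed
  also have "\<dots> = image_mset (\<lambda>i. as ! i) (image_mset \<sigma> (mset_set {..<n}))"
    by (simp add: image_mset.compositionality comp_def)
  also have "image_mset \<sigma> (mset_set {..<n}) = mset_set {..<n}"
    using \<sigma> by (simp add: image_mset_mset_set bij_betw_def)
  also have "image_mset (\<lambda>i. as ! i) (mset_set {..<n}) = mset as"
  proof -
    have "as = map (\<lambda>i. as ! i) [0..<n]" using map_nth[of as] len by simp
    then show ?thesis by (metis mset_map mset_upt lessThan_atLeast0)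
  qed
  finally have ms: "mset as' = mset as" .
  have PQ: "?P * ?Q = 1\<^sub>m n"
  proof (rule eq_matI)
    fix i j assume ij: "i < dim_row (1\<^sub>m n)" "j < dim_col (1\<^sub>m n)"
    then have "(?P * ?Q) $$ (i, j) = (\<Sum>l<n. (if l = \<sigma> i then 1 else 0) * (if l = \<sigma> j then 1 else 0))"
      by (subst mat_mult_index[of _ n n _ n]) auto
    also have "\<dots> = (\<Sum>l<n. if l = \<sigma> i then (if i = j then 1 else 0) else 0)"
      using ij by (intro sum.cong) (auto simp: inj)
    finally show "(?P * ?Q) $$ (i, j) = 1\<^sub>m n $$ (i, j)" using ij in_n[of i] by (simp add: inj)
  qed auto
  have QP: "?Q * ?P = 1\<^sub>m n"
  proof (rule eq_matI)
    fix i j assume ij: "i < dim_row (1\<^sub>m n)" "j < dim_col (1\<^sub>m n)"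
    then obtain i' where i': "i' < n" "i = \<sigma> i'" using \<sigma> by (auto simp: bij_betw_def)
    have "(?Q * ?P) $$ (i, j) = (\<Sum>l<n. (if i = \<sigma> l then 1 else 0) * (if j = \<sigma> l then 1 else 0))"
      using ij by (subst mat_mult_index[of _ n n _ n]) auto
    also have "\<dots> = (\<Sum>l<n. if l = i' then (if i = j then 1 else 0) else 0)"
      using ij i' by (intro sum.cong) (auto simp: inj)
    finally show "(?Q * ?P) $$ (i, j) = 1\<^sub>m n $$ (i, j)" using ij i' by simp
  qed auto
  show ?thesis
    unfolding graded_equiv_def graded_mat_iff using PQ QP len as' ms by auto
qed

text \<open>The entry \<open>y i\<close> has degree 0, so it is a constant, and a nonzero one is a
  unit; this allows the exchange of the basis element \<open>i\<close> for \<open>y\<close>.\<close>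

lemma graded_equiv_replace_row:
  fixes y :: "nat \<Rightarrow> ('n::{finite,linorder}, 'k::field) mpoly"
  assumes i: "i < length as" and y: "\<And>k. k < length as \<Longrightarrow> hom_shift (as ! i) (as ! k) (y k)"
    and unit: "const_term (y i) \<noteq> 0"
  defines "n \<equiv> length as"
  defines "E \<equiv> \<lambda>y. mat n n (\<lambda>(r, k). if r = i then y k else if r = k then 1 else 0)"
  shows "\<exists>Q. graded_equiv as as (E y) Q"
proof -
  define u where "u = inverse (const_term (y i))"
  \<comment> \<open>The inverse matrix has the same shape, with row \<open>i\<close> obtained by
    solving the equation of \<open>y\<close> for the old basis element.\<close>
  define z where "z k = (if k = i then const u else - (const u * y k))" for k
  have yi: "y i = const (const_term (y i))" using y[OF i] by (rule hom_shift_same_const)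
  have uy: "const u * y i = 1" using unit by (subst yi) (simp add: u_def)
  have E: "E a * E b = 1\<^sub>m n"
    if ab: "\<And>k. k < n \<Longrightarrow> a i * b k + (if k = i then 0 else a k) = (if k = i then 1 else 0)" for a b
  proof (rule eq_matI)
    fix r k assume "r < dim_row (1\<^sub>m n)" "k < dim_col (1\<^sub>m n)"
    then have rk: "r < n" "k < n" by auto
    have "(E a * E b) $$ (r, k) = (\<Sum>l<n. E a $$ (r, l) * E b $$ (l, k))"
      using rk by (intro mat_mult_index) (auto simp: E_def)
    also have "\<dots> = 1\<^sub>m n $$ (r, k)"
    proof (cases "r = i")
      case True
      have "(\<Sum>l<n. E a $$ (r, l) * E b $$ (l, k))
          = (\<Sum>l<n. (if l = i then a i * b k else 0) + (if l = k then (if k = i then 0 else a k) else 0))"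
        using rk True by (intro sum.cong) (auto simp: E_def)
      then show ?thesis using rk True i ab[of k] by (simp add: sum.distrib n_def)
    next
      case False
      have "(\<Sum>l<n. E a $$ (r, l) * E b $$ (l, k)) = (\<Sum>l<n. if l = r then (if r = k then 1 else 0) else 0)"
        using rk False by (intro sum.cong) (auto simp: E_def)
      then show ?thesis using rk False by simp
    qed
    finally show "(E a * E b) $$ (r, k) = 1\<^sub>m n $$ (r, k)" .
  qed (auto simp: E_def)
  have yz: "E y * E z = 1\<^sub>m n"
  proof (rule E)
    fix k assume "k < n"
    have "y i * (const u * y k) = const u * y i * y k" by (simp only: mult_ac)
    then have "y i * (const u * y k) = y k" by (simp add: uy)
    then show "y i * z k + (if k = i then 0 else y k) = (if k = i then 1 else 0)"
      using uy by (auto simp: z_def mult.commute)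
  qed
  have zy: "E z * E y = 1\<^sub>m n"
    by (rule E) (auto simp: z_def uy)
  have z: "hom_shift (as ! i) (as ! k) (z k)" if "k < n" for k
    using y[of k] that hom_shift_mult[OF hom_shift_const, of "as ! i" "as ! k" "y k" u]
    by (auto simp: z_def n_def)
  show ?thesis
    using yz zy y z by (intro exI[of _ "E z"]) (auto simp: graded_equiv_def graded_mat_iff E_def n_def)
qed

text \<open>Steinitz exchange, one row at a time: modulo the earlier rows, the next row has a constant
  entry outside of the columns already used.\<close>

lemma graded_basis_extension:
  fixes T :: "('n::{finite,linorder}, 'k::field) mpoly mat"
  assumes T: "graded_mat bs as T"
    and indep: "\<And>c. (\<And>k. k < length as \<Longrightarrow> (\<Sum>j<length bs. c j * const_term (T $$ (j, k))) = 0)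
      \<Longrightarrow> \<forall>j<length bs. c j = 0"
  shows "\<exists>rest P Q. graded_equiv (bs @ rest) as P Q \<and>
     (\<forall>j<length bs. \<forall>k<length as. P $$ (j, k) = T $$ (j, k))"
proof -
  define n where "n = length as"
  \<comment> \<open>Induction on the number \<open>p\<close> of rows of \<open>T\<close> that
    already form the beginning of the basis.\<close>
  have "\<exists>as' P Q. graded_equiv as' as P Q \<and> p \<le> n \<and> take p as' = take p bs \<and>
     (\<forall>j<p. \<forall>k<n. P $$ (j, k) = T $$ (j, k))" if "p \<le> length bs" for p
    using that
  proof (induction p)
    case 0
    show ?case using graded_equiv_one[of as] by auto
  next
    case (Suc p)
    then obtain as' P Q where PQ: "graded_equiv as' as P Q" and pn: "p \<le> n"
      and tk: "take p as' = take p bs" and rows: "\<And>j k. j < p \<Longrightarrow> k < n \<Longrightarrow> P $$ (j, k) = T $$ (j, k)"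
      by auto
    note D = graded_equivD[OF PQ]
    have len: "length as' = n" using D by (simp add: n_def)
    have p: "p < length bs" using Suc.prems by simp
    have cT: "T \<in> carrier_mat (length bs) n" using graded_mat_carrier[OF T] by (simp add: n_def)
    have cP: "P \<in> carrier_mat n n" and cQ: "Q \<in> carrier_mat n n" using D by (auto simp: n_def)
    \<comment> \<open>Coordinates of the next row of \<open>T\<close> in the current basis.\<close>
    define y where "y k = (T * Q) $$ (p, k)" for k
    have y: "hom_shift (bs ! p) (as' ! k) (y k)" if "k < n" for k
      using graded_mat_mult[OF T D(2)] p that by (auto simp: y_def len graded_mat_iff)
    have yP: "(\<Sum>l<n. y l * P $$ (l, k)) = T $$ (p, k)" if "k < n" for k
    proof -
      have "(\<Sum>l<n. y l * P $$ (l, k)) = (T * Q * P) $$ (p, k)"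
        using that p cT cQ cP by (subst mat_mult_index[of _ "length bs" n _ n]) (auto simp: y_def)
      also have "T * Q * P = T"
        using D cT cQ cP by (simp add: assoc_mult_mat[of _ _ n _ n _ n] n_def)
      finally show ?thesis .
    qed
    \<comment> \<open>Otherwise, at the level of constant terms, row \<open>p\<close> would be a
      combination of the rows before it, which contradicts \<open>indep\<close> with coefficient -1
      at \<open>p\<close>.\<close>
    have "\<exists>k. p \<le> k \<and> k < n \<and> const_term (y k) \<noteq> 0"
    proof (rule ccontr)
      assume "\<nexists>k. p \<le> k \<and> k < n \<and> const_term (y k) \<noteq> 0"
      then have z: "const_term (y l) = 0" if "l < n" "\<not> l < p" for l using that by auto
      define c where "c j = (if j < p then const_term (y j) else if j = p then - 1 else 0)" for j
      have "(\<Sum>j<length bs. c j * const_term (T $$ (j, k))) = 0" if k: "k < n" for k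
      proof -
        have "(\<Sum>j<length bs. c j * const_term (T $$ (j, k))) = (\<Sum>j<Suc p. c j * const_term (T $$ (j, k)))"
          using p by (intro sum.mono_neutral_right) (auto simp: c_def)
        also have "\<dots> = (\<Sum>j<p. const_term (y j) * const_term (P $$ (j, k))) - const_term (T $$ (p, k))"
          using rows k by (simp add: c_def)
        also have "(\<Sum>j<p. const_term (y j) * const_term (P $$ (j, k)))
            = (\<Sum>j<n. const_term (y j) * const_term (P $$ (j, k)))"
          using pn z by (intro sum.mono_neutral_left) auto
        also have "\<dots> = const_term (T $$ (p, k))"
          using yP[OF k] by (simp flip: const_term_mult const_term_sum)
        finally show ?thesis by simp
      qed
      then have "c p = 0" using indep[of c] p by (simp add: n_def)
      then show False by (simp add: c_def)
    qed
    then obtain k where k: "p \<le> k" "k < n" "const_term (y k) \<noteq> 0" by blast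
    have kp: "as' ! k = bs ! p" using hom_shift_const_term[OF y[OF k(2)]] k(3) by metis
    define E where "E = mat n n (\<lambda>(r, l). if r = k then y l else if r = l then 1 else (0 :: ('n, 'k) mpoly))"
    obtain E' where E': "graded_equiv as' as' E E'"
      using graded_equiv_replace_row[of k as' y] k y by (auto simp: E_def len kp)
    \<comment> \<open>The new basis element was placed at position \<open>k\<close>; the swap brings
      it to position \<open>p\<close> and leaves the earlier ones alone.\<close>
    define \<sigma> where "\<sigma> = Transposition.transpose p k"
    define as'' where "as'' = map (\<lambda>i. as' ! \<sigma> i) [0..<n]"
    have \<sigma>: "bij_betw \<sigma> {..<n} {..<n}"
      using k pn unfolding \<sigma>_def by (intro permutes_imp_bij permutes_swap_id) auto
    define S where "S = mat n n (\<lambda>(i, j). if j = \<sigma> i then 1 else (0 :: ('n, 'k) mpoly))"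
    obtain S' where S': "graded_equiv as'' as' S S'"
      using graded_equiv_perm[OF \<sigma>, of as' as''] by (auto simp: S_def as''_def len)
    have tr: "graded_equiv as'' as (S * (E * P)) ((Q * E') * S')"
      by (intro graded_equiv_trans[OF S'] graded_equiv_trans[OF E'] PQ)
    have EP: "(E * P) $$ (r, l) = (if r = k then T $$ (p, l) else P $$ (r, l))" if "r < n" "l < n" for r l
    proof -
      have "(E * P) $$ (r, l) = (\<Sum>i<n. E $$ (r, i) * P $$ (i, l))"
        using that cP by (intro mat_mult_index) (auto simp: E_def)
      also have "\<dots> = (if r = k then T $$ (p, l) else P $$ (r, l))"
      proof (cases "r = k")
        case True
        then show ?thesis using yP[of l] that by (auto simp: E_def)
      next
        case False
        then have "(\<Sum>i<n. E $$ (r, i) * P $$ (i, l)) = (\<Sum>i<n. if i = r then P $$ (r, l) else 0)"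
          using that by (intro sum.cong) (auto simp: E_def)
        then show ?thesis using False that by simp
      qed
      finally show ?thesis .
    qed
    have SEP: "(S * (E * P)) $$ (r, l) = (E * P) $$ (\<sigma> r, l)" if "r < n" "l < n" for r l
    proof -
      have "(S * (E * P)) $$ (r, l) = (\<Sum>i<n. S $$ (r, i) * (E * P) $$ (i, l))"
        using that cP by (intro mat_mult_index) (auto simp: S_def E_def)
      also have "\<dots> = (\<Sum>i<n. if i = \<sigma> r then (E * P) $$ (\<sigma> r, l) else 0)"
        using that by (intro sum.cong) (auto simp: S_def)
      finally show ?thesis using that bij_betwE[OF \<sigma>] by simp
    qed
    have \<sigma>_less: "\<sigma> i = i" if "i < p" for i using that k by (auto simp: \<sigma>_def Transposition.transpose_def)
    have \<sigma>_p: "\<sigma> p = k" by (simp add: \<sigma>_def)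
    have \<sigma>_n: "\<sigma> i < n" if "i < n" for i using that bij_betwE[OF \<sigma>] by auto
    have "(S * (E * P)) $$ (j, l) = T $$ (j, l)" if "j < Suc p" "l < n" for j l
    proof (cases "j = p")
      case True
      then show ?thesis using that k pn by (simp add: SEP EP \<sigma>_p)
    next
      case False
      then show ?thesis using that k pn rows by (simp add: SEP EP \<sigma>_less)
    qed
    moreover have "take (Suc p) as'' = take (Suc p) bs"
    proof (rule nth_equalityI)
      show "length (take (Suc p) as'') = length (take (Suc p) bs)" using k p by (simp add: as''_def)
      fix i assume "i < length (take (Suc p) as'')"
      then have i: "i < Suc p" "i < n" using k by (auto simp: as''_def)
      have "as' ! i = bs ! i" if "i < p" using arg_cong[OF tk, of "\<lambda>xs. xs ! i"] that by simp
      then show "take (Suc p) as'' ! i = take (Suc p) bs ! i"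
        using i kp by (cases "i = p") (auto simp: as''_def \<sigma>_less \<sigma>_p)
    qed
    ultimately show ?case using tr k by (intro exI[of _ as''] exI[of _ "S * (E * P)"] exI[of _ "Q * E' * S'"]) auto
  qed
  from this[of "length bs"] obtain as' P Q where *: "graded_equiv as' as P Q" "length bs \<le> n"
    "take (length bs) as' = bs" "\<forall>j<length bs. \<forall>k<n. P $$ (j, k) = T $$ (j, k)" by auto
  then have "as' = bs @ drop (length bs) as'" by (metis append_take_drop_id)
  with * show ?thesis unfolding n_def by metis
qed

lemma graded_basis_extension_mset:
  fixes T :: "('n::{finite,linorder}, 'k::field) mpoly mat"
  assumes T: "graded_mat bs as T"
    and indep: "\<And>c. (\<And>k. k < length as \<Longrightarrow> (\<Sum>j<length bs. c j * const_term (T $$ (j, k))) = 0)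
      \<Longrightarrow> \<forall>j<length bs. c j = 0"
    and rest: "mset (bs @ rest) = mset as"
  shows "\<exists>P Q. graded_equiv (bs @ rest) as P Q \<and>
     (\<forall>j<length bs. \<forall>k<length as. P $$ (j, k) = T $$ (j, k))"
proof -
  obtain rest' P Q where PQ: "graded_equiv (bs @ rest') as P Q"
    and rows: "\<forall>j<length bs. \<forall>k<length as. P $$ (j, k) = T $$ (j, k)"
    using graded_basis_extension[OF T indep] by blast
  note D = graded_equivD[OF PQ]
  define p n where "p = length bs" and "n = length as"
  have "mset bs + mset rest = mset bs + mset rest'" using D(3) rest by simp
  then have "mset rest = mset rest'" by (rule add_left_imp_eq)
  then obtain \<tau> where \<tau>: "\<tau> permutes {..<length rest'}" "permute_list \<tau> rest' = rest"
    by (rule mset_eq_permutation)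
  have len: "length rest' = length rest" "p + length rest = n"
    using \<tau> D(4) by (auto simp: p_def n_def)
  \<comment> \<open>The complement produced by the exchange has the prescribed degrees in some
    order; only its part of the basis is permuted, so the rows of \<open>T\<close> stay in
    place.\<close>
  define \<sigma> where "\<sigma> i = (if i < p then i else p + \<tau> (i - p))" for i
  have \<tau>_less: "\<tau> i < length rest" if "i < length rest" for i
    using permutes_in_image[OF \<tau>(1)] that len by auto
  have \<sigma>: "bij_betw \<sigma> {..<n} {..<n}"
  proof -
    have "inj_on \<sigma> {..<n}"
    proof (rule inj_onI)
      fix i j assume ij: "\<sigma> i = \<sigma> j"
      have "i - p = j - p" if "\<tau> (i - p) = \<tau> (j - p)"
        using permutes_inj[OF \<tau>(1)] that by (rule injD)
      with ij show "i = j" by (auto simp: \<sigma>_def split: if_splits)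
    qed
    moreover have "\<sigma> ` {..<n} \<subseteq> {..<n}"
    proof safe
      fix i assume "i < n"
      then show "\<sigma> i < n" using \<tau>_less[of "i - p"] len by (auto simp: \<sigma>_def)
    qed
    ultimately show ?thesis by (simp add: bij_betw_def endo_inj_surj)
  qed
  have "rest ! i = rest' ! \<tau> i" if "i < length rest" for i
    using permute_list_nth[OF \<tau>(1), of i] that len by (simp add: \<tau>(2))
  then have nth: "(bs @ rest) ! i = (bs @ rest') ! \<sigma> i" if "i < n" for i
    using that len(2) by (auto simp: \<sigma>_def nth_append p_def)
  define S where "S = mat n n (\<lambda>(i, j). if j = \<sigma> i then 1 else (0 :: ('n, 'k) mpoly))"
  obtain S' where S': "graded_equiv (bs @ rest) (bs @ rest') S S'"
    using graded_equiv_perm[OF \<sigma>, of "bs @ rest'" "bs @ rest"] nth len by (auto simp: S_def p_def)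
  have cP: "P \<in> carrier_mat n n" using D by (simp add: n_def)
  have "(S * P) $$ (j, l) = T $$ (j, l)" if "j < p" "l < n" for j l
  proof -
    have "(S * P) $$ (j, l) = (\<Sum>i<n. S $$ (j, i) * P $$ (i, l))"
      using that cP len by (intro mat_mult_index[of _ n n _ n]) (auto simp: S_def)
    also have "\<dots> = (\<Sum>i<n. if i = j then P $$ (j, l) else 0)"
      using that len by (intro sum.cong) (auto simp: S_def \<sigma>_def)
    finally show ?thesis using that len rows by (simp add: p_def n_def)
  qed
  with graded_equiv_trans[OF S' PQ] show ?thesis unfolding p_def n_def by blast
qed

subsection \<open>Graded free modules and their maps\<close>

lemma row_map_carrier: "P \<in> carrier_mat m n \<Longrightarrow> row_map P v \<in> carrier_vec n"
  unfolding row_map_def by (intro carrier_vecI) auto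

lemma row_map_index:
  "P \<in> carrier_mat m n \<Longrightarrow> v \<in> carrier_vec m \<Longrightarrow> k < n \<Longrightarrow>
     vec_index (row_map P v) k = (\<Sum>j<m. vec_index v j * P $$ (j, k))"
  by (auto simp: row_map_def scalar_prod_def lessThan_atLeast0 mult.commute intro!: sum.cong)


lemma row_map_mult:
  fixes A B :: "'a::comm_ring_1 mat"
  assumes A: "A \<in> carrier_mat m n" and B: "B \<in> carrier_mat n q" and v: "v \<in> carrier_vec m"
  shows "row_map (A * B) v = row_map B (row_map A v)"
proof (rule eq_vecI)
  have AB: "A * B \<in> carrier_mat m q" using A B by simp
  have Av: "row_map A v \<in> carrier_vec n" using A by (rule row_map_carrier)
  show "dim_vec (row_map (A * B) v) = dim_vec (row_map B (row_map A v))"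
    using row_map_carrier[OF AB] row_map_carrier[OF B] by (metis carrier_vecD)
  fix k assume "k < dim_vec (row_map B (row_map A v))"
  then have k: "k < q" using row_map_carrier[OF B] by (metis carrier_vecD)
  have "vec_index (row_map (A * B) v) k = (\<Sum>j<m. \<Sum>l<n. vec_index v j * A $$ (j, l) * B $$ (l, k))"
    using k by (simp add: row_map_index[OF AB v k] mat_mult_index[OF A B] sum_distrib_left mult.assoc del: index_mult_mat)
  also have "\<dots> = (\<Sum>l<n. \<Sum>j<m. vec_index v j * A $$ (j, l) * B $$ (l, k))" by (rule sum.swap)
  also have "\<dots> = vec_index (row_map B (row_map A v)) k"
    by (simp add: row_map_index[OF B Av k] row_map_index[OF A v] sum_distrib_right)
  finally show "vec_index (row_map (A * B) v) k = vec_index (row_map B (row_map A v)) k" .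
qed

lemma row_map_one: "v \<in> carrier_vec n \<Longrightarrow> row_map (1\<^sub>m n) v = v"
  by (simp add: row_map_def)

lemma row_map_zero: "A \<in> carrier_mat m n \<Longrightarrow> row_map A (0\<^sub>v m) = 0\<^sub>v n"
  for A :: "'a::comm_ring_1 mat"
  using carrier_vecD[OF row_map_carrier[of A m n]] by (intro eq_vecI) (auto simp: row_map_index[of A m n])

lemma row_map_unit_vec: "A \<in> carrier_mat m n \<Longrightarrow> i < m \<Longrightarrow> row_map A (unit_vec m i) = row A i"
  for A :: "'a::comm_ring_1 mat"
proof (rule eq_vecI)
  assume A: "A \<in> carrier_mat m n" and i: "i < m"
  then show "dim_vec (row_map A (unit_vec m i)) = dim_vec (row A i)"
    using carrier_vecD[OF row_map_carrier[OF A]] by simp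
  fix k assume "k < dim_vec (row A i)"
  then have k: "k < n" using A by simp
  have "vec_index (row_map A (unit_vec m i)) k = (\<Sum>j<m. vec_index (unit_vec m i) j * A $$ (j, k))"
    using A k by (intro row_map_index) auto
  also have "\<dots> = (\<Sum>j<m. if j = i then A $$ (i, k) else 0)"
    using i by (intro sum.cong) auto
  finally show "vec_index (row_map A (unit_vec m i)) k = vec_index (row A i) k" using A i k by simp
qed

lemma row_map_equiv:
  assumes "graded_equiv as bs P Q"
  shows "v \<in> carrier_vec (length bs) \<Longrightarrow> row_map P (row_map Q v) = v"
    and "v \<in> carrier_vec (length as) \<Longrightarrow> row_map Q (row_map P v) = v"
  using graded_equivD[OF assms]
  by (simp_all add: row_map_one flip: row_map_mult[of P "length bs" "length bs" Q "length bs"]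
      row_map_mult[of Q "length bs" "length bs" P "length bs"])

definition hom_vec :: "nat \<Rightarrow> nat list \<Rightarrow> ('n::finite, 'k::zero) mpoly Matrix.vec \<Rightarrow> bool" where
  "hom_vec a bs v \<longleftrightarrow> v \<in> carrier_vec (length bs) \<and> (\<forall>k < length bs. hom_shift a (bs ! k) (vec_index v k))"

definition part_vec :: "nat \<Rightarrow> nat list \<Rightarrow> ('n::finite, 'k::zero) mpoly Matrix.vec \<Rightarrow> ('n, 'k) mpoly Matrix.vec" where
  "part_vec a bs v = Matrix.vec (length bs) (\<lambda>k. hom_part a (bs ! k) (vec_index v k))"

definition der_part :: "nat \<Rightarrow> ('n::finite, 'k::zero) der \<Rightarrow> ('n, 'k) der" where
  "der_part a \<theta> = (\<chi> i. hom_part a 0 (vec_nth \<theta> i))"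

lemma homogeneous_der_iff: "homogeneous_der d \<theta> \<longleftrightarrow> (\<forall>i. hom_shift d 0 (vec_nth \<theta> i))"
  by (simp add: homogeneous_der_def homogeneous_iff_hom_shift)

lemma hom_vec_part_vec [simp]: "hom_vec a bs (part_vec a bs v)"
  by (simp add: hom_vec_def part_vec_def)

lemma part_vec_id: "hom_vec a bs v \<Longrightarrow> part_vec a bs v = v"
  by (rule eq_vecI) (auto simp: hom_vec_def part_vec_def hom_part_id)

text \<open>Allows an arbitrary preimage of a homogeneous vector to be replaced by one of its
  homogeneous components.\<close>

lemma part_vec_row_map:
  fixes R :: "('n::finite, 'k::comm_ring_1) mpoly mat"
  assumes R: "graded_mat as bs R" and v: "v \<in> carrier_vec (length as)"
  shows "row_map R (part_vec a as v) = part_vec a bs (row_map R v)"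
proof (rule eq_vecI)
  note c = graded_mat_carrier[OF R]
  have pv: "part_vec a as v \<in> carrier_vec (length as)" by (simp add: part_vec_def)
  show "dim_vec (row_map R (part_vec a as v)) = dim_vec (part_vec a bs (row_map R v))"
    using carrier_vecD[OF row_map_carrier[OF c]] by (simp add: part_vec_def)
  fix k assume "k < dim_vec (part_vec a bs (row_map R v))"
  then have k: "k < length bs" by (simp add: part_vec_def)
  have "vec_index (part_vec a bs (row_map R v)) k
      = (\<Sum>j<length as. hom_part a (bs ! k) (vec_index v j * R $$ (j, k)))"
    using k by (simp add: part_vec_def row_map_index[OF c v k] hom_part_sum)
  also have "\<dots> = (\<Sum>j<length as. hom_part a (as ! j) (vec_index v j) * R $$ (j, k))"
    using k by (intro sum.cong refl hom_part_mult graded_mat_index[OF R]) auto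
  also have "\<dots> = vec_index (row_map R (part_vec a as v)) k"
    by (subst row_map_index[OF c pv k]) (simp add: part_vec_def)
  finally show "vec_index (row_map R (part_vec a as v)) k = vec_index (part_vec a bs (row_map R v)) k" ..
qed

lemma graded_mat_row: "graded_mat as bs P \<Longrightarrow> j < length as \<Longrightarrow> hom_vec (as ! j) bs (row P j)"
  by (auto simp: graded_mat_iff hom_vec_def)

lemma der_comb_nth: "vec_nth (der_comb gs v) i = (\<Sum>j<length gs. vec_index v j * vec_nth (gs ! j) i)"
  by (simp add: der_comb_def)

lemma der_part_comb:
  fixes gs :: "('n::finite, 'k::comm_ring_1) der list"
  assumes gs: "list_all2 homogeneous_der as gs"
  shows "der_comb gs (part_vec a as v) = der_part a (der_comb gs v)"
proof (rule Finite_Cartesian_Product.vec_eq_iff[THEN iffD2], rule allI)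
  fix i
  have len: "length as = length gs" using gs by (rule list_all2_lengthD)
  have "vec_nth (der_part a (der_comb gs v)) i
      = (\<Sum>j<length gs. hom_part a 0 (vec_index v j * vec_nth (gs ! j) i))"
    by (simp add: der_part_def der_comb_nth hom_part_sum)
  also have "\<dots> = (\<Sum>j<length gs. hom_part a (as ! j) (vec_index v j) * vec_nth (gs ! j) i)"
    using list_all2_nthD2[OF gs] by (intro sum.cong refl hom_part_mult) (auto simp: homogeneous_der_iff)
  finally show "vec_nth (der_comb gs (part_vec a as v)) i = vec_nth (der_part a (der_comb gs v)) i"
    by (simp add: der_comb_nth part_vec_def len)
qed

lemma der_part_id: "homogeneous_der a \<theta> \<Longrightarrow> der_part a \<theta> = \<theta>"
  by (simp add: der_part_def homogeneous_der_iff hom_part_id Finite_Cartesian_Product.vec_eq_iff)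

lemma homogeneous_der_part: "homogeneous_der a (der_part a \<theta>)"
  by (simp add: der_part_def homogeneous_der_iff)

lemma homogeneous_der_comb:
  fixes gs :: "('n::finite, 'k::comm_ring_1) der list"
  assumes "list_all2 homogeneous_der as gs" "hom_vec a as v"
  shows "homogeneous_der a (der_comb gs v)"
  using der_part_comb[OF assms(1), of a v] part_vec_id[OF assms(2)] homogeneous_der_part by metis

lemma der_comb_map_row:
  assumes P: "P \<in> carrier_mat m (length gs)" and v: "v \<in> carrier_vec m"
  shows "der_comb (map (\<lambda>j. der_comb gs (row P j)) [0..<m]) v = der_comb gs (row_map P v)"
proof (rule Finite_Cartesian_Product.vec_eq_iff[THEN iffD2], rule allI)
  fix i
  have "vec_nth (der_comb (map (\<lambda>j. der_comb gs (row P j)) [0..<m]) v) i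
      = (\<Sum>j<m. \<Sum>l<length gs. vec_index v j * P $$ (j, l) * vec_nth (gs ! l) i)"
    using P by (simp add: der_comb_nth sum_distrib_left mult.assoc)
  also have "\<dots> = (\<Sum>l<length gs. \<Sum>j<m. vec_index v j * P $$ (j, l) * vec_nth (gs ! l) i)"
    by (rule sum.swap)
  also have "\<dots> = vec_nth (der_comb gs (row_map P v)) i"
    by (simp add: der_comb_nth row_map_index[OF P v] sum_distrib_right)
  finally show "vec_nth (der_comb (map (\<lambda>j. der_comb gs (row P j)) [0..<m]) v) i
      = vec_nth (der_comb gs (row_map P v)) i" .
qed

lemma der_comb_zero [simp]: "der_comb gs (0\<^sub>v (length gs)) = 0"
  by (simp add: der_comb_def)

subsection \<open>Change of bases in a minimal resolution\<close>

definition irrelevant_mat :: "('n::finite, 'k::zero) mpoly mat \<Rightarrow> bool" where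
  "irrelevant_mat R \<longleftrightarrow> (\<forall>j < dim_row R. \<forall>c < dim_col R. const_term (R $$ (j, c)) = 0)"

lemma irrelevant_mat_mult:
  fixes A B :: "('n::finite, 'k::comm_ring_1) mpoly mat"
  assumes A: "A \<in> carrier_mat m n" and B: "B \<in> carrier_mat n q"
    and "irrelevant_mat A \<or> irrelevant_mat B"
  shows "irrelevant_mat (A * B)"
  unfolding irrelevant_mat_def
proof (intro allI impI)
  fix j c assume "j < dim_row (A * B)" "c < dim_col (A * B)"
  then have jc: "j < m" "c < q" using A B by auto
  have "\<forall>l<n. const_term (A $$ (j, l)) * const_term (B $$ (l, c)) = 0"
    using assms jc by (auto simp: irrelevant_mat_def)
  then show "const_term ((A * B) $$ (j, c)) = 0"
    unfolding mat_mult_index[OF A B jc] by simp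
qed

lemma minimal_free_resolution_iff:
  "minimal_free_resolution N k M gs R \<longleftrightarrow>
     graded_free_resolution N k M gs R \<and> (\<forall>i. irrelevant_mat (R (Suc i)))"
proof -
  have "R (Suc i) \<in> carrier_mat (length (M (Suc i))) (length (M i))"
    if "graded_free_resolution N k M gs R" for i
    using that by (auto simp: graded_free_resolution_def graded_mat_def)
  then have "dim_row (R (Suc i)) = length (M (Suc i))" "dim_col (R (Suc i)) = length (M i)"
    if "graded_free_resolution N k M gs R" for i
    using that by blast+
  then show ?thesis
    by (auto simp: minimal_free_resolution_def irrelevant_mat_def const_term_def)
qed

text \<open>Exactness is transported because each \<open>P i\<close> acts bijectively, and
  minimality because a product with a factor over the irrelevant ideal has all its entries
  there.\<close>

lemma minimal_free_resolution_change:
  fixes R :: "nat \<Rightarrow> ('n::{finite,linorder}, 'k::field) mpoly mat"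
  assumes res: "minimal_free_resolution N k M gs R"
    and PQ: "\<And>i. graded_equiv (M' i) (M i) (P i) (Q i)"
    and gs': "gs' = map (\<lambda>j. der_comb gs (row (P 0) j)) [0..<length (M' 0)]"
    and R': "\<And>i. R' (Suc i) = P (Suc i) * R (Suc i) * Q i"
  shows "minimal_free_resolution N k M' gs' R'" and "change_of_bases M gs R M' gs' R'"
proof -
  define n where "n i = length (M i)" for i
  note D = graded_equivD[OF PQ]
  have n': "length (M' i) = n i" for i using D(4)[of i] by (simp add: n_def)
  have cP [simp]: "P i \<in> carrier_mat (n i) (n i)" and cQ [simp]: "Q i \<in> carrier_mat (n i) (n i)" for i
    using D(5,6)[of i] by (simp_all add: n_def)
  have gR: "graded_mat (M (Suc i)) (M i) (R (Suc i))" for i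
    using res by (simp add: minimal_free_resolution_def graded_free_resolution_def)
  then have cR [simp]: "R (Suc i) \<in> carrier_mat (n (Suc i)) (n i)" for i
    using graded_mat_carrier by (auto simp: n_def)
  have lgs: "list_all2 homogeneous_der (M 0) gs" and k: "\<And>i. i > k \<Longrightarrow> M i = []"
    and im: "der_comb gs ` carrier_vec (n 0) = N"
    and ker0: "{v \<in> carrier_vec (n 0). der_comb gs v = 0} = row_map (R 1) ` carrier_vec (n 1)"
    and ker: "\<And>i. {v \<in> carrier_vec (n (Suc i)). row_map (R (Suc i)) v = 0\<^sub>v (n i)}
       = row_map (R (Suc (Suc i))) ` carrier_vec (n (Suc (Suc i)))"
    and irr: "\<And>i. irrelevant_mat (R (Suc i))"
    using res by (simp_all add: minimal_free_resolution_iff graded_free_resolution_def n_def)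
  have len0: "length gs = n 0" using list_all2_lengthD[OF lgs] by (simp add: n_def)
  have PQv: "row_map (P i) (row_map (Q i) v) = v" "row_map (Q i) (row_map (P i) v) = v"
    if "v \<in> carrier_vec (n i)" for v i
    using row_map_equiv[OF PQ[of i]] that n' by (auto simp: n_def)
  have surj: "row_map (P i) ` carrier_vec (n i) = carrier_vec (n i)" for i
  proof safe
    fix v :: "('n, 'k) mpoly Matrix.vec" assume v: "v \<in> carrier_vec (n i)"
    show "row_map (P i) v \<in> carrier_vec (n i)" by (rule row_map_carrier[OF cP])
    have "v = row_map (P i) (row_map (Q i) v)" using PQv v by simp
    then show "v \<in> row_map (P i) ` carrier_vec (n i)" by (rule image_eqI) (rule row_map_carrier[OF cQ])
  qed
  \<comment> \<open>Matrices act on row vectors, so a product acts from left to right: go to the old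
    basis by \<open>P\<close>, apply the old map, return by \<open>Q\<close>.\<close>
  have R'v: "row_map (R' (Suc i)) v = row_map (Q i) (row_map (R (Suc i)) (row_map (P (Suc i)) v))"
    if v: "v \<in> carrier_vec (n (Suc i))" for v i
  proof -
    have "row_map (R' (Suc i)) v = row_map (Q i) (row_map (P (Suc i) * R (Suc i)) v)"
      unfolding R' using v by (intro row_map_mult[of _ "n (Suc i)" "n i" _ "n i"] mult_carrier_mat[OF cP cR]) auto
    also have "row_map (P (Suc i) * R (Suc i)) v = row_map (R (Suc i)) (row_map (P (Suc i)) v)"
      using v by (intro row_map_mult[OF cP cR])
    finally show ?thesis .
  qed
  have imR': "row_map (R' (Suc i)) ` carrier_vec (n (Suc i))
      = row_map (Q i) ` row_map (R (Suc i)) ` carrier_vec (n (Suc i))" for i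
  proof -
    have "row_map (R' (Suc i)) ` carrier_vec (n (Suc i))
        = (\<lambda>v. row_map (Q i) (row_map (R (Suc i)) v)) ` row_map (P (Suc i)) ` carrier_vec (n (Suc i))"
      by (auto simp: R'v image_image)
    then show ?thesis by (simp add: surj image_image)
  qed
  \<comment> \<open>Image under \<open>Q\<close> equals preimage under \<open>P\<close>; this
    matches old kernels with new ones.\<close>
  have QK: "row_map (Q i) ` {v \<in> carrier_vec (n i). Z v} = {v \<in> carrier_vec (n i). Z (row_map (P i) v)}" for i Z
  proof safe
    fix v :: "('n, 'k) mpoly Matrix.vec" assume v: "v \<in> carrier_vec (n i)"
    show "row_map (Q i) v \<in> carrier_vec (n i)" by (rule row_map_carrier[OF cQ])
    { assume "Z v" then show "Z (row_map (P i) (row_map (Q i) v))" using v by (simp add: PQv) }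
    { assume "Z (row_map (P i) v)"
      then show "v \<in> row_map (Q i) ` {v \<in> carrier_vec (n i). Z v}"
        using v PQv row_map_carrier[OF cP] by (intro image_eqI[of _ _ "row_map (P i) v"]) auto }
  qed
  have gs'v: "der_comb gs' v = der_comb gs (row_map (P 0) v)" if "v \<in> carrier_vec (n 0)" for v
    unfolding gs' n' using that by (intro der_comb_map_row) (auto simp: len0)
  show "minimal_free_resolution N k M' gs' R'"
    unfolding minimal_free_resolution_iff graded_free_resolution_def n'
  proof (intro conjI allI impI)
    show "M' i = []" if "i > k" for i using n'[of i] k[OF that] by (simp add: n_def)
    show "list_all2 homogeneous_der (M' 0) gs'"
      unfolding list_all2_conv_all_nth gs'
      using homogeneous_der_comb[OF lgs] graded_mat_row[OF D(1)[of 0]] by simp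
    show "graded_mat (M' (Suc i)) (M' i) (R' (Suc i))" for i
      unfolding R' by (intro graded_mat_mult[OF graded_mat_mult[OF D(1) gR] D(2)])
    have "der_comb gs' ` carrier_vec (n 0) = der_comb gs ` row_map (P 0) ` carrier_vec (n 0)"
      by (auto simp: gs'v image_image)
    then show "der_comb gs' ` carrier_vec (n 0) = N" by (simp add: surj im)
    have "{v \<in> carrier_vec (n 0). der_comb gs' v = 0} = {v \<in> carrier_vec (n 0). der_comb gs (row_map (P 0) v) = 0}"
      by (intro Collect_cong conj_cong refl) (simp only: gs'v)
    then show "{v \<in> carrier_vec (n 0). der_comb gs' v = 0} = row_map (R' 1) ` carrier_vec (n 1)"
      using imR'[of 0] QK[of 0 "\<lambda>v. der_comb gs v = 0"] by (simp add: ker0)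
    fix i
    have inj: "row_map (Q i) v = 0\<^sub>v (n i) \<longleftrightarrow> v = 0\<^sub>v (n i)" if "v \<in> carrier_vec (n i)" for v
      using PQv(1)[OF that] row_map_zero[OF cP[of i]] row_map_zero[OF cQ[of i]] by auto
    have "row_map (R' (Suc i)) v = 0\<^sub>v (n i) \<longleftrightarrow> row_map (R (Suc i)) (row_map (P (Suc i)) v) = 0\<^sub>v (n i)"
      if "v \<in> carrier_vec (n (Suc i))" for v
      unfolding R'v[OF that] by (rule inj[OF row_map_carrier[OF cR]])
    then have "{v \<in> carrier_vec (n (Suc i)). row_map (R' (Suc i)) v = 0\<^sub>v (n i)}
        = {v \<in> carrier_vec (n (Suc i)). row_map (R (Suc i)) (row_map (P (Suc i)) v) = 0\<^sub>v (n i)}"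
      by (intro Collect_cong conj_cong refl)
    then show "{v \<in> carrier_vec (n (Suc i)). row_map (R' (Suc i)) v = 0\<^sub>v (n i)}
        = row_map (R' (Suc (Suc i))) ` carrier_vec (n (Suc (Suc i)))"
      using QK[of "Suc i" "\<lambda>v. row_map (R (Suc i)) v = 0\<^sub>v (n i)"] by (simp add: imR' ker)
    show "irrelevant_mat (R' (Suc i))"
      unfolding R' by (rule irrelevant_mat_mult[OF mult_carrier_mat[OF cP cR] cQ
          disjI1[OF irrelevant_mat_mult[OF cP cR disjI2[OF irr]]]])
  qed
  have "R' (Suc i) * P i = P (Suc i) * R (Suc i)" for i
  proof -
    have "R' (Suc i) * P i = P (Suc i) * R (Suc i) * (Q i * P i)"
      unfolding R' by (rule assoc_mult_mat[OF mult_carrier_mat[OF cP cR] cQ cP])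
    moreover have "P (Suc i) * R (Suc i) \<in> carrier_mat (n (Suc i)) (n i)"
      using cP[of "Suc i"] cR[of i] by (rule mult_carrier_mat)
    ultimately show ?thesis using D(8)[of i] right_mult_one_mat[of "P (Suc i) * R (Suc i)" "n (Suc i)" "n i"]
      by (simp only: n_def)
  qed
  then show "change_of_bases M gs R M' gs' R'"
    unfolding change_of_bases_def using D gs' n' by (intro exI[of _ P] exI[of _ Q]) (simp add: n_def)
qed

text \<open>Composes the successive adaptations of the generators, the first syzygies and the second
  syzygies.\<close>

lemma change_of_bases_trans:
  fixes R :: "nat \<Rightarrow> ('n::{finite,linorder}, 'k::field) mpoly mat"
  assumes len: "length gs = length (M 0)"
    and R: "\<And>i. R (Suc i) \<in> carrier_mat (length (M (Suc i))) (length (M i))"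
    and R': "\<And>i. R' (Suc i) \<in> carrier_mat (length (M' (Suc i))) (length (M' i))"
    and R'': "\<And>i. R'' (Suc i) \<in> carrier_mat (length (M'' (Suc i))) (length (M'' i))"
    and 1: "change_of_bases M gs R M' gs' R'" and 2: "change_of_bases M' gs' R' M'' gs'' R''"
  shows "change_of_bases M gs R M'' gs'' R''"
proof -
  obtain P Q where P: "\<And>i. graded_mat (M' i) (M i) (P i)" and Q: "\<And>i. graded_mat (M i) (M' i) (Q i)"
    and PQ: "\<And>i. P i * Q i = 1\<^sub>m (length (M' i))" and QP: "\<And>i. Q i * P i = 1\<^sub>m (length (M i))"
    and gs': "gs' = map (\<lambda>j. der_comb gs (row (P 0) j)) [0..<length (M' 0)]"
    and RP: "\<And>i. R' (Suc i) * P i = P (Suc i) * R (Suc i)"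
    using 1 unfolding change_of_bases_def by auto
  obtain P' Q' where P': "\<And>i. graded_mat (M'' i) (M' i) (P' i)" and Q': "\<And>i. graded_mat (M' i) (M'' i) (Q' i)"
    and PQ': "\<And>i. P' i * Q' i = 1\<^sub>m (length (M'' i))" and QP': "\<And>i. Q' i * P' i = 1\<^sub>m (length (M' i))"
    and gs'': "gs'' = map (\<lambda>j. der_comb gs' (row (P' 0) j)) [0..<length (M'' 0)]"
    and RP': "\<And>i. R'' (Suc i) * P' i = P' (Suc i) * R' (Suc i)"
    using 2 unfolding change_of_bases_def by auto
  note c = graded_mat_carrier[OF P] graded_mat_carrier[OF Q] graded_mat_carrier[OF P'] graded_mat_carrier[OF Q']
  define a b d where "a i = length (M i)" and "b i = length (M' i)" and "d i = length (M'' i)" for i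
  have cc: "P i \<in> carrier_mat (b i) (a i)" "Q i \<in> carrier_mat (a i) (b i)"
    "P' i \<in> carrier_mat (d i) (b i)" "Q' i \<in> carrier_mat (b i) (d i)"
    "R (Suc i) \<in> carrier_mat (a (Suc i)) (a i)" "R' (Suc i) \<in> carrier_mat (b (Suc i)) (b i)"
    "R'' (Suc i) \<in> carrier_mat (d (Suc i)) (d i)" for i
    using c R R' R'' by (simp_all add: a_def b_def d_def)
  have x: "P' i * P i * (Q i * Q' i) = 1\<^sub>m (d i)" for i
  proof -
    have "P' i * P i * (Q i * Q' i) = P' i * (P i * (Q i * Q' i))"
      by (rule assoc_mult_mat[OF cc(3) cc(1) mult_carrier_mat[OF cc(2) cc(4)]])
    also have "P i * (Q i * Q' i) = P i * Q i * Q' i"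
      by (rule assoc_mult_mat[OF cc(1) cc(2) cc(4), symmetric])
    finally show ?thesis using PQ[of i] PQ'[of i] cc(4)[of i] by (simp add: b_def d_def)
  qed
  have y: "Q i * Q' i * (P' i * P i) = 1\<^sub>m (a i)" for i
  proof -
    have "Q i * Q' i * (P' i * P i) = Q i * (Q' i * (P' i * P i))"
      by (rule assoc_mult_mat[OF cc(2) cc(4) mult_carrier_mat[OF cc(3) cc(1)]])
    also have "Q' i * (P' i * P i) = Q' i * P' i * P i"
      by (rule assoc_mult_mat[OF cc(4) cc(3) cc(1), symmetric])
    finally show ?thesis using QP[of i] QP'[of i] cc(1)[of i] by (simp add: a_def b_def)
  qed
  have z: "R'' (Suc i) * (P' i * P i) = P' (Suc i) * P (Suc i) * R (Suc i)" for i
  proof -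
    have "R'' (Suc i) * (P' i * P i) = R'' (Suc i) * P' i * P i"
      by (rule assoc_mult_mat[OF cc(7) cc(3) cc(1), symmetric])
    also have "\<dots> = P' (Suc i) * (R' (Suc i) * P i)"
      unfolding RP' by (rule assoc_mult_mat[OF cc(3) cc(6) cc(1)])
    also have "\<dots> = P' (Suc i) * P (Suc i) * R (Suc i)"
      unfolding RP by (rule assoc_mult_mat[OF cc(3) cc(1) cc(5), symmetric])
    finally show ?thesis .
  qed
  have g: "gs'' = map (\<lambda>j. der_comb gs (row (P' 0 * P 0) j)) [0..<length (M'' 0)]"
    unfolding gs''
  proof (rule map_cong[OF refl])
    fix j assume "j \<in> set [0..<length (M'' 0)]"
    then have j: "j < d 0" by (simp add: d_def)
    have "row (P' 0) j \<in> carrier_vec (b 0)" using cc(3)[of 0] j by auto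
    then have "der_comb gs' (row (P' 0) j) = der_comb gs (row_map (P 0) (row (P' 0) j))"
      unfolding gs' using cc(1)[of 0] by (intro der_comb_map_row) (auto simp: len a_def b_def)
    also have "row_map (P 0) (row (P' 0) j) = row_map (P 0) (row_map (P' 0) (unit_vec (d 0) j))"
      using row_map_unit_vec[OF cc(3) j] by simp
    also have "\<dots> = row_map (P' 0 * P 0) (unit_vec (d 0) j)"
      by (rule row_map_mult[OF cc(3) cc(1), symmetric]) simp
    also have "\<dots> = row (P' 0 * P 0) j"
      by (rule row_map_unit_vec[OF mult_carrier_mat[OF cc(3) cc(1)] j])
    finally show "der_comb gs' (row (P' 0) j) = der_comb gs (row (P' 0 * P 0) j)" .
  qed
  show ?thesis
    unfolding change_of_bases_def
    using graded_mat_mult[OF P' P] graded_mat_mult[OF Q Q'] x y z g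
    by (intro exI[of _ "\<lambda>i. P' i * P i"] exI[of _ "\<lambda>i. Q i * Q' i"]) (simp add: a_def d_def)
qed

section \<open>Combinations of derivations and lifts to homogeneous coordinates\<close>

lemma der_comb_add:
  "v \<in> carrier_vec (length gs) \<Longrightarrow> w \<in> carrier_vec (length gs) \<Longrightarrow> der_comb gs (v + w) = der_comb gs v + der_comb gs w"
  by (simp add: der_comb_def der.scale_left_distrib sum.distrib)

lemma der_comb_diff:
  "v \<in> carrier_vec (length gs) \<Longrightarrow> w \<in> carrier_vec (length gs) \<Longrightarrow> der_comb gs (v - w) = der_comb gs v - der_comb gs w"
  by (simp add: der_comb_def der.scale_left_diff_distrib sum_subtractf)

lemma der_comb_smult:
  "v \<in> carrier_vec (length gs) \<Longrightarrow> der_comb gs (s \<cdot>\<^sub>v v) = s *s der_comb gs v"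
  by (simp add: der_comb_def der.scale_sum_right der.scale_scale)

lemma der_comb_vec: "der_comb gs (Matrix.vec (length gs) a) = (\<Sum>j<length gs. a j *s gs ! j)"
  by (simp add: der_comb_def)

lemma der_comb_snoc: "der_comb (gs @ [g]) v = der_comb gs v + vec_index v (length gs) *s g"
  by (simp add: der_comb_def nth_append)

lemma der_comb_cong: "(\<And>j. j < length gs \<Longrightarrow> vec_index v j = vec_index w j) \<Longrightarrow> der_comb gs v = der_comb gs w"
  by (simp add: der_comb_def)

lemma der_comb_unit_vec:
  assumes "i < length gs"
  shows "der_comb gs (unit_vec (length gs) i) = gs ! i"
proof -
  have "der_comb gs (unit_vec (length gs) i) = (\<Sum>j<length gs. if j = i then gs ! i else 0)"
    unfolding der_comb_def using assms by (intro sum.cong) (auto simp: der.scale_one)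
  then show ?thesis using assms by simp
qed

lemma set_subset_der_comb_image: "set gs \<subseteq> der_comb gs ` carrier_vec (length gs)"
proof
  fix g assume "g \<in> set gs"
  then obtain i where "i < length gs" "g = gs ! i" by (metis in_set_conv_nth)
  then show "g \<in> der_comb gs ` carrier_vec (length gs)"
    using der_comb_unit_vec[of i gs] by (intro image_eqI[of _ _ "unit_vec (length gs) i"]) auto
qed

lemma der_comb_in_span: "der_comb gs v \<in> der.span (set gs)"
  unfolding der_comb_def by (intro der.span_sum der.span_scale der.span_base) simp

lemma der_comb_image_span:
  assumes "distinct gs"
  shows "der_comb gs ` carrier_vec (length gs) = der.span (set gs)"
proof
  show "der_comb gs ` carrier_vec (length gs) \<subseteq> der.span (set gs)"
    using der_comb_in_span by blast
  show "der.span (set gs) \<subseteq> der_comb gs ` carrier_vec (length gs)"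
  proof
    fix x assume "x \<in> der.span (set gs)"
    then obtain u where "x = (\<Sum>g\<in>set gs. u g *s g)" by (auto simp: der.span_finite)
    also have "\<dots> = (\<Sum>j<length gs. u (gs ! j) *s gs ! j)"
      using sum.reindex_bij_betw[OF bij_betw_nth[OF assms refl refl], of "\<lambda>g. u g *s g"] by simp
    finally show "x \<in> der_comb gs ` carrier_vec (length gs)"
      by (intro image_eqI[of _ _ "Matrix.vec (length gs) (\<lambda>j. u (gs ! j))"]) (auto simp: der_comb_vec)
  qed
qed

lemma homogeneous_lift:
  fixes gs :: "('n::finite, 'k::comm_ring_1) der list"
  assumes gs: "list_all2 homogeneous_der as gs" and "homogeneous_der a \<theta>"
    and "\<theta> \<in> der_comb gs ` carrier_vec (length gs)"
  obtains v where "hom_vec a as v" "\<theta> = der_comb gs v"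
proof -
  obtain v where "\<theta> = der_comb gs v" using assms(3) by blast
  then have "\<theta> = der_comb gs (part_vec a as v)"
    using der_part_comb[OF gs, of a v] der_part_id[OF assms(2)] by simp
  then show thesis using that hom_vec_part_vec by blast
qed

text \<open>Source of the graded matrices fed into the exchange argument: \<open>T\<close> turns
  combinations of \<open>ys\<close> into coordinates with respect to \<open>gs\<close>.\<close>

lemma homogeneous_lift_list:
  fixes gs :: "('n::finite, 'k::comm_ring_1) der list"
  assumes gs: "list_all2 homogeneous_der as gs" and ys: "list_all2 homogeneous_der bs ys"
    and sub: "set ys \<subseteq> der_comb gs ` carrier_vec (length gs)"
  obtains T where "graded_mat bs as T" "\<And>j. j < length ys \<Longrightarrow> der_comb gs (row T j) = ys ! j"
    "\<And>v. v \<in> carrier_vec (length ys) \<Longrightarrow> der_comb ys v = der_comb gs (row_map T v)"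
proof -
  have "\<exists>v. hom_vec (bs ! j) as v \<and> ys ! j = der_comb gs v" if "j < length ys" for j
  proof -
    have "ys ! j \<in> der_comb gs ` carrier_vec (length gs)" using that sub nth_mem by blast
    with homogeneous_lift[OF gs list_all2_nthD2[OF ys that]] show ?thesis by metis
  qed
  then obtain v where v: "\<And>j. j < length ys \<Longrightarrow> hom_vec (bs ! j) as (v j) \<and> ys ! j = der_comb gs (v j)"
    by metis
  have len: "length bs = length ys" "length as = length gs"
    using ys gs by (auto dest: list_all2_lengthD)
  define T where "T = mat (length bs) (length as) (\<lambda>(j, k). vec_index (v j) k)"
  have T: "graded_mat bs as T" using v by (auto simp: graded_mat_iff T_def hom_vec_def len)
  have row: "row T j = v j" if "j < length ys" for j
    using v[OF that] that by (intro eq_vecI) (auto simp: T_def len hom_vec_def)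
  have "ys = map (\<lambda>j. der_comb gs (row T j)) [0..<length ys]"
    using v row by (intro nth_equalityI) auto
  then have "der_comb ys w = der_comb gs (row_map T w)" if "w \<in> carrier_vec (length ys)" for w
    using der_comb_map_row[of T "length ys" gs w] graded_mat_carrier[OF T] that by (simp add: len)
  with T v row that show thesis by simp
qed

lemma irrelevant_row_map:
  fixes A :: "('n::finite, 'k::comm_ring_1) mpoly mat"
  assumes A: "A \<in> carrier_mat m n" and v: "v \<in> carrier_vec m"
    and "\<And>j. j < m \<Longrightarrow> const_term (vec_index v j) = 0" and k: "k < n"
  shows "const_term (vec_index (row_map A v) k) = 0"
  using assms by (simp add: row_map_index[OF A v k])

lemma irrelevant_row_map':
  fixes A :: "('n::finite, 'k::comm_ring_1) mpoly mat"
  assumes A: "A \<in> carrier_mat m n" and v: "v \<in> carrier_vec m" and irr: "irrelevant_mat A" and k: "k < n"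
  shows "const_term (vec_index (row_map A v) k) = 0"
proof -
  have "const_term (A $$ (j, k)) = 0" if "j < m" for j using irr A that k by (auto simp: irrelevant_mat_def)
  then show ?thesis by (simp add: row_map_index[OF A v k])
qed

subsection \<open>Minimal generators\<close>

text \<open>Minimality in the form of Nakayama's lemma: no relation has a unit coefficient. This is
  what a minimal resolution provides directly, and it is easier to transport than irredundancy of a
  set.\<close>

definition min_gens :: "('n::finite, 'k::field) der set \<Rightarrow> nat list \<Rightarrow> ('n, 'k) der list \<Rightarrow> bool" where
  "min_gens N as gs \<longleftrightarrow> list_all2 homogeneous_der as gs \<and> der_comb gs ` carrier_vec (length gs) = N \<and>
     (\<forall>v \<in> carrier_vec (length gs). der_comb gs v = 0 \<longrightarrow> (\<forall>k < length gs. const_term (vec_index v k) = 0))"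

lemma min_gens_relation:
  "min_gens N as gs \<Longrightarrow> v \<in> carrier_vec (length gs) \<Longrightarrow> der_comb gs v = 0 \<Longrightarrow> k < length gs \<Longrightarrow>
     const_term (vec_index v k) = 0"
  by (simp add: min_gens_def)

lemma minimal_free_resolution_min_gens:
  assumes res: "minimal_free_resolution N k M gs R"
  shows "min_gens N (M 0) gs"
proof -
  have lgs: "list_all2 homogeneous_der (M 0) gs" and im: "der_comb gs ` carrier_vec (length (M 0)) = N"
    and ker0: "{v \<in> carrier_vec (length (M 0)). der_comb gs v = 0} = row_map (R (Suc 0)) ` carrier_vec (length (M 1))"
    and irr: "irrelevant_mat (R (Suc 0))" and gR: "graded_mat (M (Suc 0)) (M 0) (R (Suc 0))"
    using res by (auto simp: minimal_free_resolution_iff graded_free_resolution_def)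
  have len: "length (M 0) = length gs" using list_all2_lengthD[OF lgs] .
  have "const_term (vec_index v j) = 0"
    if v: "v \<in> carrier_vec (length gs)" "der_comb gs v = 0" and j: "j < length gs" for v j
  proof -
    have "v \<in> row_map (R (Suc 0)) ` carrier_vec (length (M 1))"
      using v ker0 by (auto simp: len)
    then obtain u where u: "u \<in> carrier_vec (length (M 1))" "v = row_map (R (Suc 0)) u" by blast
    show ?thesis
      unfolding u(2) using graded_mat_carrier[OF gR] u(1) irr j
      by (intro irrelevant_row_map'[of _ "length (M 1)" "length gs"]) (auto simp: len)
  qed
  then show ?thesis using lgs im by (auto simp: min_gens_def len)
qed

text \<open>Writing the minimal generators in terms of \<open>ys\<close> gives a matrix
  \<open>B\<close> whose rows are independent on constant terms, so they extend to a basis of the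
  free module on \<open>ys\<close>. For equal lengths \<open>B\<close> is invertible and pulls every
  relation of \<open>ys\<close> back to a relation of \<open>gs\<close>.\<close>

lemma min_gens_unique:
  fixes gs :: "('n::{finite,linorder}, 'k::field) der list"
  assumes min: "min_gens N as gs" and ys: "list_all2 homogeneous_der bs ys"
    and gen: "der_comb ys ` carrier_vec (length ys) = N"
  shows "length gs \<le> length ys"
    and "length ys \<le> length gs \<Longrightarrow> mset bs = mset as \<and> min_gens N bs ys"
proof -
  define n p where "n = length gs" and "p = length ys"
  have gs: "list_all2 homogeneous_der as gs" and gs_im: "der_comb gs ` carrier_vec n = N"
    using min by (auto simp: min_gens_def n_def)
  have len: "length as = n" "length bs = p" using gs ys by (auto simp: n_def p_def dest: list_all2_lengthD)
  have "set gs \<subseteq> N" "set ys \<subseteq> N"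
    using set_subset_der_comb_image[of gs] set_subset_der_comb_image[of ys] gs_im gen
    by (simp_all add: n_def)
  then obtain A B where A: "graded_mat bs as A" and B: "graded_mat as bs B"
    and yA: "\<And>v. v \<in> carrier_vec p \<Longrightarrow> der_comb ys v = der_comb gs (row_map A v)"
    and gB: "\<And>v. v \<in> carrier_vec n \<Longrightarrow> der_comb gs v = der_comb ys (row_map B v)"
    using homogeneous_lift_list[OF gs ys] homogeneous_lift_list[OF ys gs] gen gs_im
    by (metis n_def p_def)
  have cA: "A \<in> carrier_mat p n" and cB: "B \<in> carrier_mat n p"
    using graded_mat_carrier[OF A] graded_mat_carrier[OF B] by (simp_all add: len)
  \<comment> \<open>Passing from \<open>gs\<close> to \<open>ys\<close> and back changes
    \<open>v\<close> only by a relation of \<open>gs\<close>, which has no constant terms. If the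
    image \<open>u\<close> has none either, then neither does \<open>v\<close>.\<close>
  have indep: "\<forall>j<n. c j = 0" if c: "\<And>k. k < p \<Longrightarrow> (\<Sum>j<n. c j * const_term (B $$ (j, k))) = 0" for c
  proof -
    define v :: "('n, 'k) mpoly Matrix.vec" where "v = Matrix.vec n (\<lambda>j. const (c j))"
    have v: "v \<in> carrier_vec n" by (simp add: v_def)
    define u where "u = row_map B v"
    have u: "u \<in> carrier_vec p" unfolding u_def by (rule row_map_carrier[OF cB])
    have Au: "row_map A u \<in> carrier_vec n" by (rule row_map_carrier[OF cA])
    have u0: "const_term (vec_index u k) = 0" if "k < p" for k
      using c[OF that] unfolding u_def row_map_index[OF cB v that] by (simp add: v_def)
    have "der_comb gs (v - row_map A u) = 0"
      using v Au gB[OF v] yA[OF u] by (simp add: der_comb_diff n_def u_def)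
    then have "const_term (vec_index (v - row_map A u) j) = 0" if "j < n" for j
      using min_gens_relation[OF min, of "v - row_map A u"] v Au that by (simp add: n_def)
    then show ?thesis
      using irrelevant_row_map[OF cA u u0] v Au by (auto simp: v_def)
  qed
  obtain rest P Q where PQ: "graded_equiv (as @ rest) bs P Q"
    and PB: "\<And>j k. j < n \<Longrightarrow> k < p \<Longrightarrow> P $$ (j, k) = B $$ (j, k)"
    using graded_basis_extension[OF B] indep by (auto simp: len)
  note D = graded_equivD[OF PQ]
  show "length gs \<le> length ys" using D(4) len by (simp add: n_def p_def)
  assume "length ys \<le> length gs"
  then have np: "n = p" and "length rest = 0" using D(4) len by (auto simp: n_def p_def simp del: length_0_conv)
  then have rest: "rest = []" by simp
  have "P = B" using D(5) cB PB by (intro eq_matI) (auto simp: np len)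
  then have B: "graded_equiv as bs B Q" using PQ rest by simp
  have "const_term (vec_index v k) = 0" if v: "v \<in> carrier_vec p" and 0: "der_comb ys v = 0" and k: "k < p" for v k
  proof -
    have Qv: "row_map Q v \<in> carrier_vec n"
      using graded_equivD(6)[OF B] row_map_carrier by (simp add: len np)
    have v': "row_map B (row_map Q v) = v" using row_map_equiv(1)[OF B] v by (simp add: len)
    then have "der_comb gs (row_map Q v) = 0" using gB[OF Qv] 0 by simp
    then have "const_term (vec_index (row_map Q v) j) = 0" if "j < n" for j
      using min_gens_relation[OF min] Qv that by (simp add: n_def)
    from irrelevant_row_map[OF cB Qv this k] show ?thesis by (simp add: v')
  qed
  then show "mset bs = mset as \<and> min_gens N bs ys"
    using D(3) rest ys gen by (auto simp: min_gens_def p_def)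
qed

text \<open>Connects irredundant homogeneous generators with \<open>min_gens\<close>. A dependence
  among constant terms would make one member of \<open>ys\<close> redundant, so the exchange
  argument gives at most \<open>length gs\<close> members, and \<open>min_gens_unique\<close> at
  least as many.\<close>

lemma has_DS_unique:
  fixes gs :: "('n::{finite,linorder}, 'k::field) der list"
  assumes DS: "has_DS A X" and min: "min_gens (D A) as gs"
  shows "X = mset as"
proof -
  obtain es ys where X: "X = mset es" and ys: "list_all2 homogeneous_der es ys" "distinct ys"
    and span: "der.span (set ys) = D A" and irred: "\<And>G. G \<subset> set ys \<Longrightarrow> der.span G \<noteq> D A"
    using DS by (auto simp: has_DS_def)
  define n p where "n = length gs" and "p = length ys"
  have gen: "der_comb ys ` carrier_vec p = D A"
    using der_comb_image_span[OF ys(2)] span by (simp add: p_def)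
  have gs: "list_all2 homogeneous_der as gs" and gs_im: "der_comb gs ` carrier_vec n = D A"
    using min by (auto simp: min_gens_def n_def)
  have len: "length as = n" "length es = p" using gs ys by (auto simp: n_def p_def dest: list_all2_lengthD)
  have le: "n \<le> p" using min_gens_unique(1)[OF min ys(1)] gen by (simp add: n_def p_def)
  have "set ys \<subseteq> D A" using span der.span_base by blast
  then obtain T where T: "graded_mat es as T"
    and yT: "\<And>v. v \<in> carrier_vec p \<Longrightarrow> der_comb ys v = der_comb gs (row_map T v)"
    using homogeneous_lift_list[OF gs ys(1)] gs_im by (metis n_def p_def)
  have cT: "T \<in> carrier_mat p n" using graded_mat_carrier[OF T] by (simp add: len)
  have "\<forall>j<p. c j = 0" if c: "\<And>k. k < n \<Longrightarrow> (\<Sum>j<p. c j * const_term (T $$ (j, k))) = 0" for c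
  proof (rule ccontr)
    assume "\<not> (\<forall>j<p. c j = 0)"
    then obtain i where i: "i < p" "c i \<noteq> 0" by blast
    define v :: "('n, 'k) mpoly Matrix.vec" where "v = Matrix.vec p (\<lambda>j. const (c j))"
    have v: "v \<in> carrier_vec p" by (simp add: v_def)
    define w where "w = row_map T v"
    have w: "w \<in> carrier_vec n" unfolding w_def by (rule row_map_carrier[OF cT])
    have w0: "const_term (vec_index w k) = 0" if "k < n" for k
      using c[OF that] unfolding w_def row_map_index[OF cT v that] by (simp add: v_def)
    have "set gs \<subseteq> der_comb ys ` carrier_vec (length ys)"
      using set_subset_der_comb_image gs_im gen by (auto simp: n_def p_def)
    then obtain B where B: "graded_mat as es B"
      and gB: "\<And>v. v \<in> carrier_vec n \<Longrightarrow> der_comb gs v = der_comb ys (row_map B v)"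
      using homogeneous_lift_list[OF ys(1) gs] by (metis n_def)
    have cB: "B \<in> carrier_mat n p" using graded_mat_carrier[OF B] by (simp add: len)
    have Bw: "row_map B w \<in> carrier_vec p" by (rule row_map_carrier[OF cB])
    \<comment> \<open>The combination \<open>v\<close> of \<open>ys\<close> lies in the irrelevant
      ideal times the module; rewriting it through \<open>gs\<close> yields a relation of
      \<open>ys\<close> that still has constant term \<open>c i\<close> at \<open>i\<close>.\<close>
    define x where "x = v - row_map B w"
    have x: "x \<in> carrier_vec p" using v Bw by (simp add: x_def)
    have "der_comb ys x = 0"
      using v Bw yT[OF v] gB[OF w] by (simp add: x_def der_comb_diff p_def w_def)
    \<comment> \<open>In the component of degree \<open>es ! i\<close> the coefficient of
      \<open>ys ! i\<close> is exactly the constant \<open>c i\<close>, so the relation can be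
      solved for \<open>ys ! i\<close>.\<close>
    define x' where "x' = part_vec (es ! i) es x"
    have "der_comb ys x' = 0"
      unfolding x'_def der_part_comb[OF ys(1)] \<open>der_comb ys x = 0\<close> der_part_def
      by (simp add: Finite_Cartesian_Product.vec_eq_iff)
    have "const_term (vec_index x i) = c i"
      using irrelevant_row_map[OF cB w w0 i(1)] Bw i by (simp add: x_def v_def)
    then have "const_term (vec_index x' i) = c i"
      using i by (simp add: x'_def part_vec_def len const_term_def lookup_hom_part)
    moreover have "hom_shift (es ! i) (es ! i) (vec_index x' i)"
      using i by (simp add: x'_def part_vec_def len)
    ultimately have x'i: "vec_index x' i = const (c i)" using hom_shift_same_const by metis
    have "0 = (\<Sum>j<p. vec_index x' j *s ys ! j)" using \<open>der_comb ys x' = 0\<close> by (simp add: der_comb_def p_def)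
    also have "\<dots> = const (c i) *s ys ! i + (\<Sum>j\<in>{..<p} - {i}. vec_index x' j *s ys ! j)"
      using i x'i by (subst sum.remove[of _ i]) auto
    finally have "const (c i) *s ys ! i = - (\<Sum>j\<in>{..<p} - {i}. vec_index x' j *s ys ! j)"
      by (simp add: eq_neg_iff_add_eq_0)
    moreover have "(\<Sum>j\<in>{..<p} - {i}. vec_index x' j *s ys ! j) \<in> der.span (set ys - {ys ! i})"
      using ys(2) i by (intro der.span_sum der.span_scale der.span_base) (auto simp: p_def nth_eq_iff_index_eq)
    ultimately have "const (inverse (c i)) *s (const (c i) *s ys ! i) \<in> der.span (set ys - {ys ! i})"
      using der.span_scale[OF der.span_neg] by simp
    then have "ys ! i \<in> der.span (set ys - {ys ! i})"
      using i by (simp add: der.scale_scale der.scale_one)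
    then have "set ys \<subseteq> der.span (set ys - {ys ! i})" by (auto intro: der.span_base)
    then have "der.span (set ys) \<subseteq> der.span (set ys - {ys ! i})"
      by (intro der.span_minimal der.subspace_span)
    moreover have "der.span (set ys - {ys ! i}) \<subseteq> der.span (set ys)" by (intro der.span_mono) auto
    ultimately have "der.span (set ys - {ys ! i}) = D A" using span by simp
    moreover have "set ys - {ys ! i} \<subset> set ys" using i nth_mem[of i ys] by (auto simp: p_def simp del: nth_mem)
    ultimately show False using irred by blast
  qed
  then obtain rest and P Q :: "('n, 'k) mpoly mat" where "graded_equiv (es @ rest) as P Q"
    using graded_basis_extension[OF T] by (auto simp: len)
  from graded_equivD(3,4)[OF this] le len have "mset (es @ rest) = mset as" "length rest = 0" by (simp_all del: length_0_conv)
  then show ?thesis by (simp add: X)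
qed

text \<open>Only the maps adjacent to module \<open>i\<close> are affected. That the maps below stay
  literally equal keeps the rows of \<open>R 1\<close> intact while the second syzygies are
  adapted.\<close>

lemma basis_change_at:
  fixes R :: "nat \<Rightarrow> ('n::{finite,linorder}, 'k::field) mpoly mat"
  assumes res: "minimal_free_resolution N k M gs R" and PQ: "graded_equiv as (M i) P Q"
  obtains gs' R' where "minimal_free_resolution N k (M(i := as)) gs' R'" "change_of_bases M gs R (M(i := as)) gs' R'"
    "i = 0 \<Longrightarrow> gs' = map (\<lambda>j. der_comb gs (row P j)) [0..<length as]" "i \<noteq> 0 \<Longrightarrow> gs' = gs"
    "\<And>l. i = Suc l \<Longrightarrow> R' i = P * R i" "\<And>l. Suc l \<noteq> i \<Longrightarrow> l \<noteq> i \<Longrightarrow> R' (Suc l) = R (Suc l)"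
proof -
  define P' Q' where "P' l = (if l = i then P else 1\<^sub>m (length (M l)))"
    and "Q' l = (if l = i then Q else 1\<^sub>m (length (M l)))" for l
  define gs' where "gs' = map (\<lambda>j. der_comb gs (row (P' 0) j)) [0..<length ((M(i := as)) 0)]"
  define R' where "R' l = (case l of 0 \<Rightarrow> R 0 | Suc l' \<Rightarrow> P' l * R l * Q' l')" for l
  have cR: "R (Suc l) \<in> carrier_mat (length (M (Suc l))) (length (M l))" for l
    using res by (auto simp: minimal_free_resolution_def graded_free_resolution_def graded_mat_def)
  have len: "length gs = length (M 0)"
    using res by (auto simp: minimal_free_resolution_def graded_free_resolution_def dest: list_all2_lengthD)
  have eq: "graded_equiv ((M(i := as)) l) (M l) (P' l) (Q' l)" for l
    using PQ graded_equiv_one by (auto simp: P'_def Q'_def)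
  note * = minimal_free_resolution_change[OF res eq gs'_def, of R']
  show thesis
  proof (rule that[OF *])
    show "R' (Suc l) = P' (Suc l) * R (Suc l) * Q' l" "R' (Suc l) = P' (Suc l) * R (Suc l) * Q' l" for l
      by (simp_all add: R'_def)
    show "gs' = map (\<lambda>j. der_comb gs (row P j)) [0..<length as]" if "i = 0"
      using that by (simp add: gs'_def P'_def)
    show "gs' = gs" if "i \<noteq> 0"
    proof (rule nth_equalityI)
      show "length gs' = length gs" using that by (simp add: gs'_def len)
      fix j assume "j < length gs'"
      then have j: "j < length gs" using that by (simp add: gs'_def len)
      then show "gs' ! j = gs ! j" using that by (simp add: gs'_def P'_def der_comb_unit_vec flip: len)
    qed
    show "R' i = P * R i" if "i = Suc l" for l
    proof -
      have "P * R i \<in> carrier_mat (length (M i)) (length (M l))"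
        using graded_equivD(5)[OF PQ] cR[of l] that mult_carrier_mat by blast
      then show ?thesis using that right_mult_one_mat[of "P * R i" "length (M i)" "length (M l)"]
        by (simp add: R'_def P'_def Q'_def)
    qed
    show "R' (Suc l) = R (Suc l)" if "Suc l \<noteq> i" "l \<noteq> i" for l
      using that left_mult_one_mat[OF cR[of l]] right_mult_one_mat[OF cR[of l]] by (simp add: R'_def P'_def Q'_def)
  qed
qed

text \<open>By \<open>indep\<close> the \<open>ys\<close> are linearly independent modulo the
  irrelevant ideal times \<open>N\<close>, which is what makes them part of a minimal system of
  generators. The degrees \<open>rest\<close> can be prescribed as a list, so that the new
  \<open>M 0\<close> is literally the required one.\<close>

lemma change_generators:
  fixes R :: "nat \<Rightarrow> ('n::{finite,linorder}, 'k::field) mpoly mat"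
  assumes res: "minimal_free_resolution N k M gs R" and ys: "list_all2 homogeneous_der bs ys" "set ys \<subseteq> N"
    and indep: "\<And>c v. v \<in> carrier_vec (length gs) \<Longrightarrow> (\<And>l. l < length gs \<Longrightarrow> const_term (vec_index v l) = 0) \<Longrightarrow>
      (\<Sum>j<length ys. const (c j) *s ys ! j) = der_comb gs v \<Longrightarrow> \<forall>j<length ys. c j = 0"
    and rest: "mset (bs @ rest) = mset (M 0)"
  obtains gs' R' where "minimal_free_resolution N k (M(0 := bs @ rest)) gs' R'"
    "change_of_bases M gs R (M(0 := bs @ rest)) gs' R'" "\<And>j. j < length ys \<Longrightarrow> gs' ! j = ys ! j"
proof -
  define n p where "n = length gs" and "p = length ys"
  have gs: "list_all2 homogeneous_der (M 0) gs" and gs_im: "der_comb gs ` carrier_vec n = N"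
    using minimal_free_resolution_min_gens[OF res] by (auto simp: min_gens_def n_def)
  have len: "length (M 0) = n" "length bs = p" using gs ys by (auto simp: n_def p_def dest: list_all2_lengthD)
  obtain T where T: "graded_mat bs (M 0) T" and Trow: "\<And>j. j < p \<Longrightarrow> der_comb gs (row T j) = ys ! j"
    and yT: "\<And>v. v \<in> carrier_vec p \<Longrightarrow> der_comb ys v = der_comb gs (row_map T v)"
    using homogeneous_lift_list[OF gs ys(1)] ys(2) gs_im by (metis n_def p_def)
  have cT: "T \<in> carrier_mat p n" using graded_mat_carrier[OF T] by (simp add: len)
  have "\<forall>j<p. c j = 0" if c: "\<And>k. k < n \<Longrightarrow> (\<Sum>j<p. c j * const_term (T $$ (j, k))) = 0" for c
  proof -
    define v :: "('n, 'k) mpoly Matrix.vec" where "v = Matrix.vec p (\<lambda>j. const (c j))"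
    have v: "v \<in> carrier_vec p" by (simp add: v_def)
    have "const_term (vec_index (row_map T v) k) = 0" if "k < n" for k
      using c[OF that] unfolding row_map_index[OF cT v that] by (simp add: v_def)
    moreover have "(\<Sum>j<p. const (c j) *s ys ! j) = der_comb gs (row_map T v)"
      using yT[OF v] by (simp add: v_def der_comb_def p_def)
    ultimately show ?thesis
      using indep[of "row_map T v" c] row_map_carrier[OF cT, of v] by (auto simp: n_def p_def)
  qed
  then obtain P Q where PQ: "graded_equiv (bs @ rest) (M 0) P Q"
    and PT: "\<And>j k. j < p \<Longrightarrow> k < n \<Longrightarrow> P $$ (j, k) = T $$ (j, k)"
    using graded_basis_extension_mset[OF T _ rest] by (auto simp: len)
  have len': "length (bs @ rest) = n" using graded_equivD(4)[OF PQ] by (simp add: len)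
  have "row P j = row T j" if "j < p" for j
    using that PT graded_equivD(5)[OF PQ] cT len' by (intro eq_vecI) (auto simp: len)
  with Trow len' have new: "map (\<lambda>j. der_comb gs (row P j)) [0..<length (bs @ rest)] ! j = ys ! j" if "j < p" for j
    using that len by simp
  show thesis
  proof (rule basis_change_at[OF res PQ])
    fix gs' R'
    assume "minimal_free_resolution N k (M(0 := bs @ rest)) gs' R'"
      "change_of_bases M gs R (M(0 := bs @ rest)) gs' R'"
      "(0::nat) = 0 \<Longrightarrow> gs' = map (\<lambda>j. der_comb gs (row P j)) [0..<length (bs @ rest)]"
    with new show thesis by (intro that[of gs' R']) (simp_all add: p_def)
  qed
qed

text \<open>Independence of the targets modulo the irrelevant ideal times the syzygy module is implied by
  independence modulo the square of the irrelevant ideal, since the resolution is minimal.\<close>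

lemma change_syzygies:
  fixes R :: "nat \<Rightarrow> ('n::{finite,linorder}, 'k::field) mpoly mat"
  assumes res: "minimal_free_resolution N k M gs R" and T: "graded_mat bs (M i) T"
    and syz: "\<And>j. j < length bs \<Longrightarrow> row T j \<in> row_map (R (Suc i)) ` carrier_vec (length (M (Suc i)))"
    and indep: "\<And>c. (\<And>l. l < length (M i) \<Longrightarrow> order2 (\<Sum>j<length bs. const (c j) * T $$ (j, l)))
       \<Longrightarrow> \<forall>j<length bs. c j = 0"
  obtains rest R' where "minimal_free_resolution N k (M(Suc i := bs @ rest)) gs R'"
    "change_of_bases M gs R (M(Suc i := bs @ rest)) gs R'"
    "\<And>j. j < length bs \<Longrightarrow> row (R' (Suc i)) j = row T j"
    "\<And>l. 0 < l \<Longrightarrow> l \<le> i \<Longrightarrow> R' l = R l"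
proof -
  define n p where "n = length (M (Suc i))" and "p = length bs"
  have R: "graded_mat (M (Suc i)) (M i) (R (Suc i))" and irr: "irrelevant_mat (R (Suc i))"
    using res by (simp_all add: minimal_free_resolution_iff graded_free_resolution_def)
  have cR: "R (Suc i) \<in> carrier_mat n (length (M i))" using graded_mat_carrier[OF R] by (simp add: n_def)
  have cT: "T \<in> carrier_mat p (length (M i))" using graded_mat_carrier[OF T] by (simp add: p_def)
  have "\<exists>v. hom_vec (bs ! j) (M (Suc i)) v \<and> row_map (R (Suc i)) v = row T j" if j: "j < p" for j
  proof -
    obtain v where v: "v \<in> carrier_vec n" "row T j = row_map (R (Suc i)) v"
      using syz j by (auto simp: n_def p_def)
    then have "row_map (R (Suc i)) (part_vec (bs ! j) (M (Suc i)) v) = row T j"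
      using part_vec_row_map[OF R, of v "bs ! j"] part_vec_id[OF graded_mat_row[OF T, of j]] j
      by (simp add: n_def p_def)
    then show ?thesis using hom_vec_part_vec by blast
  qed
  then obtain v where v: "\<And>j. j < p \<Longrightarrow> hom_vec (bs ! j) (M (Suc i)) (v j)"
    "\<And>j. j < p \<Longrightarrow> row_map (R (Suc i)) (v j) = row T j" by metis
  define V where "V = mat p n (\<lambda>(j, k). vec_index (v j) k)"
  have cV: "V \<in> carrier_mat p n" by (simp add: V_def)
  have V: "graded_mat bs (M (Suc i)) V"
    using v(1) by (auto simp: graded_mat_iff V_def hom_vec_def n_def p_def)
  have VR: "(\<Sum>l<n. V $$ (j, l) * R (Suc i) $$ (l, k)) = T $$ (j, k)" if "j < p" "k < length (M i)" for j k
  proof -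
    have "v j \<in> carrier_vec n" using v(1)[OF that(1)] by (simp add: hom_vec_def n_def)
    then have "(\<Sum>l<n. V $$ (j, l) * R (Suc i) $$ (l, k)) = vec_index (row_map (R (Suc i)) (v j)) k"
      using that by (simp add: row_map_index[OF cR] V_def)
    then show ?thesis using v(2)[OF that(1)] that cT by simp
  qed
  have "\<forall>j<p. c j = 0" if c: "\<And>k. k < n \<Longrightarrow> (\<Sum>j<p. c j * const_term (V $$ (j, k))) = 0" for c
  proof -
    \<comment> \<open>Each summand is a product of a coordinate without constant term and an entry
      of a minimal resolution, hence lies in the square of the irrelevant ideal.\<close>
    have "order2 (\<Sum>j<p. const (c j) * T $$ (j, k))" if k: "k < length (M i)" for k
    proof -
      have "(\<Sum>j<p. const (c j) * T $$ (j, k))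
          = (\<Sum>j<p. \<Sum>l<n. const (c j) * V $$ (j, l) * R (Suc i) $$ (l, k))"
        using k by (simp add: VR[symmetric] sum_distrib_left mult.assoc)
      also have "\<dots> = (\<Sum>l<n. (\<Sum>j<p. const (c j) * V $$ (j, l)) * R (Suc i) $$ (l, k))"
        by (subst sum.swap) (simp add: sum_distrib_right)
      also have "order2 \<dots>"
        using c irr k cR by (intro order2_sum order2_mult) (auto simp: irrelevant_mat_def)
      finally show ?thesis .
    qed
    then show ?thesis using indep by (simp add: p_def)
  qed
  then obtain rest P Q where PQ: "graded_equiv (bs @ rest) (M (Suc i)) P Q"
    and PV: "\<And>j k. j < p \<Longrightarrow> k < n \<Longrightarrow> P $$ (j, k) = V $$ (j, k)"
    using graded_basis_extension[OF V] by (auto simp: n_def p_def)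
  have cP: "P \<in> carrier_mat n n" using graded_equivD(5)[OF PQ] by (simp add: n_def)
  have pn: "p \<le> n" using graded_equivD(4)[OF PQ] by (simp add: n_def p_def)
  have PR: "row (P * R (Suc i)) j = row T j" if "j < p" for j
  proof (rule eq_vecI)
    show "dim_vec (row (P * R (Suc i)) j) = dim_vec (row T j)" using cR cT by simp
    fix k assume "k < dim_vec (row T j)"
    then have k: "k < length (M i)" using cT by simp
    have "(P * R (Suc i)) $$ (j, k) = (\<Sum>l<n. P $$ (j, l) * R (Suc i) $$ (l, k))"
      using that pn k by (intro mat_mult_index[OF cP cR]) auto
    also have "\<dots> = T $$ (j, k)" using that PV VR[OF that k] by simp
    finally show "vec_index (row (P * R (Suc i)) j) k = vec_index (row T j) k"
      using that pn k cP cR cT by simp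
  qed
  show thesis
  proof (rule basis_change_at[OF res PQ])
    fix gs' R'
    assume *: "minimal_free_resolution N k (M(Suc i := bs @ rest)) gs' R'"
      "change_of_bases M gs R (M(Suc i := bs @ rest)) gs' R'"
      "Suc i \<noteq> 0 \<Longrightarrow> gs' = gs" "\<And>l. Suc i = Suc l \<Longrightarrow> R' (Suc i) = P * R (Suc i)"
      "\<And>l. Suc l \<noteq> Suc i \<Longrightarrow> l \<noteq> Suc i \<Longrightarrow> R' (Suc l) = R (Suc l)"
    have "R' l = R l" if "0 < l" "l \<le> i" for l
      using *(5)[of "l - 1"] that by simp
    with * PR show thesis by (intro that[of rest R']) (auto simp: p_def)
  qed
qed

subsection \<open>Cyclic cokernels\<close>

text \<open>Gaussian elimination without division: each step clears one column by
  cross-multiplication with a pivot, which suffices over a domain.\<close>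

lemma more_rows_dependent:
  fixes E :: "'i \<Rightarrow> 'j \<Rightarrow> 'a::idom"
  assumes "finite J" "finite I" "card J < card I"
  shows "\<exists>u. (\<exists>i\<in>I. u i \<noteq> 0) \<and> (\<forall>j\<in>J. (\<Sum>i\<in>I. u i * E i j) = 0)"
  using assms
proof (induction J arbitrary: I E rule: finite_induct)
  case empty
  then have "I \<noteq> {}" by auto
  then show ?case by (intro exI[of _ "\<lambda>_. 1"]) auto
next
  case (insert j0 J)
  show ?case
  proof (cases "\<forall>i\<in>I. E i j0 = 0")
    case True
    have "card J < card I" using insert by simp
    from insert.IH[OF insert.prems(1) this, of E] True show ?thesis by auto
  next
    case False
    then obtain i0 where i0: "i0 \<in> I" "E i0 j0 \<noteq> 0" by blast
    define E' where "E' i j = E i0 j0 * E i j - E i j0 * E i0 j" for i j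
    have "card J < card (I - {i0})" using insert i0 by simp
    from insert.IH[OF _ this, of E'] obtain u i1 where i1: "i1 \<in> I - {i0}" "u i1 \<noteq> 0"
      and u: "\<And>j. j \<in> J \<Longrightarrow> (\<Sum>i\<in>I - {i0}. u i * E' i j) = 0"
      using insert.prems by auto
    \<comment> \<open>The coefficient of the pivot row is chosen to cancel column \<open>j0\<close>;
      the other coefficients carry the pivot as a factor because of the cross-multiplication in
      \<open>E'\<close>.\<close>
    define w where "w i = (if i = i0 then - (\<Sum>i\<in>I - {i0}. u i * E i j0) else E i0 j0 * u i)" for i
    have "(\<Sum>i\<in>I. w i * E i j) = (\<Sum>i\<in>I - {i0}. u i * E' i j)" for j
    proof -
      have "(\<Sum>i\<in>I. w i * E i j) = w i0 * E i0 j + (\<Sum>i\<in>I - {i0}. E i0 j0 * u i * E i j)"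
        using insert.prems i0 by (subst sum.remove[of _ i0]) (auto simp: w_def)
      also have "w i0 * E i0 j = (\<Sum>i\<in>I - {i0}. - (u i * E i j0 * E i0 j))"
        by (simp add: w_def sum_distrib_right sum_negf)
      finally show ?thesis
        by (simp add: E'_def sum.distrib[symmetric] algebra_simps)
    qed
    moreover have "(\<Sum>i\<in>I - {i0}. u i * E' i j0) = 0"
      by (simp add: E'_def algebra_simps)
    ultimately have "\<forall>j\<in>insert j0 J. (\<Sum>i\<in>I. w i * E i j) = 0" using u by auto
    moreover have "w i1 \<noteq> 0" using i1 i0 by (simp add: w_def)
    ultimately show ?thesis using i1 by blast
  qed
qed

text \<open>Without a nonzero constant entry, the rows of degree at most \<open>e\<close> would only use columns of degree
  less than \<open>e\<close>; counting over all \<open>e\<close> would make the degrees of rows and columns differ by at least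
  the size of the matrix.\<close>

lemma constant_entry:
  fixes E :: "'i \<Rightarrow> 'j \<Rightarrow> ('n::{finite,linorder}, 'k::field) mpoly"
  assumes fin: "finite I" "finite J" and card: "card I = card J" "2 \<le> card I"
    and hom: "\<And>i j. i \<in> I \<Longrightarrow> j \<in> J \<Longrightarrow> hom_shift (a i) (b j) (E i j)"
    and deg: "(\<Sum>i\<in>I. a i) = (\<Sum>j\<in>J. b j) + 1"
    and indep: "\<And>u. (\<And>j. j \<in> J \<Longrightarrow> (\<Sum>i\<in>I. u i * E i j) = 0) \<Longrightarrow> \<forall>i\<in>I. u i = 0"
  shows "\<exists>i\<in>I. \<exists>j\<in>J. const_term (E i j) \<noteq> 0"
proof (rule ccontr)
  assume none: "\<not> ?thesis"
  \<comment> \<open>Entries of negative degree vanish anyway, and those of degree 0 are constants,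
    which vanish by assumption.\<close>
  have zero: "E i j = 0" if "i \<in> I" "j \<in> J" "a i \<le> b j" for i j
  proof (cases "a i = b j")
    case True
    then have "E i j = const (const_term (E i j))" using hom[of i j] that hom_shift_same_const by metis
    then show ?thesis using none that by auto
  next
    case False
    then show ?thesis using hom_shift_less hom that by force
  qed
  have le: "card {i\<in>I. a i \<le> e} \<le> card {j\<in>J. b j < e}" for e
  proof (rule ccontr)
    assume "\<not> ?thesis"
    then obtain u i0 where u: "\<And>j. j \<in> {j\<in>J. b j < e} \<Longrightarrow> (\<Sum>i\<in>{i\<in>I. a i \<le> e}. u i * E i j) = 0"
      and i0: "i0 \<in> {i\<in>I. a i \<le> e}" "u i0 \<noteq> 0"
      using more_rows_dependent[of "{j\<in>J. b j < e}" "{i\<in>I. a i \<le> e}" E] fin by auto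
    have "(\<Sum>i\<in>I. (if a i \<le> e then u i else 0) * E i j) = 0" if j: "j \<in> J" for j
    proof -
      have "(\<Sum>i\<in>I. (if a i \<le> e then u i else 0) * E i j) = (\<Sum>i\<in>{i\<in>I. a i \<le> e}. u i * E i j)"
        using fin by (intro sum.mono_neutral_cong_right) auto
      also have "\<dots> = 0"
      proof (cases "b j < e")
        case False
        then have "E i j = 0" if "i \<in> {i\<in>I. a i \<le> e}" for i using that j by (intro zero) auto
        then show ?thesis by simp
      qed (use u j in auto)
      finally show ?thesis .
    qed
    from indep[OF this] i0 show False by auto
  qed
  define N where "N = Max (insert 0 (a ` I \<union> b ` J))"
  have N: "a i \<le> N" "b j \<le> N" if "i \<in> I" "j \<in> J" for i j
    using that fin by (auto simp: N_def intro!: Max_ge)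
  have count: "(\<Sum>e\<le>N. card {x\<in>X. P x e}) = (\<Sum>x\<in>X. card {e\<in>{..N}. P x e})"
    if "finite X" for X :: "'x set" and P
  proof -
    have "(\<Sum>e\<le>N. card {x\<in>X. P x e}) = (\<Sum>e\<le>N. \<Sum>x\<in>X. if P x e then 1 else 0)"
      unfolding card_eq_sum using that by (intro sum.cong refl sum.inter_filter)
    also have "\<dots> = (\<Sum>x\<in>X. \<Sum>e\<le>N. if P x e then 1 else 0)" by (rule sum.swap)
    also have "\<dots> = (\<Sum>x\<in>X. card {e\<in>{..N}. P x e})"
      unfolding card_eq_sum by (intro sum.cong refl sum.inter_filter[symmetric]) simp
    finally show ?thesis .
  qed
  have "(\<Sum>i\<in>I. card {e\<in>{..N}. a i \<le> e}) = (\<Sum>e\<le>N. card {i\<in>I. a i \<le> e})"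
    by (rule count[OF fin(1), of "\<lambda>i e. a i \<le> e", symmetric])
  also have "\<dots> \<le> (\<Sum>e\<le>N. card {j\<in>J. b j < e})" by (rule sum_mono) (rule le)
  also have "\<dots> = (\<Sum>j\<in>J. card {e\<in>{..N}. b j < e})"
    by (rule count[OF fin(2), of "\<lambda>j e. b j < e"])
  finally have "(\<Sum>i\<in>I. card {e\<in>{..N}. a i \<le> e}) \<le> (\<Sum>j\<in>J. card {e\<in>{..N}. b j < e})" .
  moreover have "card {e\<in>{..N}. a i \<le> e} + a i = Suc N" if "i \<in> I" for i
  proof -
    have "{e\<in>{..N}. a i \<le> e} = {a i..N}" by auto
    moreover obtain j where \<open>j \<in> J\<close> using card by fastforce
    ultimately show ?thesis using N(1)[OF that \<open>j \<in> J\<close>] by simp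
  qed
  then have "(\<Sum>i\<in>I. card {e\<in>{..N}. a i \<le> e}) + sum a I = card I * Suc N"
    using sum.cong[OF refl, of I "\<lambda>i. card {e\<in>{..N}. a i \<le> e} + a i" "\<lambda>_. Suc N"]
    by (simp only: sum.distrib sum_constant of_nat_id)
  moreover have "card {e\<in>{..N}. b j < e} + b j = N" if "j \<in> J" for j
  proof -
    have "{e\<in>{..N}. b j < e} = {b j<..N}" by auto
    moreover obtain i where "i \<in> I" using card(2) by fastforce
    ultimately show ?thesis using N(2)[OF _ that] by simp
  qed
  then have "(\<Sum>j\<in>J. card {e\<in>{..N}. b j < e}) + sum b J = card J * N"
    using sum.cong[OF refl, of J "\<lambda>j. card {e\<in>{..N}. b j < e} + b j" "\<lambda>_. N"]
    by (simp only: sum.distrib sum_constant of_nat_id)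
  \<comment> \<open>Summing over all \<open>e\<close> up to \<open>N\<close> gives
    \<open>n * (N + 1) - sum a I \<le> n * N - sum b J\<close> with \<open>n = card I\<close>, so
    that \<open>n\<close> is at most the degree difference 1.\<close>
  ultimately have "card I * Suc N \<le> card J * N + 1" using deg by linarith
  then show False using card by simp
qed

text \<open>While the size is at least 2 there is a constant pivot. Eliminating its row and column
  leaves the cokernel unchanged and, the two degrees being equal, also the degree difference 1. The
  process ends with a 1 by 1 matrix, whose cokernel is generated by the surviving coordinate
  \<open>k\<close>.\<close>

lemma cyclic_cokernel:
  fixes E :: "'i \<Rightarrow> 'j \<Rightarrow> ('n::{finite,linorder}, 'k::field) mpoly"
  assumes "finite I" "finite J" "card I = card J" "J \<noteq> {}"
    and "\<And>i j. i \<in> I \<Longrightarrow> j \<in> J \<Longrightarrow> hom_shift (a i) (b j) (E i j)"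
    and "(\<Sum>i\<in>I. a i) = (\<Sum>j\<in>J. b j) + 1"
    and "\<And>u. (\<And>j. j \<in> J \<Longrightarrow> (\<Sum>i\<in>I. u i * E i j) = 0) \<Longrightarrow> \<forall>i\<in>I. u i = 0"
  shows "\<exists>k\<in>J. \<forall>v. \<exists>u s. \<forall>j\<in>J. v j = (\<Sum>i\<in>I. u i * E i j) + (if j = k then s else 0)"
  using assms
proof (induction "card J" arbitrary: I J E rule: less_induct)
  case less
  show ?case
  proof (cases "card J = 1")
    case True
    then obtain k where "J = {k}" by (rule card_1_singletonE)
    moreover have "\<exists>u s. \<forall>j\<in>{k}. v j = (\<Sum>i\<in>I. u i * E i j) + (if j = k then s else 0)" for v
      by (intro exI[of _ "\<lambda>_. 0"] exI[of _ "v k"]) simp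
    ultimately show ?thesis by simp
  next
    case False
    have "0 < card J" using less.prems(2,4) by (simp add: card_gt_0_iff)
    with False less.prems(3) have "2 \<le> card I" by linarith
    from constant_entry[OF less.prems(1-3) this less.prems(5-7)]
    obtain i0 k0 where ik: "i0 \<in> I" "k0 \<in> J" "const_term (E i0 k0) \<noteq> 0" by blast
    have ab: "a i0 = b k0" using hom_shift_const_term[OF less.prems(5)[OF ik(1,2)]] ik(3) by blast
    define d :: "('n, 'k) mpoly" where "d = const (inverse (const_term (E i0 k0)))"
    have "E i0 k0 = const (const_term (E i0 k0))"
      using less.prems(5)[OF ik(1,2)] ab hom_shift_same_const by metis
    then have d: "d * E i0 k0 = 1" using ik(3) by (metis const_inverse_mult d_def)
    define I' J' where "I' = I - {i0}" and "J' = J - {k0}"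
    \<comment> \<open>The Schur complement of the pivot; \<open>d\<close> is the inverse of the
      pivot.\<close>
    define E' where "E' i j = E i j - E i k0 * d * E i0 j" for i j
    have fin': "finite I'" "finite J'" "card I' = card J'" "card J' < card J"
      using less.prems ik by (auto simp: I'_def J'_def card_gt_0_iff)
    have "J' \<noteq> {}"
    proof
      assume "J' = {}"
      then have "J = {k0}" using ik by (auto simp: J'_def)
      then show False using False by simp
    qed
    have split: "(\<Sum>i\<in>I. f i) = f i0 + (\<Sum>i\<in>I'. f i)" for f :: "'i \<Rightarrow> ('n, 'k) mpoly"
      using less.prems ik unfolding I'_def by (intro sum.remove) auto
    have hom': "hom_shift (a i) (b j) (E' i j)" if "i \<in> I'" "j \<in> J'" for i j
    proof -
      have "hom_shift (a i) (b k0) (E i k0 * d)"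
        using less.prems(5)[of i k0] ik that unfolding d_def
        by (intro hom_shift_mult[OF _ hom_shift_const]) (auto simp: I'_def)
      moreover have "hom_shift (b k0) (b j) (E i0 j)"
        using less.prems(5)[of i0 j] ik that ab by (simp add: J'_def)
      ultimately have "hom_shift (a i) (b j) (- (E i k0 * d * E i0 j))"
        by (simp add: hom_shift_mult)
      moreover have "hom_shift (a i) (b j) (E i j)" using less.prems(5) that by (simp add: I'_def J'_def)
      ultimately show ?thesis unfolding E'_def by (metis add_uminus_conv_diff hom_shift_add)
    qed
    have deg': "(\<Sum>i\<in>I'. a i) = (\<Sum>j\<in>J'. b j) + 1"
      using less.prems(6) sum.remove[OF less.prems(1) ik(1), of a] sum.remove[OF less.prems(2) ik(2), of b] ab
      by (simp add: I'_def J'_def)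
    \<comment> \<open>A combination of rows of the Schur complement plus \<open>x\<close> times the
      pivot row is a combination of rows of \<open>E\<close>, with the coefficient at
      \<open>i0\<close> corrected accordingly.\<close>
    have E_E': "(\<Sum>i\<in>I. (if i = i0 then x - (\<Sum>i\<in>I'. u i * E i k0 * d) else u i) * E i j)
        = (\<Sum>i\<in>I'. u i * E' i j) + x * E i0 j" for u x j
    proof -
      have "(\<Sum>i\<in>I. (if i = i0 then x - (\<Sum>i\<in>I'. u i * E i k0 * d) else u i) * E i j)
          = (x - (\<Sum>i\<in>I'. u i * E i k0 * d)) * E i0 j + (\<Sum>i\<in>I'. u i * E i j)"
        unfolding split by (auto simp: I'_def intro!: sum.cong)
      also have "\<dots> = x * E i0 j + (\<Sum>i\<in>I'. u i * E i j - u i * E i k0 * d * E i0 j)"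
        by (simp add: algebra_simps sum_distrib_left sum_subtractf)
      finally show ?thesis by (simp add: E'_def algebra_simps)
    qed
    have E'k0: "E' i k0 = 0" for i
      using d by (simp add: E'_def mult.assoc)
    have indep': "\<forall>i\<in>I'. u i = 0" if u: "\<And>j. j \<in> J' \<Longrightarrow> (\<Sum>i\<in>I'. u i * E' i j) = 0" for u
    proof -
      have "(\<Sum>i\<in>I'. u i * E' i j) = 0" if "j \<in> J" for j
        using u that E'k0 by (cases "j = k0") (auto simp: J'_def)
      with E_E'[of 0 u] less.prems(7)[of "\<lambda>i. if i = i0 then 0 - (\<Sum>i\<in>I'. u i * E i k0 * d) else u i"]
      have "\<forall>i\<in>I. (if i = i0 then 0 - (\<Sum>i\<in>I'. u i * E i k0 * d) else u i) = 0" by simp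
      then show ?thesis by (auto simp: I'_def split: if_splits)
    qed
    from less.hyps[OF fin'(4) fin'(1-3) \<open>J' \<noteq> {}\<close> hom' deg' indep']
    obtain k where k: "k \<in> J'"
      and IH: "\<And>v. \<exists>u s. \<forall>j\<in>J'. v j = (\<Sum>i\<in>I'. u i * E' i j) + (if j = k then s else 0)" by blast
    have "\<exists>u s. \<forall>j\<in>J. v j = (\<Sum>i\<in>I. u i * E i j) + (if j = k then s else 0)" for v
    proof -
      obtain u s where us: "\<And>j. j \<in> J' \<Longrightarrow>
          v j - v k0 * d * E i0 j = (\<Sum>i\<in>I'. u i * E' i j) + (if j = k then s else 0)"
        using IH[of "\<lambda>j. v j - v k0 * d * E i0 j"] by blast
      have "v j = (\<Sum>i\<in>I'. u i * E' i j) + v k0 * d * E i0 j + (if j = k then s else 0)" if "j \<in> J" for j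
      proof (cases "j = k0")
        case True
        then show ?thesis using k d E'k0 by (auto simp: J'_def mult.assoc)
      next
        case False
        then show ?thesis using us[of j] that by (simp add: J'_def algebra_simps)
      qed
      then show ?thesis unfolding E_E'[symmetric] by (intro exI ballI) assumption
    qed
    moreover have "k \<in> J" using k by (simp add: J'_def)
    ultimately show ?thesis by blast
  qed
qed

subsection \<open>Generators of strictly plus-one generated deletions\<close>

text \<open>The basis of the free submodule together with the single relation of the resolution forms a square
  graded matrix whose row and column degrees differ by one in total, so the quotient is cyclic.\<close>

lemma plus_one_generators:
  fixes gs \<theta>s :: "('n::{finite,linorder}, 'k::field) der list"
  assumes res: "minimal_free_resolution N k M gs R" and M0: "M 0 = c # ds" and M1: "M 1 = [c + 1]"
    and row: "vec_index (row (R 1) 0) 0 \<noteq> 0"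
    and \<theta>s: "list_all2 homogeneous_der ds \<theta>s" "der_comb \<theta>s ` carrier_vec (length \<theta>s) \<subseteq> N"
    and basis: "\<And>v. v \<in> carrier_vec (length \<theta>s) \<Longrightarrow> der_comb \<theta>s v = 0 \<Longrightarrow> v = 0\<^sub>v (length \<theta>s)"
  obtains \<phi> where "homogeneous_der c \<phi>" "min_gens N (ds @ [c]) (\<theta>s @ [\<phi>])"
proof -
  define l where "l = length \<theta>s"
  have min: "min_gens N (c # ds) gs" using minimal_free_resolution_min_gens[OF res] M0 by simp
  then have gs: "list_all2 homogeneous_der (c # ds) gs" and gs_im: "der_comb gs ` carrier_vec (length gs) = N"
    by (auto simp: min_gens_def)
  have len: "length ds = l" "length gs = Suc l"
    using \<theta>s(1) list_all2_lengthD[OF gs] by (auto simp: l_def dest: list_all2_lengthD)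
  have "graded_mat (M (Suc 0)) (M 0) (R (Suc 0))"
    and "{v \<in> carrier_vec (length (M 0)). der_comb gs v = 0} = row_map (R 1) ` carrier_vec (length (M 1))"
    using res by (simp_all add: minimal_free_resolution_def graded_free_resolution_def)
  then have R1: "graded_mat [c + 1] (c # ds) (R (Suc 0))"
    and ker0: "{v \<in> carrier_vec (Suc l). der_comb gs v = 0} = row_map (R 1) ` carrier_vec 1"
    using M0 M1 by (simp_all add: len)
  have cR: "R 1 \<in> carrier_mat 1 (Suc l)" using graded_mat_carrier[OF R1] len by simp
  define r where "r = row (R 1) 0"
  have r: "r \<in> carrier_vec (Suc l)" unfolding r_def by (rule row_carrier_vec[OF _ cR]) simp
  have "r = row_map (R 1) (unit_vec 1 0)" using row_map_unit_vec[OF cR, of 0] by (simp add: r_def)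
  then have r0: "der_comb gs r = 0" using ker0 by (auto simp: set_eq_iff)
  have "set \<theta>s \<subseteq> N" using set_subset_der_comb_image \<theta>s(2) by blast
  then obtain T where T: "graded_mat ds (c # ds) T"
    and T\<theta>: "\<And>j. j < l \<Longrightarrow> der_comb gs (row T j) = \<theta>s ! j"
    using homogeneous_lift_list[OF gs \<theta>s(1)] gs_im by (metis l_def)
  have cT: "T \<in> carrier_mat l (Suc l)" using graded_mat_carrier[OF T] len by simp
  \<comment> \<open>Row degrees are \<open>ds\<close> and \<open>c + 1\<close>, column degrees
    \<open>c\<close> and \<open>ds\<close>: the total difference is 1 whatever \<open>ds\<close>
    is.\<close>
  define E where "E i j = (if i < l then T $$ (i, j) else vec_index r j)" for i j
  define Em where "Em = mat (Suc l) (Suc l) (\<lambda>(i, j). E i j)"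
  have cE: "Em \<in> carrier_mat (Suc l) (Suc l)" by (simp add: Em_def)
  have rows: "map (\<lambda>j. der_comb gs (row Em j)) [0..<Suc l] = \<theta>s @ [0]"
  proof (rule nth_equalityI)
    show "length (map (\<lambda>j. der_comb gs (row Em j)) [0..<Suc l]) = length (\<theta>s @ [0])" by (simp add: l_def)
    fix j assume "j < length (map (\<lambda>j. der_comb gs (row Em j)) [0..<Suc l])"
    then have j: "j < Suc l" by simp
    have "row Em j = (if j < l then row T j else r)"
      using j cT r by (intro eq_vecI) (auto simp: Em_def E_def)
    then show "map (\<lambda>j. der_comb gs (row Em j)) [0..<Suc l] ! j = (\<theta>s @ [0]) ! j"
      using j T\<theta> r0 by (auto simp: nth_append l_def nth_append simp del: upt_Suc)
  qed
  have comb: "der_comb gs (row_map Em v) = der_comb \<theta>s v" if v: "v \<in> carrier_vec (Suc l)" for v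
    using der_comb_map_row[OF _ v, of Em gs] cE len by (simp only: rows der_comb_snoc) simp
  have idx: "vec_index (row_map Em (Matrix.vec (Suc l) u)) j = (\<Sum>i<Suc l. u i * E i j)" if "j < Suc l" for u j
    using that by (subst row_map_index[OF cE _ that]) (auto simp: Em_def intro!: sum.cong)
  have hom: "hom_shift ((ds @ [c + 1]) ! i) ((c # ds) ! j) (E i j)" if "i < Suc l" "j < Suc l" for i j
    using that graded_mat_index[OF T, of i j] graded_mat_index[OF R1, of 0 j] cR len
    by (auto simp: E_def r_def nth_append less_Suc_eq)
  have deg: "(\<Sum>i<Suc l. (ds @ [c + 1]) ! i) = (\<Sum>j<Suc l. (c # ds) ! j) + 1"
  proof -
    have "(\<Sum>i<Suc l. (ds @ [c + 1]) ! i) = sum_list (ds @ [c + 1])"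
      using len by (simp only: sum_list_sum_nth length_append_singleton atLeast0LessThan)
    moreover have "(\<Sum>j<Suc l. (c # ds) ! j) = sum_list (c # ds)"
      using len by (simp only: sum_list_sum_nth length_Cons atLeast0LessThan)
    ultimately show ?thesis by simp
  qed
  \<comment> \<open>The basis property kills the coefficients of the \<open>\<theta>s\<close>; the
    relation remains, and its entry in column 0 is the nonzero entry required of a strictly plus-one
    generated resolution.\<close>
  have indep: "\<forall>i\<in>{..<Suc l}. u i = 0" if u: "\<And>j. j \<in> {..<Suc l} \<Longrightarrow> (\<Sum>i\<in>{..<Suc l}. u i * E i j) = 0" for u
  proof -
    define v where "v = Matrix.vec (Suc l) u"
    have "row_map Em v = 0\<^sub>v (Suc l)"
      using u carrier_vecD[OF row_map_carrier[OF cE, of v]] by (intro eq_vecI) (auto simp: v_def idx simp del: sum.lessThan_Suc)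
    then have "der_comb \<theta>s v = 0" using comb[of v] der_comb_zero[of gs] by (simp add: v_def len)
    then have "der_comb \<theta>s (Matrix.vec l u) = 0"
      using der_comb_cong[of \<theta>s v "Matrix.vec l u"] by (simp add: v_def l_def)
    then have "Matrix.vec l u = 0\<^sub>v l" using basis[of "Matrix.vec l u"] by (simp add: l_def)
    then have ul: "u i = 0" if "i < l" for i using that by (metis index_vec index_zero_vec(1))
    then have "u l * vec_index r 0 = 0" using u[of 0] by (simp add: E_def)
    then have "u l = 0" using row by (simp add: r_def)
    with ul show ?thesis by (auto simp: less_Suc_eq)
  qed
  obtain j0 where j0: "j0 < Suc l"
    and cyc: "\<And>v. \<exists>u s. \<forall>j\<in>{..<Suc l}. v j = (\<Sum>i\<in>{..<Suc l}. u i * E i j) + (if j = j0 then s else 0)"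
    using cyclic_cokernel[of "{..<Suc l}" "{..<Suc l}" "\<lambda>i. (ds @ [c + 1]) ! i" "\<lambda>j. (c # ds) ! j" E]
      hom deg indep by auto
  define \<phi> where "\<phi> = gs ! j0"
  define e where "e = (c # ds) ! j0"
  have \<phi>: "homogeneous_der e \<phi>" using list_all2_nthD2[OF gs] j0 len by (simp add: \<phi>_def e_def)
  have ys: "list_all2 homogeneous_der (ds @ [e]) (\<theta>s @ [\<phi>])"
    using \<theta>s(1) \<phi> by (intro list_all2_appendI) auto
  have "der_comb (\<theta>s @ [\<phi>]) ` carrier_vec (length (\<theta>s @ [\<phi>])) = N"
  proof
    show "der_comb (\<theta>s @ [\<phi>]) ` carrier_vec (length (\<theta>s @ [\<phi>])) \<subseteq> N"
    proof safe
      fix v :: "('n, 'k) mpoly Matrix.vec" assume "v \<in> carrier_vec (length (\<theta>s @ [\<phi>]))"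
      have "der_comb \<theta>s v = der_comb \<theta>s (Matrix.vec l (vec_index v))"
        by (rule der_comb_cong) (simp add: l_def)
      then have "der_comb \<theta>s v \<in> N" using \<theta>s(2) by (auto simp: l_def)
      then obtain w where w: "w \<in> carrier_vec (Suc l)" "der_comb \<theta>s v = der_comb gs w"
        using gs_im len by auto
      have "der_comb (\<theta>s @ [\<phi>]) v = der_comb gs (w + vec_index v l \<cdot>\<^sub>v unit_vec (Suc l) j0)"
        using w j0 len der_comb_unit_vec[of j0 gs]
        by (simp add: der_comb_snoc der_comb_add der_comb_smult \<phi>_def l_def)
      then show "der_comb (\<theta>s @ [\<phi>]) v \<in> N" using gs_im w(1) len by auto
    qed
    show "N \<subseteq> der_comb (\<theta>s @ [\<phi>]) ` carrier_vec (length (\<theta>s @ [\<phi>]))"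
    proof
      fix \<eta> assume "\<eta> \<in> N"
      then obtain v where v: "v \<in> carrier_vec (Suc l)" "\<eta> = der_comb gs v" using gs_im len by auto
      obtain u s where us: "\<And>j. j < Suc l \<Longrightarrow> vec_index v j = (\<Sum>i<Suc l. u i * E i j) + (if j = j0 then s else 0)"
        using cyc[of "vec_index v"] by auto
      have cu: "row_map Em (Matrix.vec (Suc l) u) \<in> carrier_vec (Suc l)" by (rule row_map_carrier[OF cE])
      have "v = row_map Em (Matrix.vec (Suc l) u) + s \<cdot>\<^sub>v unit_vec (Suc l) j0"
        using v us cu j0 by (intro eq_vecI) (auto simp: idx simp del: sum.lessThan_Suc)
      then have "\<eta> = der_comb \<theta>s (Matrix.vec (Suc l) u) + s *s \<phi>"
        using v cu j0 len comb[of "Matrix.vec (Suc l) u"] der_comb_unit_vec[of j0 gs]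
        by (simp add: der_comb_add der_comb_smult \<phi>_def)
      also have "\<dots> = der_comb (\<theta>s @ [\<phi>]) (Matrix.vec (Suc l) (\<lambda>i. if i < l then u i else s))"
        by (simp add: der_comb_snoc l_def) (auto simp: der_comb_def l_def)
      finally show "\<eta> \<in> der_comb (\<theta>s @ [\<phi>]) ` carrier_vec (length (\<theta>s @ [\<phi>]))" by (auto simp: l_def)
    qed
  qed
  \<comment> \<open>There are as many new generators as old ones, so they are minimal too, and
    comparing degrees shows that the surviving old generator has degree \<open>c\<close>, whichever
    index \<open>j0\<close> is.\<close>
  from min_gens_unique(2)[OF min ys this] have *: "mset (ds @ [e]) = mset (c # ds)" "min_gens N (ds @ [e]) (\<theta>s @ [\<phi>])"
    using len by (auto simp: l_def)
  then have "e = c" by simp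
  with \<phi> * that show thesis by simp
qed

subsection \<open>Deleting one or two hyperplanes\<close>

text \<open>Coefficients are functions on all of \<open>nat\<close>, so combinations can be added,
  cut and shifted without dimension conditions; only the values below \<open>length gs\<close>
  matter.\<close>

definition comb :: "('n::finite, 'k::comm_ring_1) der list \<Rightarrow> (nat \<Rightarrow> ('n, 'k) mpoly) \<Rightarrow> ('n, 'k) der" where
  "comb gs a = (\<Sum>j<length gs. a j *s gs ! j)"

lemma der_comb_eq_comb: "der_comb gs v = comb gs (vec_index v)"
  by (simp add: der_comb_def comb_def)

lemma comb_eq_der_comb: "comb gs a = der_comb gs (Matrix.vec (length gs) a)"
  by (simp add: der_comb_def comb_def)

lemma range_comb: "range (comb gs) = der_comb gs ` carrier_vec (length gs)"
proof safe
  show "comb gs a \<in> der_comb gs ` carrier_vec (length gs)" for a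
    unfolding comb_eq_der_comb by (rule imageI) simp
  show "der_comb gs v \<in> range (comb gs)" for v
    unfolding der_comb_eq_comb by (rule rangeI)
qed

lemma comb_add: "comb gs (\<lambda>j. a j + b j) = comb gs a + comb gs b"
  by (simp add: comb_def der.scale_left_distrib sum.distrib)

lemma comb_diff: "comb gs (\<lambda>j. a j - b j) = comb gs a - comb gs b"
  by (simp add: comb_def der.scale_left_diff_distrib sum_subtractf)

lemma comb_uminus: "comb gs (\<lambda>j. - a j) = - comb gs a"
  by (simp add: comb_def sum_negf der.scale_minus_left)

lemma comb_scale: "comb gs (\<lambda>j. s * a j) = s *s comb gs a"
  by (simp add: comb_def der.scale_sum_right der.scale_scale)

lemma comb_zero [simp]: "comb gs (\<lambda>j. 0) = 0"
  by (simp add: comb_def)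

lemma comb_sum: "comb gs (\<lambda>j. \<Sum>i\<in>I. f i j) = (\<Sum>i\<in>I. comb gs (f i))"
  by (induction I rule: infinite_finite_induct) (auto simp: comb_add)

lemma comb_cong: "(\<And>j. j < length gs \<Longrightarrow> a j = b j) \<Longrightarrow> comb gs a = comb gs b"
  by (simp add: comb_def)

lemma comb_append: "comb (xs @ ys) a = comb xs a + comb ys (\<lambda>j. a (length xs + j))"
proof -
  have "comb (xs @ ys) a = (\<Sum>j<length xs. a j *s (xs @ ys) ! j)
      + (\<Sum>j\<in>{length xs..<length xs + length ys}. a j *s (xs @ ys) ! j)"
    unfolding comb_def length_append lessThan_atLeast0 by (rule sum.atLeastLessThan_concat[symmetric]) auto
  also have "(\<Sum>j\<in>{length xs..<length xs + length ys}. a j *s (xs @ ys) ! j)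
      = (\<Sum>j<length ys. a (length xs + j) *s ys ! j)"
    by (rule sum.reindex_bij_witness[of _ "\<lambda>j. length xs + j" "\<lambda>j. j - length xs"]) (auto simp: nth_append)
  finally show ?thesis by (simp add: comb_def nth_append)
qed

lemma comb_Cons: "comb (x # xs) a = a 0 *s x + comb xs (\<lambda>j. a (Suc j))"
  using comb_append[of "[x]" xs a] by (simp add: comb_def)

lemma comb_Nil [simp]: "comb [] a = 0"
  by (simp add: comb_def)

lemma subspace_range_comb: "der.subspace (range (comb gs))"
proof (rule der.subspaceI)
  show "0 \<in> range (comb gs)" using comb_zero by (metis rangeI)
  show "x + y \<in> range (comb gs)" if xy: "x \<in> range (comb gs)" "y \<in> range (comb gs)" for x y
  proof -
    obtain a b where "x = comb gs a" "y = comb gs b" using xy by blast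
    then have "x + y = comb gs (\<lambda>j. a j + b j)" by (simp add: comb_add)
    then show ?thesis by blast
  qed
  show "s *s x \<in> range (comb gs)" if x: "x \<in> range (comb gs)" for s x
  proof -
    obtain a where "x = comb gs a" using x by blast
    then have "s *s x = comb gs (\<lambda>j. s * a j)" by (simp add: comb_scale)
    then show ?thesis by blast
  qed
qed

lemma min_gens_range: "min_gens N as gs \<Longrightarrow> N = range (comb gs)"
  unfolding min_gens_def range_comb by blast

lemma min_gens_comb_relation:
  assumes "min_gens N as gs" "comb gs a = 0" "k < length gs"
  shows "const_term (a k) = 0"
  using min_gens_relation[OF assms(1), of "Matrix.vec (length gs) a" k] assms by (simp add: comb_eq_der_comb)

lemma homogeneous_comb_lift:
  fixes gs :: "('n::finite, 'k::comm_ring_1) der list"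
  assumes gs: "list_all2 homogeneous_der as gs" and "homogeneous_der e \<theta>" "\<theta> \<in> range (comb gs)"
  obtains a where "\<theta> = comb gs a" "\<And>i. i < length gs \<Longrightarrow> hom_shift e (as ! i) (a i)"
proof -
  obtain v where v: "hom_vec e as v" "\<theta> = der_comb gs v"
    using homogeneous_lift[OF gs assms(2)] assms(3) by (auto simp: range_comb)
  then show thesis using list_all2_lengthD[OF gs]
    by (intro that[of "vec_index v"]) (auto simp: der_comb_eq_comb hom_vec_def)
qed

lemma homogeneous_der_scale:
  fixes \<theta> :: "('n::finite, 'k::comm_ring_1) der"
  assumes "homogeneous 1 \<alpha>" "homogeneous_der e \<theta>"
  shows "homogeneous_der (Suc e) (\<alpha> *s \<theta>)"
proof -
  have "hom_shift (1 + e) (0 + e) \<alpha>"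
    using assms(1) by (simp only: homogeneous_iff_hom_shift hom_shift_add_cancel)
  then have "hom_shift (Suc e) e \<alpha>" by simp
  then show ?thesis using assms(2) by (auto simp: homogeneous_der_iff intro: hom_shift_mult)
qed

text \<open>\<open>N\<close> stands for the derivations of one deletion and
  \<open>range (comb \<theta>s)\<close> for \<open>D(A)\<close>. The assumptions
  \<open>scale_in\<close> and \<open>dvd\<close> say that the annihilator of \<open>\<phi>\<close>
  modulo \<open>D(A)\<close> is exactly the ideal of \<open>\<alpha>\<close>.\<close>

locale deletion =
  fixes N :: "('n::{finite,linorder}, 'k::field) der set" and \<alpha> :: "('n, 'k) mpoly"
    and \<theta>s :: "('n, 'k) der list" and ds :: "nat list" and \<phi> :: "('n, 'k) der" and c :: nat
  assumes linear: "homogeneous 1 \<alpha>"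
    and gens: "min_gens N (ds @ [c]) (\<theta>s @ [\<phi>])"
    and basis: "\<And>a i. comb \<theta>s a = 0 \<Longrightarrow> i < length \<theta>s \<Longrightarrow> a i = 0"
    and hom_\<theta>s: "list_all2 homogeneous_der ds \<theta>s"
    and hom_\<phi>: "homogeneous_der c \<phi>"
    and scale_in: "\<And>\<eta>. \<eta> \<in> N \<Longrightarrow> \<alpha> *s \<eta> \<in> range (comb \<theta>s)"
    and dvd: "\<And>g. g *s \<phi> \<in> range (comb \<theta>s) \<Longrightarrow> \<alpha> dvd g"
begin

lemma N_iff: "\<eta> \<in> N \<longleftrightarrow> (\<exists>a g. \<eta> = comb \<theta>s a + g *s \<phi>)"
proof -
  have "(\<exists>b. \<eta> = comb (\<theta>s @ [\<phi>]) b) \<longleftrightarrow> (\<exists>a g. \<eta> = comb \<theta>s a + g *s \<phi>)"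
  proof
    assume "\<exists>a g. \<eta> = comb \<theta>s a + g *s \<phi>"
    then obtain a g where "\<eta> = comb \<theta>s a + g *s \<phi>" by blast
    also have "\<dots> = comb (\<theta>s @ [\<phi>]) (a(length \<theta>s := g))"
      unfolding comb_append comb_Cons using comb_cong[of \<theta>s "a(length \<theta>s := g)" a] by simp
    finally show "\<exists>b. \<eta> = comb (\<theta>s @ [\<phi>]) b" by blast
  qed (auto simp: comb_append comb_Cons)
  then show ?thesis using min_gens_range[OF gens] by auto
qed

lemma comb_in_N: "comb \<theta>s a \<in> N"
  unfolding N_iff by (intro exI[of _ a] exI[of _ 0]) (simp add: der.scale_zero_left)

lemma \<phi>_in_N: "\<phi> \<in> N"
  unfolding N_iff by (intro exI[of _ "\<lambda>_. 0"] exI[of _ 1]) (simp add: der.scale_one)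

lemma subspace_N: "der.subspace N"
  using min_gens_range[OF gens] subspace_range_comb by simp

lemma length_ds: "length ds = length \<theta>s"
  using hom_\<theta>s by (rule list_all2_lengthD)

lemma homogeneous_N_lift:
  assumes "\<eta> \<in> N" "homogeneous_der e \<eta>"
  obtains a g where "\<eta> = comb \<theta>s a + g *s \<phi>" "\<And>i. i < length \<theta>s \<Longrightarrow> hom_shift e (ds ! i) (a i)"
    "hom_shift e c g"
proof -
  have "list_all2 homogeneous_der (ds @ [c]) (\<theta>s @ [\<phi>])" using gens by (simp add: min_gens_def)
  moreover have "\<eta> \<in> range (comb (\<theta>s @ [\<phi>]))" using assms(1) min_gens_range[OF gens] by simp
  ultimately obtain a where a: "\<eta> = comb (\<theta>s @ [\<phi>]) a"
    "\<And>i. i < length (\<theta>s @ [\<phi>]) \<Longrightarrow> hom_shift e ((ds @ [c]) ! i) (a i)"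
    using homogeneous_comb_lift assms(2) by metis
  have "hom_shift e (ds ! i) (a i)" if "i < length \<theta>s" for i
    using a(2)[of i] that by (simp add: nth_append length_ds)
  moreover have "hom_shift e c (a (length \<theta>s))"
    using a(2)[of "length \<theta>s"] by (simp add: nth_append length_ds)
  ultimately show thesis using a(1) by (intro that[of a "a (length \<theta>s)"]) (auto simp: comb_append comb_Cons)
qed

text \<open>The coordinates of \<open>\<alpha> *s \<phi>\<close> in the basis
  \<open>\<theta>s\<close>, that is, the nontrivial part of the single relation; below
  \<open>length \<theta>s\<close> the basis property determines them.\<close>

definition f :: "nat \<Rightarrow> ('n, 'k) mpoly" where
  "f = (SOME a. \<alpha> *s \<phi> = comb \<theta>s a \<and> (\<forall>i < length \<theta>s. hom_shift (Suc c) (ds ! i) (a i)))"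

lemma f: "\<alpha> *s \<phi> = comb \<theta>s f" "i < length \<theta>s \<Longrightarrow> hom_shift (Suc c) (ds ! i) (f i)"
proof -
  have "\<exists>a. \<alpha> *s \<phi> = comb \<theta>s a \<and> (\<forall>i < length \<theta>s. hom_shift (Suc c) (ds ! i) (a i))"
    using homogeneous_comb_lift[OF hom_\<theta>s homogeneous_der_scale[OF linear hom_\<phi>] scale_in[OF \<phi>_in_N]]
    by metis
  from someI_ex[OF this] show "\<alpha> *s \<phi> = comb \<theta>s f" "i < length \<theta>s \<Longrightarrow> hom_shift (Suc c) (ds ! i) (f i)"
    unfolding f_def by blast+
qed

lemma const_term_f: "i < length \<theta>s \<Longrightarrow> const_term (f i) = 0"
proof -
  assume i: "i < length \<theta>s"
  have "comb (\<theta>s @ [\<phi>]) (\<lambda>j. if j < length \<theta>s then f j else - \<alpha>) = comb \<theta>s f + - \<alpha> *s \<phi>"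
    unfolding comb_append comb_Cons by (simp cong: comb_cong)
  then have "comb (\<theta>s @ [\<phi>]) (\<lambda>j. if j < length \<theta>s then f j else - \<alpha>) = 0"
    by (simp add: f(1) der.scale_minus_left)
  from min_gens_comb_relation[OF gens this, of i] i show ?thesis by simp
qed

lemma comb_eqD: "comb \<theta>s a = comb \<theta>s b \<Longrightarrow> i < length \<theta>s \<Longrightarrow> a i = b i"
  using basis[of "\<lambda>j. a j - b j" i] by (simp add: comb_diff)

text \<open>By \<open>dvd\<close> the coefficient of \<open>\<phi>\<close> is a multiple of
  \<open>\<alpha>\<close>; subtracting that multiple of the known relation leaves a relation of the
  basis alone.\<close>

lemma relation:
  assumes "comb \<theta>s a + g *s \<phi> = 0"
  obtains q where "g = q * \<alpha>" "\<And>i. i < length \<theta>s \<Longrightarrow> a i = - (q * f i)"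
proof -
  have "g *s \<phi> = comb \<theta>s (\<lambda>i. - a i)" using assms by (simp add: comb_uminus eq_neg_iff_add_eq_0 add.commute)
  then have "\<alpha> dvd g" using dvd by blast
  then obtain q where q: "g = q * \<alpha>" by (auto simp: dvd_def mult.commute)
  have "comb \<theta>s (\<lambda>i. a i + q * f i) = 0"
    using assms by (simp add: comb_add comb_scale f(1)[symmetric] q der.scale_scale)
  then have "a i + q * f i = 0" if "i < length \<theta>s" for i using basis that by blast
  then show thesis using q by (intro that[of q]) (auto simp: eq_neg_iff_add_eq_0)
qed

text \<open>The degree \<open>c + 1 - ds ! i\<close> is negative or 0; in the latter case
  \<open>f i\<close> is a constant, which minimality of the generators excludes unless it is
  0.\<close>

lemma f_eq_0:
  assumes "i < length \<theta>s" "c < ds ! i"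
  shows "f i = 0"
proof (cases "Suc c = ds ! i")
  case True
  then show ?thesis using f(2)[OF assms(1)] const_term_f[OF assms(1)] hom_shift_same_const
    by (metis const_0)
next
  case False
  then show ?thesis using f(2)[OF assms(1)] hom_shift_less assms(2) by (metis Suc_lessI)
qed

end

text \<open>All that is kept of the arrangement: from here on the argument is about modules.
  Primality of the two forms enters through \<open>coprime12\<close>, \<open>cancel1\<close> and
  \<open>cancel2\<close>.\<close>

locale two_deletions =
  d1: deletion D1 \<alpha>1 \<theta>s ds \<phi>1 c1 + d2: deletion D2 \<alpha>2 \<theta>s ds \<phi>2 c2
  for D1 D2 :: "('n::{finite,linorder}, 'k::field) der set" and \<alpha>1 \<alpha>2 :: "('n, 'k) mpoly"
    and \<theta>s :: "('n, 'k) der list" and ds :: "nat list" and \<phi>1 \<phi>2 :: "('n, 'k) der" and c1 c2 :: nat +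
  fixes D12 :: "('n, 'k) der set"
  assumes coprime12: "\<And>p. \<alpha>1 dvd \<alpha>2 * p \<Longrightarrow> \<alpha>1 dvd p"
    and not_dvd12: "\<not> \<alpha>1 dvd \<alpha>2" and not_dvd21: "\<not> \<alpha>2 dvd \<alpha>1"
    and inter: "D1 \<inter> D2 = range (comb \<theta>s)" and sub1: "D1 \<subseteq> D12" and sub2: "D2 \<subseteq> D12"
    and subspace: "der.subspace D12"
    and scale2: "\<And>\<eta>. \<eta> \<in> D12 \<Longrightarrow> \<alpha>2 *s \<eta> \<in> D1" and scale1: "\<And>\<eta>. \<eta> \<in> D12 \<Longrightarrow> \<alpha>1 *s \<eta> \<in> D2"
    and cancel1: "\<And>\<eta>. \<eta> \<in> D12 \<Longrightarrow> \<alpha>1 *s \<eta> \<in> range (comb \<theta>s) \<Longrightarrow> \<eta> \<in> D1"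
    and cancel2: "\<And>\<eta>. \<eta> \<in> D12 \<Longrightarrow> \<alpha>2 *s \<eta> \<in> range (comb \<theta>s) \<Longrightarrow> \<eta> \<in> D2"
    and c12: "c1 \<le> c2"
begin

abbreviation "l \<equiv> length \<theta>s"

lemma nonzero: "\<alpha>1 \<noteq> 0" "\<alpha>2 \<noteq> 0"
  using not_dvd12 not_dvd21 by auto

text \<open>The coefficient \<open>g\<close> of \<open>\<phi>2\<close> in
  \<open>\<alpha>1 *s \<eta>\<close> has degree \<open>e + 1 - c2\<close>, at most 0. If it
  vanishes, \<open>cancel1\<close> applies. If it is a nonzero constant,
  \<open>\<alpha>1 *s \<eta>\<close> replaces \<open>\<phi>2\<close>, so that
  \<open>\<theta>s\<close>, \<open>\<phi>1\<close> and \<open>\<eta>\<close> generate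
  \<open>D12\<close>, against the number of minimal generators.\<close>

lemma low_degree:
  assumes min: "min_gens D12 as gs" "length gs > l + 2"
    and \<eta>: "\<eta> \<in> D12" "homogeneous_der e \<eta>" "e < c2"
  shows "\<eta> \<in> D1"
proof -
  obtain a g where ag: "\<alpha>1 *s \<eta> = comb \<theta>s a + g *s \<phi>2" "hom_shift (Suc e) c2 g"
    using d2.homogeneous_N_lift[OF scale1[OF \<eta>(1)] homogeneous_der_scale[OF d1.linear \<eta>(2)]] by metis
  have "g = 0"
  proof (rule ccontr)
    assume "g \<noteq> 0"
    then have "Suc e = c2" using ag(2) hom_shift_less \<eta>(3) by (metis Suc_leI le_neq_implies_less)
    then have "g = const (const_term g)" using ag(2) hom_shift_same_const by metis
    then obtain \<gamma> where \<gamma>: "g = const \<gamma>" "\<gamma> \<noteq> 0" using \<open>g \<noteq> 0\<close> by (metis const_0)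
    define d :: "('n, 'k) mpoly" where "d = const (inverse \<gamma>)"
    have dg: "d * g = 1" using \<gamma> by (simp add: d_def)
    define ys where "ys = \<theta>s @ [\<phi>1, \<eta>]"
    have ys: "list_all2 homogeneous_der (ds @ [c1, e]) ys"
      unfolding ys_def using d1.hom_\<theta>s d1.hom_\<phi> \<eta>(2) by (intro list_all2_appendI) auto
    have ys_eq: "comb ys b = comb \<theta>s b + b l *s \<phi>1 + b (Suc l) *s \<eta>" for b
      by (simp add: ys_def comb_append comb_Cons add.assoc)
    have "range (comb ys) = D12"
    proof
      have "\<phi>1 \<in> D12" using d1.\<phi>_in_N sub1 by blast
      then show "range (comb ys) \<subseteq> D12"
        using \<eta>(1) d1.comb_in_N sub1 subspace
        by (auto simp: ys_eq intro!: der.subspace_add der.subspace_scale)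
      show "D12 \<subseteq> range (comb ys)"
      proof
        fix \<zeta> assume \<zeta>: "\<zeta> \<in> D12"
        obtain a' g' where ag': "\<alpha>1 *s \<zeta> = comb \<theta>s a' + g' *s \<phi>2"
          using scale1[OF \<zeta>] d2.N_iff by metis
        \<comment> \<open>Subtracting this multiple of \<open>\<eta>\<close> removes the
          \<open>\<phi>2\<close>-part of \<open>\<alpha>1 *s \<zeta>\<close>, after which
          \<open>cancel1\<close> places the difference in \<open>D1\<close>.\<close>
        define x where "x = \<zeta> - (g' * d) *s \<eta>"
        have "\<alpha>1 *s x = \<alpha>1 *s \<zeta> - (g' * d) *s (\<alpha>1 *s \<eta>)"
          by (simp add: x_def der.scale_right_diff_distrib der.scale_scale mult.commute)
        also have "\<dots> = comb \<theta>s a' - (g' * d) *s comb \<theta>s a + (g' - g' * (d * g)) *s \<phi>2"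
          by (simp add: ag ag' der.scale_right_distrib der.scale_left_diff_distrib der.scale_scale mult.assoc)
        also have "\<dots> = comb \<theta>s (\<lambda>i. a' i - (g' * d) * a i)"
          by (simp add: dg comb_diff comb_scale der.scale_zero_left)
        finally have "\<alpha>1 *s x \<in> range (comb \<theta>s)" by blast
        moreover have "x \<in> D12" unfolding x_def
          using \<zeta> \<eta>(1) subspace by (intro der.subspace_diff der.subspace_scale)
        ultimately have "x \<in> D1" using cancel1 by blast
        then obtain b h where "x = comb \<theta>s b + h *s \<phi>1" using d1.N_iff by metis
        then have "\<zeta> = comb \<theta>s b + h *s \<phi>1 + (g' * d) *s \<eta>" by (simp add: x_def diff_eq_eq)
        also have "\<dots> = comb ys (\<lambda>i. if i < l then b i else if i = l then h else g' * d)"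
          by (simp add: ys_eq cong: comb_cong)
        finally show "\<zeta> \<in> range (comb ys)" by blast
      qed
    qed
    then have "length gs \<le> length ys"
      using min_gens_unique(1)[OF min(1) ys] by (simp add: range_comb)
    with min(2) show False by (simp add: ys_def)
  qed
  then have "\<alpha>1 *s \<eta> = comb \<theta>s a" using ag(1) by (simp add: der.scale_zero_left)
  then show ?thesis using cancel1[OF \<eta>(1)] by blast
qed

text \<open>Solving for \<open>g1 *s \<phi>1\<close> places it in both deletions, hence in
  \<open>D(A)\<close>. The relation therefore splits into one relation for each deletion, and both
  of these are known.\<close>

lemma relation_const_term:
  assumes "comb \<theta>s a + g1 *s \<phi>1 + g2 *s \<phi>2 = 0"
  shows "const_term g1 = 0" "const_term g2 = 0" "i < l \<Longrightarrow> const_term (a i) = 0"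
proof -
  have 1: "g1 *s \<phi>1 = comb \<theta>s (\<lambda>i. - a i) + (- g2) *s \<phi>2"
    using assms by (simp add: comb_uminus der.scale_minus_left eq_neg_iff_add_eq_0 algebra_simps)
  have "g1 *s \<phi>1 \<in> D1" using d1.subspace_N d1.\<phi>_in_N by (rule der.subspace_scale)
  moreover have "g1 *s \<phi>1 \<in> D2" unfolding 1 d2.N_iff by blast
  ultimately have "g1 *s \<phi>1 \<in> range (comb \<theta>s)" using inter by blast
  then obtain a1 where a1: "g1 *s \<phi>1 = comb \<theta>s a1" by blast
  have r1: "comb \<theta>s (\<lambda>i. - a1 i) + g1 *s \<phi>1 = 0" by (simp add: comb_uminus a1)
  have r2: "comb \<theta>s (\<lambda>i. a i + a1 i) + g2 *s \<phi>2 = 0" using assms by (simp add: comb_add a1)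
  obtain q1 where q1: "g1 = q1 * \<alpha>1" "\<And>i. i < l \<Longrightarrow> - a1 i = - (q1 * d1.f i)" using d1.relation[OF r1] by metis
  obtain q2 where q2: "g2 = q2 * \<alpha>2" "\<And>i. i < l \<Longrightarrow> a i + a1 i = - (q2 * d2.f i)" using d2.relation[OF r2] by metis
  have "const_term \<alpha>1 = 0" "const_term \<alpha>2 = 0"
    using d1.linear d2.linear hom_shift_const_term[of 1 0] by (auto simp: homogeneous_iff_hom_shift)
  then show "const_term g1 = 0" "const_term g2 = 0" by (simp_all add: q1 q2)
  assume i: "i < l"
  then have "a i = - (q2 * d2.f i) - q1 * d1.f i" using q1(2)[OF i] q2(2)[OF i] by (simp add: algebra_simps)
  then show "const_term (a i) = 0" using d1.const_term_f d2.const_term_f i by simp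
qed

text \<open>In high degrees the coordinates with respect to the basis of the free module extend to all
  of \<open>D12\<close>, because the relations of the two deletions do not involve the basis elements of
  high degree.\<close>

lemma high_coordinates:
  assumes "\<eta> \<in> D12"
  obtains w where "(\<alpha>1 * \<alpha>2) *s \<eta> = comb \<theta>s w"
    "\<And>i. i < l \<Longrightarrow> c2 < ds ! i \<Longrightarrow> \<alpha>1 * \<alpha>2 dvd w i"
proof -
  obtain a g where ag: "\<alpha>2 *s \<eta> = comb \<theta>s a + g *s \<phi>1" using scale2[OF assms] d1.N_iff by metis
  obtain b h where bh: "\<alpha>1 *s \<eta> = comb \<theta>s b + h *s \<phi>2" using scale1[OF assms] d2.N_iff by metis
  have "(\<alpha>1 * \<alpha>2) *s \<eta> = \<alpha>1 *s (\<alpha>2 *s \<eta>)" by (simp add: der.scale_scale)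
  also have "\<dots> = \<alpha>1 *s comb \<theta>s a + g *s (\<alpha>1 *s \<phi>1)"
    by (simp add: ag der.scale_right_distrib der.scale_scale mult.commute)
  finally have A: "(\<alpha>1 * \<alpha>2) *s \<eta> = comb \<theta>s (\<lambda>i. \<alpha>1 * a i + g * d1.f i)"
    by (simp add: comb_add comb_scale d1.f(1))
  have "(\<alpha>1 * \<alpha>2) *s \<eta> = \<alpha>2 *s (\<alpha>1 *s \<eta>)" by (simp add: der.scale_scale mult.commute)
  also have "\<dots> = \<alpha>2 *s comb \<theta>s b + h *s (\<alpha>2 *s \<phi>2)"
    by (simp add: bh der.scale_right_distrib der.scale_scale mult.commute)
  finally have B: "(\<alpha>1 * \<alpha>2) *s \<eta> = comb \<theta>s (\<lambda>i. \<alpha>2 * b i + h * d2.f i)"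
    by (simp add: comb_add comb_scale d2.f(1))
  show thesis
  proof (rule that[OF A])
    fix i assume i: "i < l" "c2 < ds ! i"
    have f: "d1.f i = 0" "d2.f i = 0" using d1.f_eq_0 d2.f_eq_0 i c12 by auto
    have "\<alpha>1 * a i = \<alpha>2 * b i"
      using d1.comb_eqD[OF trans[OF A[symmetric] B] i(1)] f by simp
    \<comment> \<open>With both \<open>f\<close> vanishing, the coordinate is
      \<open>\<alpha>1 * a i = \<alpha>2 * b i\<close>, and coprimality turns the two divisibilities
      into one by the product.\<close>
    then have "\<alpha>1 dvd b i" using coprime12 by (metis dvd_triv_left)
    then obtain q where "b i = \<alpha>1 * q" ..
    then have "\<alpha>1 * a i = \<alpha>1 * (\<alpha>2 * q)" using \<open>\<alpha>1 * a i = \<alpha>2 * b i\<close> by (simp add: mult.left_commute)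
    then show "\<alpha>1 * \<alpha>2 dvd \<alpha>1 * a i + g * d1.f i" using f nonzero by simp
  qed
qed

text \<open>A generator of degree \<open>e \<le> c2\<close> is treated in the degree
  \<open>e\<close> component: minimal generators of degree at least \<open>e\<close> drop out
  because \<open>v\<close> has no constant terms, the others lie in \<open>D1\<close>, and a
  relation among \<open>\<theta>s\<close>, \<open>\<phi>1\<close>, \<open>\<phi>2\<close> results. A
  generator of degree above \<open>c2\<close> is some \<open>\<theta>s ! j\<close>, and its
  polynomial coordinate on \<open>D12\<close> is used instead.\<close>

lemma generators_independent:
  assumes min: "min_gens D12 as gs" "length gs > l + 2"
    and v: "\<And>k. k < length gs \<Longrightarrow> const_term (v k) = 0"
    and eq: "(\<Sum>j<length (\<theta>s @ [\<phi>1, \<phi>2]). const (c j) *s (\<theta>s @ [\<phi>1, \<phi>2]) ! j) = comb gs v"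
  shows "\<forall>j<length (\<theta>s @ [\<phi>1, \<phi>2]). c j = 0"
proof (intro allI impI)
  define ys bs where "ys = \<theta>s @ [\<phi>1, \<phi>2]" and "bs = ds @ [c1, c2]"
  have ys_eq: "comb ys b = comb \<theta>s b + b l *s \<phi>1 + b (Suc l) *s \<phi>2" for b
    by (simp add: ys_def comb_append comb_Cons add.assoc)
  have len: "length ys = l + 2" "length ds = l" by (simp_all add: ys_def d1.length_ds)
  have ys: "list_all2 homogeneous_der bs ys"
    unfolding ys_def bs_def using d1.hom_\<theta>s d1.hom_\<phi> d2.hom_\<phi> by (intro list_all2_appendI) auto
  have gs: "list_all2 homogeneous_der as gs" using min by (simp add: min_gens_def)
  have gsD: "gs ! k \<in> D12" if "k < length gs" for k
    using min(1) set_subset_der_comb_image[of gs] nth_mem[OF that] by (auto simp: min_gens_def simp del: nth_mem)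
  have eq': "comb ys (\<lambda>j. const (c j)) = comb gs v" using eq by (simp add: comb_def ys_def)
  fix j assume "j < length (\<theta>s @ [\<phi>1, \<phi>2])"
  then have j: "j < l + 2" by simp
  show "c j = 0"
  proof (cases "bs ! j \<le> c2")
    case True
    define e where "e = bs ! j"
    have part: "comb hs (\<lambda>k. hom_part e (us ! k) (a k)) = der_part e (comb hs a)"
      if "list_all2 homogeneous_der us hs" for us hs and a :: "nat \<Rightarrow> ('n, 'k) mpoly"
    proof -
      have "comb hs (\<lambda>k. hom_part e (us ! k) (a k)) = der_comb hs (part_vec e us (Matrix.vec (length hs) a))"
        unfolding der_comb_eq_comb using list_all2_lengthD[OF that]
        by (intro comb_cong) (simp add: part_vec_def)
      then show ?thesis by (simp add: der_part_comb[OF that] comb_eq_der_comb)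
    qed
    have "\<exists>u. (\<forall>i<l + 2. const_term (u i) = 0) \<and> hom_part e (as ! k) (v k) *s gs ! k = comb ys u"
      if k: "k < length gs" for k
    proof (cases "as ! k < e")
      case True
      then have "gs ! k \<in> D1"
        using low_degree[OF min gsD[OF k] list_all2_nthD2[OF gs k]] \<open>bs ! j \<le> c2\<close> by (simp add: e_def)
      then obtain a g where "gs ! k = comb \<theta>s a + g *s \<phi>1" using d1.N_iff by metis
      then have "gs ! k = comb ys (\<lambda>i. if i < l then a i else if i = l then g else 0)"
        by (simp add: ys_eq der.scale_zero_left cong: comb_cong)
      then have "hom_part e (as ! k) (v k) *s gs ! k
          = comb ys (\<lambda>i. hom_part e (as ! k) (v k) * (if i < l then a i else if i = l then g else 0))"
        by (simp add: comb_scale)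
      then show ?thesis using const_term_hom_part[OF v[OF k], of e "as ! k"]
        by (intro exI[of _ "\<lambda>i. hom_part e (as ! k) (v k) * (if i < l then a i else if i = l then g else 0)"]) simp
    next
      case False
      have "hom_part e (as ! k) (v k) = 0"
      proof (cases "e = as ! k")
        case True
        then show ?thesis using hom_shift_same_const[of e "hom_part e (as ! k) (v k)"]
            const_term_hom_part[OF v[OF k]] by (metis const_0 hom_shift_hom_part)
      qed (use False in \<open>auto intro: hom_shift_less[OF hom_shift_hom_part]\<close>)
      then show ?thesis by (intro exI[of _ "\<lambda>_. 0"]) (simp add: der.scale_zero_left)
    qed
    then obtain u where u: "\<And>k i. k < length gs \<Longrightarrow> i < l + 2 \<Longrightarrow> const_term (u k i) = 0"
      "\<And>k. k < length gs \<Longrightarrow> hom_part e (as ! k) (v k) *s gs ! k = comb ys (u k)" by metis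
    define w where "w i = (\<Sum>k<length gs. u k i)" for i
    have w0: "const_term (w i) = 0" if "i < l + 2" for i using u(1) that by (simp add: w_def)
    have "comb ys (\<lambda>i. hom_part e (bs ! i) (const (c i))) = der_part e (comb gs v)"
      using part[OF ys] eq' by simp
    also have "\<dots> = comb gs (\<lambda>k. hom_part e (as ! k) (v k))" by (rule part[OF gs, symmetric])
    also have "\<dots> = (\<Sum>k<length gs. comb ys (u k))" by (simp add: comb_def[of gs] u(2))
    also have "\<dots> = comb ys w" by (simp add: w_def[abs_def] comb_sum)
    finally have "comb ys (\<lambda>i. hom_part e (bs ! i) (const (c i)) - w i) = 0" by (simp add: comb_diff)
    from relation_const_term[OF this[unfolded ys_eq]]
    have "const_term (hom_part e (bs ! j) (const (c j)) - w j) = 0"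
      using j by (cases "j < l"; cases "j = l") (auto simp: less_Suc_eq)
    then show ?thesis using w0[OF j] by (simp add: e_def hom_part_id)
  next
    case False
    then have jl: "j < l" "c2 < ds ! j"
      using j c12 len by (auto simp: bs_def nth_append less_Suc_eq split: if_splits)
    have "\<exists>w. (\<alpha>1 * \<alpha>2) *s gs ! k = comb \<theta>s w \<and> \<alpha>1 * \<alpha>2 dvd w j" if "k < length gs" for k
      using high_coordinates[OF gsD[OF that]] jl by metis
    then obtain w where w: "\<And>k. k < length gs \<Longrightarrow> (\<alpha>1 * \<alpha>2) *s gs ! k = comb \<theta>s (w k)"
      "\<And>k. k < length gs \<Longrightarrow> \<alpha>1 * \<alpha>2 dvd w k j" by metis
    then obtain w' where w': "\<And>k. k < length gs \<Longrightarrow> w k j = \<alpha>1 * \<alpha>2 * w' k" unfolding dvd_def by metis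
    \<comment> \<open>After multiplication by \<open>\<alpha>1 * \<alpha>2\<close> everything lies
      in \<open>D(A)\<close>, where coordinate \<open>j\<close> can be compared. The
      \<open>\<phi>1\<close> and \<open>\<phi>2\<close> contribute nothing there, since both
      \<open>f\<close> vanish at \<open>j\<close>.\<close>
    have "comb \<theta>s (\<lambda>i. \<alpha>1 * \<alpha>2 * const (c i) + (const (c l) * \<alpha>2 * d1.f i + const (c (Suc l)) * \<alpha>1 * d2.f i))
        = (\<alpha>1 * \<alpha>2) *s comb ys (\<lambda>j. const (c j))"
      by (simp add: ys_eq comb_add comb_scale d1.f(1)[symmetric] d2.f(1)[symmetric] der.scale_right_distrib
          der.scale_scale mult_ac add.assoc)
    also have "\<dots> = (\<Sum>k<length gs. v k *s ((\<alpha>1 * \<alpha>2) *s gs ! k))"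
      unfolding eq' by (simp add: comb_def der.scale_sum_right der.scale_scale mult_ac)
    also have "\<dots> = (\<Sum>k<length gs. comb \<theta>s (\<lambda>i. v k * w k i))" by (simp add: w comb_scale)
    also have "\<dots> = comb \<theta>s (\<lambda>i. \<Sum>k<length gs. v k * w k i)" by (rule comb_sum[symmetric])
    finally have "\<alpha>1 * \<alpha>2 * const (c j) + (const (c l) * \<alpha>2 * d1.f j + const (c (Suc l)) * \<alpha>1 * d2.f j)
        = (\<Sum>k<length gs. v k * w k j)"
      by (rule d1.comb_eqD[OF _ jl(1)])
    moreover have "d1.f j = 0" "d2.f j = 0" using d1.f_eq_0 d2.f_eq_0 jl c12 by auto
    ultimately have "\<alpha>1 * \<alpha>2 * const (c j) = (\<Sum>k<length gs. v k * w k j)" by simp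
    also have "\<dots> = \<alpha>1 * \<alpha>2 * (\<Sum>k<length gs. v k * w' k)"
      unfolding sum_distrib_left by (intro sum.cong) (simp_all add: w' mult_ac)
    finally have "const (c j) = (\<Sum>k<length gs. v k * w' k)" using nonzero by simp
    then have "const_term (const (c j) :: ('n, 'k) mpoly) = 0" using v by simp
    then show ?thesis by simp
  qed
qed

end

section \<open>Explicit syzygies of the double deletion and their independence\<close>

lemma comb_single: "j < length gs \<Longrightarrow> comb gs (\<lambda>m. if m = j then x else 0) = x *s gs ! j"
proof -
  assume j: "j < length gs"
  have "comb gs (\<lambda>m. if m = j then x else 0) = (\<Sum>m<length gs. if m = j then x *s gs ! j else 0)"
    unfolding comb_def by (intro sum.cong) auto
  then show ?thesis using j by simp
qed

lemma comb_pair: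
  assumes "i < length gs" "j < length gs" "i \<noteq> j"
  shows "comb gs (\<lambda>m. if m = j then x else if m = i then y else 0) = x *s gs ! j + y *s gs ! i"
proof -
  have "comb gs (\<lambda>m. if m = j then x else if m = i then y else 0)
      = comb gs (\<lambda>m. (if m = j then x else 0) + (if m = i then y else 0))"
    using assms by (intro comb_cong) auto
  then show ?thesis using assms by (simp add: comb_add comb_single)
qed

locale minimal_deletions = two_deletions D1 D2 \<alpha>1 \<alpha>2 \<theta>s ds \<phi>1 \<phi>2 c1 c2 D12
  for D1 D2 :: "('n::{finite,linorder}, 'k::field) der set" and \<alpha>1 \<alpha>2 :: "('n, 'k) mpoly"
    and \<theta>s :: "('n, 'k) der list" and ds :: "nat list" and \<phi>1 \<phi>2 :: "('n, 'k) der" and c1 c2 :: nat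
    and D12 :: "('n, 'k) der set" +
  fixes \<eta>s :: "('n, 'k) der list" and cs :: "nat list"
    and a b :: "nat \<Rightarrow> nat \<Rightarrow> ('n, 'k) mpoly" and g h :: "nat \<Rightarrow> ('n, 'k) mpoly"
  assumes min: "min_gens D12 (ds @ cs) (\<theta>s @ \<eta>s)"
    and \<eta>s: "\<eta>s ! 0 = \<phi>1" "\<eta>s ! 1 = \<phi>2" and cs: "2 < length cs" "cs ! 0 = c1" "cs ! 1 = c2"
    and g: "\<And>j. 2 \<le> j \<Longrightarrow> j < length cs \<Longrightarrow> \<alpha>2 *s \<eta>s ! j = comb \<theta>s (a j) + g j *s \<phi>1"
      "\<And>j i. 2 \<le> j \<Longrightarrow> j < length cs \<Longrightarrow> i < length \<theta>s \<Longrightarrow> hom_shift (Suc (cs ! j)) (ds ! i) (a j i)"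
      "\<And>j. 2 \<le> j \<Longrightarrow> j < length cs \<Longrightarrow> hom_shift (Suc (cs ! j)) c1 (g j)"
    and h: "\<And>j. 2 \<le> j \<Longrightarrow> j < length cs \<Longrightarrow> \<alpha>1 *s \<eta>s ! j = comb \<theta>s (b j) + h j *s \<phi>2"
      "\<And>j i. 2 \<le> j \<Longrightarrow> j < length cs \<Longrightarrow> i < length \<theta>s \<Longrightarrow> hom_shift (Suc (cs ! j)) (ds ! i) (b j i)"
      "\<And>j. 2 \<le> j \<Longrightarrow> j < length cs \<Longrightarrow> hom_shift (Suc (cs ! j)) c2 (h j)"
begin

abbreviation "r \<equiv> length cs"

text \<open>Twice \<open>r\<close> minus two syzygies: one for each of the two deletions, and for each further generator
  one with pivot \<open>\<alpha>2\<close> and one with pivot \<open>\<alpha>1\<close>, split into their coordinates with respect to \<open>\<theta>s\<close> and \<open>\<eta>s\<close>.\<close>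

definition head :: "nat \<Rightarrow> nat \<Rightarrow> ('n, 'k) mpoly" where
  "head j i = (if j = 0 then - d1.f i else if j = 1 then - d2.f i
     else if j < r then - a j i else - b (j - r + 2) i)"

definition tail :: "nat \<Rightarrow> nat \<Rightarrow> ('n, 'k) mpoly" where
  "tail j m = (if j = 0 then (if m = 0 then \<alpha>1 else 0) else if j = 1 then (if m = 1 then \<alpha>2 else 0)
     else if j < r then (if m = j then \<alpha>2 else if m = 0 then - g j else 0)
     else (if m = j - r + 2 then \<alpha>1 else if m = 1 then - h (j - r + 2) else 0))"

lemma length_\<eta>s: "length \<eta>s = r"
proof -
  have "length (ds @ cs) = length (\<theta>s @ \<eta>s)"
    using min list_all2_lengthD unfolding min_gens_def by blast
  then show ?thesis by (simp add: d1.length_ds)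
qed

lemma cs_nonempty [simp]: "cs \<noteq> []"
  using cs(1) by auto

lemma hom_\<alpha>: "hom_shift (Suc e) e \<alpha>1" "hom_shift (Suc e) e \<alpha>2"
  using d1.linear d2.linear by (auto simp: homogeneous_iff_hom_shift hom_shift_def)

lemma head_tail_syzygy:
  assumes "j < r + (r - 2)"
  shows "comb \<theta>s (head j) + comb \<eta>s (tail j) = 0"
proof -
  consider "j = 0" | "j = 1" | "2 \<le> j" "j < r" | "r \<le> j" by linarith
  then show ?thesis
  proof cases
    case 1
    have "comb \<eta>s (\<lambda>m. if m = 0 then \<alpha>1 else 0) = comb \<theta>s d1.f"
      using cs comb_single[of 0 \<eta>s \<alpha>1] \<eta>s d1.f(1) by (simp add: length_\<eta>s)
    with 1 show ?thesis by (simp add: head_def[abs_def] tail_def[abs_def] comb_uminus)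
  next
    case 2
    have "comb \<eta>s (\<lambda>m. if m = 1 then \<alpha>2 else 0) = comb \<theta>s d2.f"
      using cs comb_single[of 1 \<eta>s \<alpha>2] \<eta>s d2.f(1) by (simp add: length_\<eta>s)
    with 2 show ?thesis by (simp add: head_def[abs_def] tail_def[abs_def] comb_uminus)
  next
    case 3
    then have "head j = (\<lambda>i. - a j i)" "tail j = (\<lambda>m. if m = j then \<alpha>2 else if m = 0 then - g j else 0)"
      by (auto simp: head_def tail_def)
    then show ?thesis using 3 comb_pair[of 0 \<eta>s j \<alpha>2 "- g j"]
      by (simp add: comb_uminus length_\<eta>s \<eta>s g(1) der.scale_minus_left)
  next
    case 4
    \<comment> \<open>Syzygies from index \<open>r\<close> on belong to the generators from index 2
      on, since \<open>\<phi>1\<close> and \<open>\<phi>2\<close> have no second syzygy of this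
      kind.\<close>
    define i where "i = j - r + 2"
    have i: "2 \<le> i" "i < r" using 4 assms cs by (auto simp: i_def)
    have "head j = (\<lambda>m. - b i m)" "tail j = (\<lambda>m. if m = i then \<alpha>1 else if m = 1 then - h i else 0)"
      using 4 cs(1) by (auto simp: head_def tail_def i_def)
    then show ?thesis using i comb_pair[of 1 \<eta>s i \<alpha>1 "- h i"] \<eta>s(2)
      by (simp add: comb_uminus length_\<eta>s h(1) der.scale_minus_left)
  qed
qed

lemma hom_head_tail:
  assumes "j < r + (r - 2)"
  shows "i < l \<Longrightarrow> hom_shift ((map Suc cs @ map Suc (drop 2 cs)) ! j) (ds ! i) (head j i)"
    and "m < r \<Longrightarrow> hom_shift ((map Suc cs @ map Suc (drop 2 cs)) ! j) (cs ! m) (tail j m)"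
proof -
  consider "j = 0" | "j = 1" | "2 \<le> j" "j < r" | "r \<le> j" by linarith
  then have "(i < l \<longrightarrow> hom_shift ((map Suc cs @ map Suc (drop 2 cs)) ! j) (ds ! i) (head j i)) \<and>
      (m < r \<longrightarrow> hom_shift ((map Suc cs @ map Suc (drop 2 cs)) ! j) (cs ! m) (tail j m))"
  proof cases
    case 1
    then show ?thesis using cs hom_\<alpha> d1.f(2) by (auto simp: head_def tail_def nth_append)
  next
    case 2
    then show ?thesis using cs(1) cs(3) hom_\<alpha> d2.f(2) by (auto simp: head_def tail_def nth_append simp flip: One_nat_def)
  next
    case 3
    then show ?thesis using cs hom_\<alpha> g(2,3) by (auto simp: head_def tail_def nth_append)
  next
    case 4
    define k where "k = j - r + 2"
    have k: "2 \<le> k" "k < r" using 4 assms cs by (auto simp: k_def)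
    have "(map Suc cs @ map Suc (drop 2 cs)) ! j = Suc (cs ! k)"
      using 4 assms by (simp add: nth_append k_def add.commute)
    moreover have "head j i = - b k i" "tail j m = (if m = k then \<alpha>1 else if m = 1 then - h k else 0)"
      using 4 cs(1) by (auto simp: head_def tail_def k_def)
    ultimately show ?thesis using k cs(3) hom_\<alpha> h(2,3) by (auto simp flip: One_nat_def)
  qed
  then show "i < l \<Longrightarrow> hom_shift ((map Suc cs @ map Suc (drop 2 cs)) ! j) (ds ! i) (head j i)"
    and "m < r \<Longrightarrow> hom_shift ((map Suc cs @ map Suc (drop 2 cs)) ! j) (cs ! m) (tail j m)" by blast+
qed

text \<open>If \<open>g j\<close> vanished, \<open>cancel2\<close> would put
  \<open>\<eta>s ! j\<close> into \<open>D2\<close>, making it a combination of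
  \<open>\<theta>s\<close> and \<open>\<phi>2\<close>, against minimality.\<close>

lemma g_nonzero:
  assumes "2 \<le> j" "j < r"
  shows "g j \<noteq> 0"
proof
  assume "g j = 0"
  have \<eta>: "\<eta>s ! j \<in> D12"
    using min set_subset_der_comb_image[of "\<theta>s @ \<eta>s"] assms length_\<eta>s by (force simp: min_gens_def)
  have "\<alpha>2 *s \<eta>s ! j \<in> range (comb \<theta>s)"
    using g(1)[OF assms] \<open>g j = 0\<close> by (simp add: der.scale_zero_left)
  then have "\<eta>s ! j \<in> D2" by (rule cancel2[OF \<eta>])
  then obtain x y where xy: "\<eta>s ! j = comb \<theta>s x + y *s \<phi>2" using d2.N_iff by metis
  define z where "z k = (if k < l then x k else if k = l + j then - 1 else if k = l + 1 then y else 0)" for k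
  have "comb (\<theta>s @ \<eta>s) z = comb \<theta>s z + comb \<eta>s (\<lambda>m. z (l + m))" by (rule comb_append)
  also have "comb \<theta>s z = comb \<theta>s x" by (rule comb_cong) (simp add: z_def)
  also have "(\<lambda>m. z (l + m)) = (\<lambda>m. if m = j then - 1 else if m = 1 then y else 0)"
    by (auto simp: z_def)
  also have "comb \<eta>s (\<lambda>m. if m = j then - 1 else if m = 1 then y else 0) = - 1 *s \<eta>s ! j + y *s \<eta>s ! 1"
    using assms by (intro comb_pair) (auto simp: length_\<eta>s)
  finally have "comb (\<theta>s @ \<eta>s) z = 0"
    using xy \<eta>s(2) by (simp add: der.scale_minus_left der.scale_one)
  from min_gens_comb_relation[OF min this, of "l + j"] show False
    using assms by (simp add: z_def length_\<eta>s)
qed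

lemma linear_independent:
  assumes "order2 (const x * \<alpha>1 + const y * \<alpha>2)"
  shows "x = 0" "y = 0"
proof -
  have "homogeneous 1 (const x * \<alpha>1 + const y * \<alpha>2)"
    using d1.linear d2.linear unfolding homogeneous_iff_hom_shift
    by (intro hom_shift_add hom_shift_mult[OF hom_shift_const])
  with assms have 0: "const x * \<alpha>1 + const y * \<alpha>2 = 0" by (rule order2_linear)
  have "\<alpha> dvd \<beta>" if "const u * \<alpha> + const w * \<beta> = 0" "w \<noteq> 0" for \<alpha> \<beta> :: "('n, 'k) mpoly" and u w
  proof -
    have "const w * \<beta> = - (const u * \<alpha>)"
      using that(1) by (simp add: eq_neg_iff_add_eq_0 add.commute)
    then have "const (inverse w) * (const w * \<beta>) = \<alpha> * (- (const (inverse w) * const u))"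
      by (simp add: mult_ac)
    moreover have "const (inverse w) * (const w * \<beta>) = \<beta>" using that(2) by (simp flip: mult.assoc)
    ultimately show ?thesis by (metis dvd_triv_left)
  qed
  from this[of x \<alpha>1 y \<alpha>2] this[of y \<alpha>2 x \<alpha>1] 0 show "x = 0" "y = 0"
    using not_dvd12 not_dvd21 by (auto simp: add.commute)
qed

text \<open>Column \<open>m \<ge> 2\<close> meets only the pivot \<open>\<alpha>2\<close> in row
  \<open>m\<close> and the pivot \<open>\<alpha>1\<close> in row \<open>r + m - 2\<close>, so
  \<open>linear_independent\<close> applies. Columns 0 and 1 come last: they also contain the
  \<open>g\<close> and \<open>h\<close>, which may have linear terms, but whose coefficients are 0
  by then.\<close>

lemma tail_independent:
  assumes o2: "\<And>m. m < r \<Longrightarrow> order2 (\<Sum>j<r + (r - 2). const (c j) * tail j m)" and j: "j < r + (r - 2)"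
  shows "c j = 0"
proof -
  define q where "q = r + (r - 2)"
  have big: "c m = 0 \<and> c (r + m - 2) = 0" if m: "2 \<le> m" "m < r" for m
  proof -
    have "(\<Sum>j<q. const (c j) * tail j m)
        = (\<Sum>j<q. (if j = m then const (c m) * \<alpha>2 else 0) + (if j = r + m - 2 then const (c (r + m - 2)) * \<alpha>1 else 0))"
    proof (intro sum.cong refl)
      fix j
      have "m = j - r + 2 \<longleftrightarrow> j = r + m - 2" if "r \<le> j" using that m by linarith
      moreover have "r + m - 2 \<ge> r" using m by linarith
      ultimately show "const (c j) * tail j m
          = (if j = m then const (c m) * \<alpha>2 else 0) + (if j = r + m - 2 then const (c (r + m - 2)) * \<alpha>1 else 0)"
        using m cs(1) by (cases "j < r") (simp_all add: tail_def)
    qed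
    also have "\<dots> = const (c (r + m - 2)) * \<alpha>1 + const (c m) * \<alpha>2"
    proof -
      have "m < q" "r + m - 2 < q" using m by (auto simp: q_def)
      then show ?thesis unfolding sum.distrib by simp
    qed
    finally have "order2 (const (c (r + m - 2)) * \<alpha>1 + const (c m) * \<alpha>2)"
      using o2[OF m(2)] by (simp only: q_def)
    from linear_independent[OF this] show ?thesis by blast
  qed
  have zero: "c j = 0" if "2 \<le> j" "j < q" for j
  proof (cases "j < r")
    case False
    then show ?thesis using big[of "j - r + 2"] that cs by (simp add: q_def)
  qed (use big that in auto)
  have "(\<Sum>j<q. const (c j) * tail j 0) = (\<Sum>j<q. if j = 0 then const (c 0) * \<alpha>1 else 0)"
    using zero by (intro sum.cong refl) (auto simp: tail_def)
  then have "order2 (const (c 0) * \<alpha>1 + const 0 * \<alpha>2)"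
    using o2[of 0] cs by (simp add: q_def)
  then have c0: "c 0 = 0" by (rule linear_independent)
  have "(\<Sum>j<q. const (c j) * tail j 1) = (\<Sum>j<q. if j = 1 then const (c 1) * \<alpha>2 else 0)"
    using zero by (intro sum.cong refl) (auto simp: tail_def)
  then have "order2 (const 0 * \<alpha>1 + const (c 1) * \<alpha>2)"
  proof -
    have "1 < q" "1 < r" using cs(1) by (auto simp: q_def)
    with \<open>(\<Sum>j<q. const (c j) * tail j 1) = _\<close> o2[of 1] show ?thesis by (simp add: q_def[symmetric])
  qed
  then have "c 1 = 0" by (rule linear_independent)
  then show ?thesis using c0 zero[of j] j by (cases "j = 0"; cases "j = 1") (auto simp: q_def)
qed

section \<open>Multiples of arbitrary syzygies in terms of the explicit ones\<close>

lemma single_tail_syzygy: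
  assumes syz: "comb \<theta>s x + comb \<eta>s t = 0" and p: "p = 0 \<or> p = 1" and t: "\<And>m. m < r \<Longrightarrow> m \<noteq> p \<Longrightarrow> t m = 0"
  obtains q where "\<And>i. i < l \<Longrightarrow> x i = q * head p i" "\<And>m. m < r \<Longrightarrow> t m = q * tail p m"
proof -
  have pr: "p < r" using p cs by auto
  have "comb \<eta>s t = comb \<eta>s (\<lambda>m. if m = p then t p else 0)"
    using t by (intro comb_cong) (auto simp: length_\<eta>s)
  also have "\<dots> = t p *s \<eta>s ! p" using pr by (simp add: comb_single length_\<eta>s)
  finally have eq: "comb \<theta>s x + t p *s \<eta>s ! p = 0" using syz by simp
  show thesis
  proof (cases "p = 0")
    case True
    with eq have "comb \<theta>s x + t 0 *s \<phi>1 = 0" by (simp add: \<eta>s)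
    then obtain q where "t 0 = q * \<alpha>1" "\<And>i. i < l \<Longrightarrow> x i = - (q * d1.f i)" using d1.relation by blast
    then show thesis using True t by (intro that[of q]) (auto simp: head_def tail_def)
  next
    case False
    with p have p: "p = 1" by blast
    with eq have "comb \<theta>s x + t 1 *s \<phi>2 = 0" using \<eta>s(2) by simp
    then obtain q where "t 1 = q * \<alpha>2" "\<And>i. i < l \<Longrightarrow> x i = - (q * d2.f i)" using d2.relation by blast
    then show thesis using p t by (intro that[of q]) (auto simp: head_def tail_def)
  qed
qed

text \<open>Matching the coordinates at all \<open>\<eta>s\<close> except position \<open>p\<close>
  is enough: the difference is a syzygy of \<open>\<theta>s\<close> and one of
  \<open>\<phi>1\<close>, \<open>\<phi>2\<close>, hence a multiple of the relation of that
  deletion.\<close>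

lemma reduce_syzygy:
  assumes syz: "comb \<theta>s x + comb \<eta>s t = 0" and p: "p = 0 \<or> p = 1" "p \<notin> J" and J: "J \<subseteq> {..<r + (r - 2)}"
    and t: "\<And>m. m < r \<Longrightarrow> m \<noteq> p \<Longrightarrow> s * t m = (\<Sum>j\<in>J. u j * tail j m)"
  obtains w where "\<And>i. i < l \<Longrightarrow> s * x i = (\<Sum>j\<in>insert p J. w j * head j i)"
    "\<And>m. m < r \<Longrightarrow> s * t m = (\<Sum>j\<in>insert p J. w j * tail j m)"
proof -
  have fin: "finite J" using J finite_subset by blast
  define x' where "x' i = s * x i - (\<Sum>j\<in>J. u j * head j i)" for i
  define t' where "t' m = s * t m - (\<Sum>j\<in>J. u j * tail j m)" for m
  have "comb \<theta>s x' + comb \<eta>s t' = s *s (comb \<theta>s x + comb \<eta>s t) - (\<Sum>j\<in>J. u j *s (comb \<theta>s (head j) + comb \<eta>s (tail j)))"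
    unfolding x'_def[abs_def] t'_def[abs_def]
    by (simp add: comb_diff comb_sum comb_scale der.scale_right_distrib sum.distrib)
  also have "\<dots> = 0"
    using syz head_tail_syzygy J by (subst sum.neutral) (auto simp: der.scale_zero_right)
  finally obtain q where q: "\<And>i. i < l \<Longrightarrow> x' i = q * head p i" "\<And>m. m < r \<Longrightarrow> t' m = q * tail p m"
    by (rule single_tail_syzygy[OF _ p(1), of x' t']) (use t in \<open>auto simp: t'_def\<close>)
  have S: "(\<Sum>j\<in>insert p J. (u(p := q)) j * y j) = q * y p + (\<Sum>j\<in>J. u j * y j)" for y
    using p fin by (subst sum.insert) (auto intro!: sum.cong)
  show thesis
  proof (rule that[of "u(p := q)"])
    show "s * x i = (\<Sum>j\<in>insert p J. (u(p := q)) j * head j i)" if "i < l" for i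
      using q(1)[OF that] unfolding S x'_def by (simp add: diff_eq_eq)
    show "s * t m = (\<Sum>j\<in>insert p J. (u(p := q)) j * tail j m)" if "m < r" for m
      using q(2)[OF that] unfolding S t'_def by (simp add: diff_eq_eq)
  qed
qed

lemma \<alpha>2_multiple_syzygy:
  assumes syz: "comb \<theta>s x + comb \<eta>s t = 0"
  obtains w where "\<And>i. i < l \<Longrightarrow> \<alpha>2 * x i = (\<Sum>j<r. w j * head j i)"
    "\<And>m. m < r \<Longrightarrow> \<alpha>2 * t m = (\<Sum>j<r. w j * tail j m)"
proof -
  \<comment> \<open>Among the first \<open>r\<close> syzygies all but number 0 have pivot
    \<open>\<alpha>2\<close>, so the coefficients \<open>t j\<close> match every position except
    0.\<close>
  have t: "\<alpha>2 * t m = (\<Sum>j\<in>{1..<r}. t j * tail j m)" if m: "m < r" "m \<noteq> 0" for m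
  proof -
    have "(\<Sum>j\<in>{1..<r}. t j * tail j m) = (\<Sum>j\<in>{1..<r}. if j = m then \<alpha>2 * t m else 0)"
      using m by (intro sum.cong refl) (auto simp: tail_def)
    then show ?thesis using m by simp
  qed
  have ins: "insert 0 {1..<r} = {..<r}" using cs by auto
  have J: "{1..<r} \<subseteq> {..<r + (r - 2)}" "0 \<notin> {1..<r}" by auto
  show thesis
  proof (rule reduce_syzygy[OF syz disjI1[OF refl] J(2) J(1) t])
    fix w
    assume "\<And>i. i < l \<Longrightarrow> \<alpha>2 * x i = (\<Sum>j\<in>insert 0 {1..<r}. w j * head j i)"
      "\<And>m. m < r \<Longrightarrow> \<alpha>2 * t m = (\<Sum>j\<in>insert 0 {1..<r}. w j * tail j m)"
    then show thesis unfolding ins by (rule that)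
  qed
qed

lemma \<alpha>1_multiple_syzygy:
  assumes syz: "comb \<theta>s x + comb \<eta>s t = 0"
  obtains w where "\<And>i. i < l \<Longrightarrow> \<alpha>1 * x i = (\<Sum>j<r + (r - 2). w j * head j i)"
    "\<And>m. m < r \<Longrightarrow> \<alpha>1 * t m = (\<Sum>j<r + (r - 2). w j * tail j m)"
proof -
  define q where "q = r + (r - 2)"
  \<comment> \<open>The pivots \<open>\<alpha>1\<close> sit at position 0 in syzygy 0 and at
    position \<open>m \<ge> 2\<close> in syzygy \<open>r + m - 2\<close>; only position 1 is left
    over, where the \<open>h\<close> interfere.\<close>
  define u where "u j = (if j = 0 then t 0 else t (j - r + 2))" for j
  define J where "J = insert 0 {r..<q}"
  have r0: "0 \<notin> {r..<q}" using cs by auto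
  have t: "\<alpha>1 * t m = (\<Sum>j\<in>J. u j * tail j m)" if m: "m < r" "m \<noteq> 1" for m
  proof -
    have "(\<Sum>j\<in>J. u j * tail j m) = t 0 * tail 0 m + (\<Sum>j\<in>{r..<q}. u j * tail j m)"
      using r0 by (simp add: J_def u_def)
    also have "(\<Sum>j\<in>{r..<q}. u j * tail j m) = (\<Sum>j\<in>{r..<q}. if j = r + m - 2 then (if m = 0 then 0 else \<alpha>1 * t m) else 0)"
      using m cs by (intro sum.cong refl) (auto simp: tail_def u_def)
    finally show ?thesis using m cs by (auto simp: tail_def q_def)
  qed
  have J: "1 \<notin> J" "J \<subseteq> {..<q}" using cs by (auto simp: J_def q_def)
  obtain w where w: "\<And>i. i < l \<Longrightarrow> \<alpha>1 * x i = (\<Sum>j\<in>insert 1 J. w j * head j i)"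
    "\<And>m. m < r \<Longrightarrow> \<alpha>1 * t m = (\<Sum>j\<in>insert 1 J. w j * tail j m)"
    by (rule reduce_syzygy[OF syz disjI2[OF refl] J(1) J(2)[unfolded q_def] t]) (assumption+, rule that)
  have "(\<Sum>j<q. (if j \<in> insert 1 J then w j else 0) * y j) = (\<Sum>j\<in>insert 1 J. w j * y j)" for y
    using J cs by (intro sum.mono_neutral_cong_right) (auto simp: q_def)
  then show thesis using w by (intro that[of "\<lambda>j. if j \<in> insert 1 J then w j else 0"]) (simp_all add: q_def)
qed

lemma resolution:
  assumes res: "minimal_free_resolution D12 k M (\<theta>s @ \<eta>s) R" and M0: "M 0 = ds @ cs"
  shows "\<exists>M' R' es rest H F. change_of_bases M (\<theta>s @ \<eta>s) R M' (\<theta>s @ \<eta>s) R' \<and>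
    minimal_free_resolution D12 k M' (\<theta>s @ \<eta>s) R' \<and> M' 0 = ds @ cs \<and>
    M' 1 = map Suc cs @ es \<and> es \<noteq> [] \<and>
    (\<forall>j<r. H j \<in> carrier_vec l) \<and>
    row (R' 1) 0 = H 0 @\<^sub>v (\<alpha>1 \<cdot>\<^sub>v unit_vec r 0) \<and>
    row (R' 1) 1 = H 1 @\<^sub>v (\<alpha>2 \<cdot>\<^sub>v unit_vec r 1) \<and>
    (\<forall>j\<in>{2..<r}. row (R' 1) j = H j @\<^sub>v (- g j \<cdot>\<^sub>v unit_vec r 0 + \<alpha>2 \<cdot>\<^sub>v unit_vec r j)) \<and>
    M' 2 = map Suc es @ rest \<and>
    (\<forall>i<length es. F i \<in> carrier_vec r \<and> row (R' 2) i = F i @\<^sub>v (\<alpha>2 \<cdot>\<^sub>v unit_vec (length es) i)) \<and>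
    (M' 2 = map Suc es \<longrightarrow> length es = r - 2 \<and> M' 3 = [])"
proof -
  define gs where "gs = \<theta>s @ \<eta>s"
  define n q where "n = l + r" and "q = r + (r - 2)"
  define bs where "bs = map Suc cs @ map Suc (drop 2 cs)"
  have len: "length gs = n" "length (ds @ cs) = n" "length bs = q"
    by (simp_all add: gs_def n_def q_def bs_def length_\<eta>s d1.length_ds)
  define T where "T = mat q n (\<lambda>(j, k). if k < l then head j k else tail j (k - l))"
  have cT: "T \<in> carrier_mat q n" by (simp add: T_def)
  have T: "graded_mat bs (M 0) T"
    unfolding graded_mat_iff M0 len
  proof (intro conjI allI impI)
    fix j k assume jk: "j < q" "k < n"
    show "hom_shift (bs ! j) ((ds @ cs) ! k) (T $$ (j, k))"
    proof (cases "k < l")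
      case True
      then show ?thesis
        using jk hom_head_tail(1)[of j k] by (simp add: T_def bs_def q_def nth_append d1.length_ds)
    next
      case False
      then show ?thesis
        using jk hom_head_tail(2)[of j "k - l"] by (simp add: T_def bs_def q_def n_def nth_append d1.length_ds)
    qed
  qed (rule cT)
  have comb_vec: "der_comb gs v = comb \<theta>s (vec_index v) + comb \<eta>s (\<lambda>m. vec_index v (l + m))" for v
    by (simp add: der_comb_eq_comb gs_def comb_append)
  have exact0: "{v \<in> carrier_vec n. der_comb gs v = 0} = row_map (R' 1) ` carrier_vec (length (M' 1))"
    if "minimal_free_resolution D12 k M' gs R'" "M' 0 = ds @ cs" for M' R'
    using that(1) by (simp add: minimal_free_resolution_def graded_free_resolution_def that(2) len del: length_append)
  have carrier: "R' (Suc i) \<in> carrier_mat (length (M' (Suc i))) (length (M' i))"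
    if "minimal_free_resolution D12 k M' gs R'" for M' R' i
    using that by (auto simp: minimal_free_resolution_def graded_free_resolution_def graded_mat_def)
  have exact: "{v \<in> carrier_vec (length (M' (Suc i))). row_map (R' (Suc i)) v = 0\<^sub>v (length (M' i))}
       = row_map (R' (Suc (Suc i))) ` carrier_vec (length (M' (Suc (Suc i))))"
    if "minimal_free_resolution D12 k M' gs R'" for M' R' i
    using that unfolding minimal_free_resolution_def graded_free_resolution_def by blast
  note res = res[folded gs_def]
  have rowT: "der_comb gs (row T j) = 0" if j: "j < q" for j
  proof -
    have "comb \<theta>s (vec_index (row T j)) = comb \<theta>s (head j)"
      using j by (intro comb_cong) (simp add: T_def n_def)
    moreover have "comb \<eta>s (\<lambda>m. vec_index (row T j) (l + m)) = comb \<eta>s (tail j)"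
      using j by (intro comb_cong) (simp add: T_def n_def length_\<eta>s)
    ultimately show ?thesis using head_tail_syzygy j by (simp add: comb_vec q_def)
  qed
  obtain rest1 R1 where res1: "minimal_free_resolution D12 k (M(Suc 0 := bs @ rest1)) gs R1"
    and cb1: "change_of_bases M gs R (M(Suc 0 := bs @ rest1)) gs R1"
    and R1T: "\<And>j. j < length bs \<Longrightarrow> row (R1 (Suc 0)) j = row T j"
  proof (rule change_syzygies[OF res T])
    fix j assume "j < length bs"
    then have "row T j \<in> carrier_vec n" "der_comb gs (row T j) = 0"
      using rowT row_carrier_vec[OF _ cT] by (auto simp: len)
    then show "row T j \<in> row_map (R (Suc 0)) ` carrier_vec (length (M (Suc 0)))"
      using exact0[OF res M0] by auto
  next
    fix c assume c: "\<And>k. k < length (M 0) \<Longrightarrow> order2 (\<Sum>j<length bs. const (c j) * T $$ (j, k))"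
    have "order2 (\<Sum>j<q. const (c j) * tail j m)" if m: "m < r" for m
    proof -
      have "(\<Sum>j<q. const (c j) * tail j m) = (\<Sum>j<q. const (c j) * T $$ (j, l + m))"
        using m by (intro sum.cong refl) (simp add: T_def n_def)
      then show ?thesis using c[of "l + m"] m by (simp only: len M0) (simp add: n_def)
    qed
    then show "\<forall>j<length bs. c j = 0" using tail_independent by (simp add: len q_def)
  qed (rule that)
  define M1 where "M1 = M(Suc 0 := bs @ rest1)"
  \<comment> \<open>The syzygies with pivot \<open>\<alpha>1\<close> are counted in
    \<open>es\<close>. Hence \<open>es\<close> is nonempty with at least \<open>r - 2\<close>
    members, and equality means that there are no basis syzygies beyond the explicit ones.\<close>
  define es where "es = map Suc (drop 2 cs) @ rest1"
  define t where "t = length es"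
  have M1: "M1 0 = ds @ cs" "M1 (Suc 0) = map Suc cs @ es" by (simp_all add: M1_def M0 bs_def es_def)
  have lenM1: "length (M1 (Suc 0)) = r + t" "length (M1 0) = n" unfolding M1 by (simp_all add: t_def len(2)[simplified])
  have q: "q \<le> r + t" by (simp add: q_def t_def es_def)
  note res1 = res1[folded M1_def] and cb1 = cb1[folded M1_def]
  define X where "X = R1 (Suc 0)"
  have cX: "X \<in> carrier_mat (r + t) n" using carrier[OF res1, of 0] by (simp add: X_def lenM1)
  have XT: "X $$ (j, c) = T $$ (j, c)" if "j < q" "c < n" for j c
  proof -
    have "vec_index (row X j) c = vec_index (row T j) c" using R1T[of j] that by (simp add: X_def len)
    then show ?thesis using that cX cT q by simp
  qed
  have Xrow: "comb \<theta>s (\<lambda>i. X $$ (j, i)) + comb \<eta>s (\<lambda>m. X $$ (j, l + m)) = 0" if j: "j < r + t" for j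
  proof -
    have "row X j = row_map X (unit_vec (r + t) j)" using row_map_unit_vec[OF cX j] by simp
    then have "row X j \<in> row_map (R1 1) ` carrier_vec (length (M1 1))"
      by (simp add: X_def lenM1)
    then have "der_comb gs (row X j) = 0" using exact0[OF res1 M1(1)] by blast
    moreover have "comb \<theta>s (vec_index (row X j)) = comb \<theta>s (\<lambda>i. X $$ (j, i))"
      using j cX by (intro comb_cong) (simp add: n_def)
    moreover have "comb \<eta>s (\<lambda>m. vec_index (row X j) (l + m)) = comb \<eta>s (\<lambda>m. X $$ (j, l + m))"
      using j cX by (intro comb_cong) (simp add: n_def length_\<eta>s)
    ultimately show ?thesis by (simp add: comb_vec)
  qed
  \<comment> \<open>The first \<open>q\<close> rows of \<open>X\<close> are the explicit syzygies,
    so identities in terms of \<open>head\<close> and \<open>tail\<close> become identities between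
    rows of \<open>X\<close>.\<close>
  have lift: "\<alpha> * X $$ (i, c) = (\<Sum>j<p. w j * X $$ (j, c))"
    if w: "\<And>c. c < l \<Longrightarrow> \<alpha> * X $$ (i, c) = (\<Sum>j<p. w j * head j c)"
      "\<And>m. m < r \<Longrightarrow> \<alpha> * X $$ (i, l + m) = (\<Sum>j<p. w j * tail j m)" and p: "p \<le> q" and c: "c < n"
    for \<alpha> i p w c
  proof (cases "c < l")
    case True
    then show ?thesis using w(1)[OF True] p c by (simp add: XT T_def)
  next
    case False
    then have "c - l < r" "l + (c - l) = c" using c by (auto simp: n_def)
    with False show ?thesis using w(2)[of "c - l"] p c by (simp add: XT T_def)
  qed
  have kerX: "row_map X v = 0\<^sub>v n" if v: "v \<in> carrier_vec (r + t)"
    and "\<And>c. c < n \<Longrightarrow> (\<Sum>j<r + t. vec_index v j * X $$ (j, c)) = 0" for v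
    using that carrier_vecD[OF row_map_carrier[OF cX, of v]]
    by (intro eq_vecI) (auto simp: row_map_index[OF cX v])
  have "\<exists>v. hom_vec (Suc (es ! i)) (M1 1) v \<and> row_map X v = 0\<^sub>v n \<and>
      (\<forall>m<t. vec_index v (r + m) = (if m = i then \<alpha>2 else 0))" if i: "i < t" for i
  proof -
    obtain w where w: "\<And>c. c < l \<Longrightarrow> \<alpha>2 * X $$ (r + i, c) = (\<Sum>j<r. w j * head j c)"
      "\<And>m. m < r \<Longrightarrow> \<alpha>2 * X $$ (r + i, l + m) = (\<Sum>j<r. w j * tail j m)"
      by (rule \<alpha>2_multiple_syzygy[OF Xrow[of "r + i"]]) (use i in simp, rule that)
    \<comment> \<open>A second syzygy: \<open>\<alpha>2\<close> times basis syzygy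
      \<open>r + i\<close> minus its expression through the first \<open>r\<close> of them.\<close>
    define v where "v = Matrix.vec (r + t) (\<lambda>j. if j < r then - w j else if j = r + i then \<alpha>2 else 0)"
    have v: "v \<in> carrier_vec (r + t)" by (simp add: v_def)
    have "row_map X v = 0\<^sub>v n"
    proof (rule kerX[OF v])
      fix c assume c: "c < n"
      have "(\<Sum>j<r + t. vec_index v j * X $$ (j, c))
          = (\<Sum>j<r + t. (if j < r then - (w j * X $$ (j, c)) else 0) + (if j = r + i then \<alpha>2 * X $$ (r + i, c) else 0))"
        by (intro sum.cong refl) (auto simp: v_def)
      also have "\<dots> = (\<Sum>j<r + t. if j < r then - (w j * X $$ (j, c)) else 0) + \<alpha>2 * X $$ (r + i, c)"
        using i by (simp add: sum.distrib)
      also have "(\<Sum>j<r + t. if j < r then - (w j * X $$ (j, c)) else 0) = (\<Sum>j<r. - (w j * X $$ (j, c)))"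
        by (intro sum.mono_neutral_cong_right) auto
      finally show "(\<Sum>j<r + t. vec_index v j * X $$ (j, c)) = 0"
        using lift[OF w _ c] by (simp add: sum_negf q_def)
    qed
    \<comment> \<open>Passing to the component of degree \<open>Suc (es ! i)\<close> makes the
      second syzygy homogeneous and keeps the pivot, since \<open>\<alpha>2\<close> has the right
      degree there.\<close>
    then have "row_map X (part_vec (Suc (es ! i)) (M1 1) v) = 0\<^sub>v n"
      using part_vec_row_map[of "M1 1" "M1 0" X v "Suc (es ! i)"] res1 v
      by (simp add: minimal_free_resolution_def graded_free_resolution_def X_def lenM1)
        (auto simp: part_vec_def lenM1)
    moreover have "vec_index (part_vec (Suc (es ! i)) (M1 1) v) (r + m) = (if m = i then \<alpha>2 else 0)" if "m < t" for m
    proof -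
      have "M1 1 ! (r + m) = es ! m" using M1(2) by (simp add: nth_append)
      then show ?thesis using that hom_\<alpha>(2) by (simp add: part_vec_def lenM1 v_def hom_part_id)
    qed
    ultimately show ?thesis using hom_vec_part_vec by blast
  qed
  then obtain v where v: "\<And>i. i < t \<Longrightarrow> hom_vec (Suc (es ! i)) (M1 1) (v i)" "\<And>i. i < t \<Longrightarrow> row_map X (v i) = 0\<^sub>v n"
    "\<And>i m. i < t \<Longrightarrow> m < t \<Longrightarrow> vec_index (v i) (r + m) = (if m = i then \<alpha>2 else 0)" by metis
  define T2 where "T2 = mat t (r + t) (\<lambda>(i, j). vec_index (v i) j)"
  have cT2: "T2 \<in> carrier_mat t (r + t)" by (simp add: T2_def)
  have vc: "v i \<in> carrier_vec (r + t)" if "i < t" for i using v(1)[OF that] by (simp add: hom_vec_def lenM1)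
  have rowT2: "row T2 i = v i" if "i < t" for i
    using that vc[OF that] by (intro eq_vecI) (auto simp: T2_def)
  have T2: "graded_mat (map Suc es) (M1 (Suc 0)) T2"
    using v(1) by (auto simp: graded_mat_iff T2_def lenM1 hom_vec_def t_def)
  obtain rest2 R2 where res2: "minimal_free_resolution D12 k (M1(Suc (Suc 0) := map Suc es @ rest2)) gs R2"
    and cb2: "change_of_bases M1 gs R1 (M1(Suc (Suc 0) := map Suc es @ rest2)) gs R2"
    and R2T: "\<And>j. j < length (map Suc es) \<Longrightarrow> row (R2 (Suc (Suc 0))) j = row T2 j"
    and R21: "\<And>l. 0 < l \<Longrightarrow> l \<le> Suc 0 \<Longrightarrow> R2 l = R1 l"
  proof (rule change_syzygies[OF res1 T2])
    fix j assume "j < length (map Suc es)"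
    then have j: "j < t" by (simp add: t_def)
    then have "v j \<in> {v \<in> carrier_vec (length (M1 (Suc 0))). row_map (R1 (Suc 0)) v = 0\<^sub>v (length (M1 0))}"
      using vc v(2) by (simp add: lenM1 X_def)
    then show "row T2 j \<in> row_map (R1 (Suc (Suc 0))) ` carrier_vec (length (M1 (Suc (Suc 0))))"
      using exact[OF res1, of 0] rowT2[OF j] by simp
  next
    fix c assume c: "\<And>k. k < length (M1 (Suc 0)) \<Longrightarrow> order2 (\<Sum>j<length (map Suc es). const (c j) * T2 $$ (j, k))"
    show "\<forall>j<length (map Suc es). c j = 0"
    proof (intro allI impI)
      fix i assume "i < length (map Suc es)"
      then have i: "i < t" by (simp add: t_def)
      \<comment> \<open>Column \<open>r + i\<close> contains nothing but the pivot of row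
        \<open>i\<close>.\<close>
      have "(\<Sum>j<t. const (c j) * T2 $$ (j, r + i)) = (\<Sum>j<t. if j = i then const (c i) * \<alpha>2 else 0)"
        using i by (intro sum.cong refl) (auto simp: T2_def v(3))
      then have "order2 (const 0 * \<alpha>1 + const (c i) * \<alpha>2)"
        using c[of "r + i"] i by (simp add: lenM1) (simp add: t_def)
      then show "c i = 0" by (rule linear_independent)
    qed
  qed (rule that)
  define M2 where "M2 = M1(Suc (Suc 0) := map Suc es @ rest2)"
  note res2 = res2[folded M2_def] and cb2 = cb2[folded M2_def]
  have M2: "M2 0 = ds @ cs" "M2 1 = map Suc cs @ es" "M2 2 = map Suc es @ rest2"
    using M1 by (simp_all add: M2_def numeral_2_eq_2)
  have R21: "R2 1 = X" using R21 by (simp add: X_def)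
  have cb: "change_of_bases M gs R M2 gs R2"
    using M0 len by (intro change_of_bases_trans[OF _ carrier[OF res] carrier[OF res1] carrier[OF res2] cb1 cb2]) simp
  define Y where "Y = R2 2"
  have cY: "Y \<in> carrier_mat (t + length rest2) (r + t)"
    using carrier[OF res2, of 1] M2 by (simp add: Y_def numeral_2_eq_2 t_def)
  have rowY: "row Y i = v i" if "i < t" for i
    using R2T[of i] rowT2[OF that] that by (simp add: Y_def t_def numeral_2_eq_2)
  define H where "H j = Matrix.vec l (head j)" for j
  define F where "F i = Matrix.vec r (vec_index (v i))" for i
  have rows1: "row (R2 1) j = H j @\<^sub>v Matrix.vec r (tail j)" if "j < q" for j
  proof -
    have "row (R2 1) j = row T j" using R1T[of j] that unfolding R21 X_def by (simp add: len)
    also have "\<dots> = H j @\<^sub>v Matrix.vec r (tail j)"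
      using that by (intro eq_vecI) (auto simp: T_def H_def n_def)
    finally show ?thesis .
  qed
  have "Matrix.vec r (tail 0) = \<alpha>1 \<cdot>\<^sub>v unit_vec r 0" "Matrix.vec r (tail 1) = \<alpha>2 \<cdot>\<^sub>v unit_vec r 1"
    using cs(1) by (auto intro!: eq_vecI simp: tail_def)
  moreover have *: "Matrix.vec r (tail j) = - g j \<cdot>\<^sub>v unit_vec r 0 + \<alpha>2 \<cdot>\<^sub>v unit_vec r j" if "j \<in> {2..<r}" for j
    using that cs(1) by (intro eq_vecI) (auto simp: tail_def)
  ultimately have r1: "row (R2 1) 0 = H 0 @\<^sub>v (\<alpha>1 \<cdot>\<^sub>v unit_vec r 0)" "row (R2 1) 1 = H 1 @\<^sub>v (\<alpha>2 \<cdot>\<^sub>v unit_vec r 1)"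
    "\<forall>j\<in>{2..<r}. row (R2 1) j = H j @\<^sub>v (- g j \<cdot>\<^sub>v unit_vec r 0 + \<alpha>2 \<cdot>\<^sub>v unit_vec r j)"
  proof -
    show "\<forall>j\<in>{2..<r}. row (R2 1) j = H j @\<^sub>v (- g j \<cdot>\<^sub>v unit_vec r 0 + \<alpha>2 \<cdot>\<^sub>v unit_vec r j)"
    proof
      fix j assume j: "j \<in> {2..<r}"
      then have "j < q" using cs(1) by (auto simp: q_def)
      from rows1[OF this] show "row (R2 1) j = H j @\<^sub>v (- g j \<cdot>\<^sub>v unit_vec r 0 + \<alpha>2 \<cdot>\<^sub>v unit_vec r j)"
        unfolding *[OF j] .
    qed
  qed (use rows1[of 0] rows1[of 1] cs(1) in \<open>simp_all add: q_def\<close>)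
  have r2: "F i \<in> carrier_vec r \<and> row (R2 2) i = F i @\<^sub>v (\<alpha>2 \<cdot>\<^sub>v unit_vec (length es) i)" if i: "i < length es" for i
  proof -
    have it: "i < t" using i by (simp add: t_def)
    have "v i = F i @\<^sub>v (\<alpha>2 \<cdot>\<^sub>v unit_vec t i)"
    proof (rule eq_vecI)
      show "dim_vec (v i) = dim_vec (F i @\<^sub>v (\<alpha>2 \<cdot>\<^sub>v unit_vec t i))" using vc[OF it] by (simp add: F_def)
      fix j assume "j < dim_vec (F i @\<^sub>v (\<alpha>2 \<cdot>\<^sub>v unit_vec t i))"
      then have j: "j < r + t" by (simp add: F_def)
      show "vec_index (v i) j = vec_index (F i @\<^sub>v (\<alpha>2 \<cdot>\<^sub>v unit_vec t i)) j"
      proof (cases "j < r")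
        case False
        then show ?thesis using v(3)[OF it, of "j - r"] j it by (simp add: F_def)
      qed (use j in \<open>simp add: F_def\<close>)
    qed
    then show ?thesis using rowY[OF it] by (simp add: Y_def t_def F_def)
  qed
  have final: "length es = r - 2 \<and> M2 3 = []" if "M2 2 = map Suc es"
  proof
    have rest2: "rest2 = []" using that M2(3) by simp
    have cY: "Y \<in> carrier_mat t (r + t)" using cY rest2 by simp
    \<comment> \<open>If there are no further second syzygies, the last \<open>t\<close> columns of
      \<open>Y\<close> are \<open>\<alpha>2\<close> times the identity, so every element of the
      kernel of \<open>R 1\<close> has multiples of \<open>\<alpha>2\<close> in these
      positions.\<close>
    have Y: "vec_index (row_map Y w) (r + m) = vec_index w m * \<alpha>2" if w: "w \<in> carrier_vec t" and m: "m < t" for w m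
    proof -
      have "vec_index (row_map Y w) (r + m) = (\<Sum>i<t. vec_index w i * Y $$ (i, r + m))"
        using m by (intro row_map_index[OF cY w]) simp
      also have "\<dots> = (\<Sum>i<t. if i = m then vec_index w m * \<alpha>2 else 0)"
      proof (intro sum.cong refl)
        fix i assume i: "i \<in> {..<t}"
        then have "Y $$ (i, r + m) = vec_index (row Y i) (r + m)" using cY m by simp
        then show "vec_index w i * Y $$ (i, r + m) = (if i = m then vec_index w m * \<alpha>2 else 0)"
          using i m rowY v(3) by simp
      qed
      finally show ?thesis using m by simp
    qed
    show "length es = r - 2"
    proof (rule ccontr)
      assume "length es \<noteq> r - 2"
      then have qt: "q < r + t" "q - r < t" "r + (q - r) = q" by (auto simp: t_def es_def q_def)
      obtain w where w: "\<And>c. c < l \<Longrightarrow> \<alpha>1 * X $$ (q, c) = (\<Sum>j<q. w j * head j c)"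
        "\<And>m. m < r \<Longrightarrow> \<alpha>1 * X $$ (q, l + m) = (\<Sum>j<q. w j * tail j m)"
        by (rule \<alpha>1_multiple_syzygy[OF Xrow[OF qt(1)], folded q_def]) (rule that)
      \<comment> \<open>Row \<open>q\<close> is the first basis syzygy beyond the explicit ones. Its
        \<open>\<alpha>1\<close>-multiple gives a second syzygy with entry \<open>\<alpha>1\<close>
        at position \<open>q\<close>, which is not a multiple of \<open>\<alpha>2\<close>.\<close>
      define x where "x = Matrix.vec (r + t) (\<lambda>j. if j < q then - w j else if j = q then \<alpha>1 else 0)"
      have x: "x \<in> carrier_vec (r + t)" by (simp add: x_def)
      have "row_map X x = 0\<^sub>v n"
      proof (rule kerX[OF x])
        fix c assume c: "c < n"
        have "(\<Sum>j<r + t. vec_index x j * X $$ (j, c))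
            = (\<Sum>j<r + t. (if j < q then - (w j * X $$ (j, c)) else 0) + (if j = q then \<alpha>1 * X $$ (q, c) else 0))"
          by (intro sum.cong refl) (auto simp: x_def)
        also have "\<dots> = (\<Sum>j<r + t. if j < q then - (w j * X $$ (j, c)) else 0) + \<alpha>1 * X $$ (q, c)"
          using qt by (simp add: sum.distrib)
        also have "(\<Sum>j<r + t. if j < q then - (w j * X $$ (j, c)) else 0) = (\<Sum>j<q. - (w j * X $$ (j, c)))"
          using qt by (intro sum.mono_neutral_cong_right) auto
        finally show "(\<Sum>j<r + t. vec_index x j * X $$ (j, c)) = 0"
          using lift[OF w order.refl c] by (simp add: sum_negf)
      qed
      then have "x \<in> {v \<in> carrier_vec (length (M2 (Suc 0))). row_map (R2 (Suc 0)) v = 0\<^sub>v (length (M2 0))}"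
        using x M2 R21 len by (simp add: t_def)
      then have "x \<in> row_map Y ` carrier_vec t"
        unfolding exact[OF res2] using M2(3) rest2 by (simp add: Y_def numeral_2_eq_2 t_def)
      then obtain u where u: "u \<in> carrier_vec t" "x = row_map Y u" by blast
      have "\<alpha>1 = vec_index x q" using qt by (simp add: x_def)
      also have "\<dots> = vec_index u (q - r) * \<alpha>2" using Y[OF u(1) qt(2)] by (simp add: u(2) qt(3))
      finally show False using not_dvd21 by (metis dvd_triv_right)
    qed
    show "M2 3 = []"
    proof (rule ccontr)
      assume "M2 3 \<noteq> []"
      define p where "p = length (M2 (Suc 2))"
      have p: "0 < p" using \<open>M2 3 \<noteq> []\<close> by (simp add: p_def eval_nat_numeral)
      have c3: "R2 (Suc 2) \<in> carrier_mat p t" using carrier[OF res2, of 2] M2(3) rest2 by (simp add: p_def t_def)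
      \<comment> \<open>Because \<open>Y\<close> is injective, this basis vector of the third module
        maps to 0. By exactness it is then an image under \<open>R 4\<close>, although minimality
        leaves no constant terms in such images.\<close>
      define u :: "('n, 'k) mpoly Matrix.vec" where "u = unit_vec p 0"
      have u: "u \<in> carrier_vec p" by (simp add: u_def)
      have y: "row_map (R2 (Suc 2)) u \<in> carrier_vec t" by (rule row_map_carrier[OF c3])
      have "row_map (R2 (Suc 2)) u \<in> {v \<in> carrier_vec (length (M2 (Suc 1))). row_map (R2 (Suc 1)) v = 0\<^sub>v (length (M2 1))}"
        using exact[OF res2, of 1] u by (auto simp: p_def eval_nat_numeral)
      then have "row_map Y (row_map (R2 (Suc 2)) u) = 0\<^sub>v (r + t)"
        using M2(2) by (simp add: Y_def t_def eval_nat_numeral)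
      then have "vec_index (row_map (R2 (Suc 2)) u) m * \<alpha>2 = 0" if "m < t" for m
        using Y[OF y that] that by simp
      then have "row_map (R2 (Suc 2)) u = 0\<^sub>v t" using nonzero y by (intro eq_vecI) auto
      then have "u \<in> {v \<in> carrier_vec (length (M2 (Suc 2))). row_map (R2 (Suc 2)) v = 0\<^sub>v (length (M2 2))}"
        using u M2(3) rest2 by (simp add: p_def t_def)
      then obtain z where z: "z \<in> carrier_vec (length (M2 (Suc (Suc 2))))" "u = row_map (R2 (Suc (Suc 2))) z"
        unfolding exact[OF res2] by blast
      have "const_term (vec_index u 0) = 0"
        unfolding z(2)
      proof (rule irrelevant_row_map'[OF _ z(1) _ p])
        show "R2 (Suc (Suc 2)) \<in> carrier_mat (length (M2 (Suc (Suc 2)))) p"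
          unfolding p_def by (rule carrier[OF res2])
        show "irrelevant_mat (R2 (Suc (Suc 2)))" using res2 unfolding minimal_free_resolution_iff by blast
      qed
      then show False using p by (simp add: u_def)
    qed
  qed
  have "es \<noteq> []" using cs(1) by (simp add: es_def)
  moreover have "\<forall>j<r. H j \<in> carrier_vec l" by (simp add: H_def)
  moreover have "M2 2 = map Suc es \<longrightarrow> length es = r - 2 \<and> M2 3 = []" using final by (rule impI)
  moreover have "\<forall>i<length es. F i \<in> carrier_vec r \<and> row (R2 2) i = F i @\<^sub>v (\<alpha>2 \<cdot>\<^sub>v unit_vec (length es) i)"
    by (intro allI impI r2)
  ultimately show ?thesis
    using cb[unfolded gs_def] res2[unfolded gs_def] M2 r1
    by (intro exI[of _ M2] exI[of _ R2] exI[of _ es] exI[of _ rest2] exI[of _ H] exI[of _ F] conjI)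
qed

end

subsection \<open>Logarithmic derivations\<close>

lemma der_apply_add: "der_apply (\<theta> + \<eta>) p = der_apply \<theta> p + der_apply \<eta> p"
  by (simp add: der_apply_def distrib_right sum.distrib)

lemma der_apply_scale: "der_apply (s *s \<theta>) p = s * der_apply \<theta> p"
  by (simp add: der_apply_def sum_distrib_left mult.assoc)

lemma der_apply_0 [simp]: "der_apply 0 p = 0"
  by (simp add: der_apply_def)

lemma subspace_D: "der.subspace (D A)"
  by (rule der.subspaceI) (auto simp: D_def der_apply_add der_apply_scale)

lemma D_antimono: "A \<subseteq> B \<Longrightarrow> D B \<subseteq> D A"
  by (auto simp: D_def)

lemma D_Int_deletions: "H1 \<noteq> H2 \<Longrightarrow> D (A - {H1}) \<inter> D (A - {H2}) = D A"
  by (auto simp: D_def)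

lemma D_delete_scale:
  fixes A :: "('k::field ^ 'n::finite) set set"
  assumes A: "\<forall>H\<in>A. hyperplane H" and \<alpha>: "defining_form H \<alpha>" and \<eta>: "\<eta> \<in> D (A - {H})"
  shows "\<alpha> *s \<eta> \<in> D A"
  unfolding D_def
proof (clarify, goal_cases)
  case (1 K \<beta>)
  show ?case
  proof (cases "K = H")
    case True
    have "\<beta> \<noteq> 0" using defining_form_nonzero 1 A by blast
    then obtain c where "\<alpha> = const c * \<beta>" using defining_form_eqD[of H \<beta> \<alpha>] 1 \<alpha> True by blast
    then show ?thesis by (simp add: der_apply_scale)
  next
    case False
    then have "\<beta> dvd der_apply \<eta> \<beta>" using \<eta> 1 by (auto simp: D_def)
    then show ?thesis by (simp add: der_apply_scale)
  qed
qed

text \<open>The only new condition is at \<open>H\<close>, whose form is prime and does not divide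
  the form \<open>\<alpha>\<close> of another hyperplane, so that \<open>\<alpha>\<close> can be
  cancelled.\<close>

lemma D_delete_cancel:
  fixes A :: "('k::field ^ 'n::{finite,linorder}) set set"
  assumes A: "\<forall>H\<in>A. hyperplane H" and H': "hyperplane H'" "defining_form H' \<alpha>" "H' \<noteq> H"
    and \<eta>: "\<eta> \<in> D (A - {H})" and scaled: "\<alpha> *s \<eta> \<in> D A"
  shows "\<eta> \<in> D A"
  unfolding D_def
proof (clarify, goal_cases)
  case (1 K \<beta>)
  show ?case
  proof (cases "K = H")
    case True
    have "\<beta> dvd \<alpha> * der_apply \<eta> \<beta>" using scaled 1 by (auto simp: D_def der_apply_scale)
    moreover have "\<not> \<beta> dvd \<alpha>" using defining_form_not_dvd[OF H'(1) 1(2) H'(2)] True H'(3) by blast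
    moreover have "homogeneous 1 \<beta>" "\<beta> \<noteq> 0"
      using 1 A defining_form_nonzero by (auto simp: defining_form_def)
    ultimately show ?thesis using linear_form_prime by blast
  next
    case False
    then show ?thesis using \<eta> 1 by (auto simp: D_def)
  qed
qed

text \<open>Minimality keeps \<open>\<phi>\<close> out of \<open>D A\<close>, so some form
  \<open>\<beta>\<close> of \<open>H\<close> does not divide its value under \<open>\<phi>\<close>.
  If \<open>g *s \<phi>\<close> is in \<open>D A\<close>, primality then forces
  \<open>\<beta>\<close>, and with it the proportional form \<open>\<alpha>\<close>, to divide
  \<open>g\<close>.\<close>

lemma SPOG_deletion:
  fixes A :: "('k::field ^ 'n::{finite,linorder}) set set"
  assumes A: "\<forall>H\<in>A. hyperplane H" and \<alpha>: "defining_form H \<alpha>" "H \<in> A"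
    and SPOG: "SPOG (A - {H}) ds c"
    and \<theta>s: "list_all2 homogeneous_der ds \<theta>s" "range (comb \<theta>s) = D A"
    and basis: "\<And>a i. comb \<theta>s a = 0 \<Longrightarrow> i < length \<theta>s \<Longrightarrow> a i = 0"
  obtains \<phi> where "deletion (D (A - {H})) \<alpha> \<theta>s ds \<phi> c"
proof -
  obtain M gs R \<beta> f where "\<beta> \<noteq> 0" and M: "M 0 = c # ds" "M 1 = [c + 1]" and row: "row (R 1) 0 = vCons \<beta> f"
    and res: "minimal_free_resolution (D (A - {H})) 1 M gs R"
    using SPOG unfolding SPOG_def by blast
  have nz: "vec_index (row (R 1) 0) 0 \<noteq> 0" using row \<open>\<beta> \<noteq> 0\<close> by simp
  have sub: "der_comb \<theta>s ` carrier_vec (length \<theta>s) \<subseteq> D (A - {H})"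
    using \<theta>s(2) D_antimono[of "A - {H}" A] by (auto simp: range_comb)
  have basis': "v = 0\<^sub>v (length \<theta>s)" if "v \<in> carrier_vec (length \<theta>s)" "der_comb \<theta>s v = 0" for v
    using that basis[of "vec_index v"] by (intro eq_vecI) (auto simp: der_comb_eq_comb)
  obtain \<phi> where \<phi>: "homogeneous_der c \<phi>" and gens: "min_gens (D (A - {H})) (ds @ [c]) (\<theta>s @ [\<phi>])"
    by (rule plus_one_generators[OF res M nz \<theta>s(1) sub basis'])
  have "\<phi> \<notin> D A"
  proof
    assume "\<phi> \<in> D A"
    then obtain a where a: "\<phi> = comb \<theta>s a" using \<theta>s(2) by blast
    have "comb (\<theta>s @ [\<phi>]) (\<lambda>i. if i < length \<theta>s then a i else - 1) = 0"
      unfolding comb_append comb_Cons using comb_cong[of \<theta>s "\<lambda>i. if i < length \<theta>s then a i else - 1" a]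
      by (simp add: a der.scale_minus_left der.scale_one)
    from min_gens_comb_relation[OF gens this, of "length \<theta>s"] show False by simp
  qed
  moreover have "\<phi> \<in> D (A - {H})"
    using gens set_subset_der_comb_image[of "\<theta>s @ [\<phi>]"] by (auto simp: min_gens_def)
  ultimately obtain \<beta> where \<beta>: "defining_form H \<beta>" "\<not> \<beta> dvd der_apply \<phi> \<beta>" by (auto simp: D_def)
  have lin: "homogeneous 1 \<alpha>" "homogeneous 1 \<beta>" using \<alpha> \<beta> by (auto simp: defining_form_def)
  have nonzero: "\<alpha> \<noteq> 0" "\<beta> \<noteq> 0" using defining_form_nonzero A \<alpha> \<beta>(1) by blast+
  show thesis
  proof (rule that[of \<phi>], unfold_locales)
    fix g assume "g *s \<phi> \<in> range (comb \<theta>s)"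
    then have "\<beta> dvd g * der_apply \<phi> \<beta>" using \<theta>s(2) \<beta>(1) \<alpha>(2) by (auto simp: D_def der_apply_scale)
    then have "\<beta> dvd g" using linear_form_prime[OF lin(2) nonzero(2)] \<beta>(2) by blast
    moreover obtain c where "\<beta> = const c * \<alpha>" using defining_form_eqD[OF \<alpha>(1) \<beta>(1) nonzero(1)] by blast
    ultimately show "\<alpha> dvd g" by (metis dvd_mult_right)
  next
    show "\<alpha> *s \<eta> \<in> range (comb \<theta>s)" if "\<eta> \<in> D (A - {H})" for \<eta>
      using D_delete_scale[OF A \<alpha>(1) that] \<theta>s(2) by simp
  qed (use lin gens \<theta>s basis \<phi> in auto)
qed

lemma free_with_exp_basis:
  assumes "free_with_exp A ds"
  obtains \<theta>s where "list_all2 homogeneous_der ds \<theta>s" "range (comb \<theta>s) = D A"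
    "\<And>a i. comb \<theta>s a = 0 \<Longrightarrow> i < length \<theta>s \<Longrightarrow> a i = 0"
proof -
  obtain \<theta>s where \<theta>s: "list_all2 homogeneous_der ds \<theta>s" "distinct \<theta>s"
    and indep: "der.independent (set \<theta>s)" and span: "der.span (set \<theta>s) = D A"
    using assms by (auto simp: free_with_exp_def)
  show thesis
  proof (rule that[OF \<theta>s(1)])
    show "range (comb \<theta>s) = D A" using der_comb_image_span[OF \<theta>s(2)] span by (simp add: range_comb)
    fix a i assume 0: "comb \<theta>s a = 0" and i: "i < length \<theta>s"
    have bij: "bij_betw (nth \<theta>s) {..<length \<theta>s} (set \<theta>s)" by (rule bij_betw_nth[OF \<theta>s(2) refl refl])
    define u where "u x = a (the_inv_into {..<length \<theta>s} (nth \<theta>s) x)" for x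
    have u: "u (\<theta>s ! j) = a j" if "j < length \<theta>s" for j
      using the_inv_into_f_f[OF bij_betw_imp_inj_on[OF bij], of j] that by (simp add: u_def)
    have "(\<Sum>x\<in>set \<theta>s. u x *s x) = (\<Sum>j<length \<theta>s. u (\<theta>s ! j) *s \<theta>s ! j)"
      by (rule sum.reindex_bij_betw[OF bij, symmetric])
    also have "\<dots> = 0" using 0 by (simp add: u comb_def)
    finally have "u (\<theta>s ! i) = 0" using der.independentD[OF indep _ order.refl] i by simp
    then show "a i = 0" using u i by simp
  qed
qed

theorem theorem3p9:
  fixes A :: "('k::field ^ 'n::{finite,linorder}) set set"
    and H1 H2 :: "('k ^ 'n::{finite,linorder}) set"
    and \<alpha>1 \<alpha>2 :: "('n, 'k) mpoly"
    and ds cs :: "nat list"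
    and k :: nat
    and M :: "nat \<Rightarrow> nat list"
    and gs :: "('n, 'k) der list"
    and R :: "nat \<Rightarrow> ('n, 'k) mpoly mat"
  assumes "arrangement A"
    and "free_with_exp A ds" and "ds ! 0 = 1"
    and "H1 \<in> A" and "H2 \<in> A" and "H1 \<noteq> H2"
    and "defining_form H1 \<alpha>1" and "defining_form H2 \<alpha>2"
    and "SPOG (A - {H1}) ds (cs ! 0)"
    and "SPOG (A - {H2}) ds (cs ! 1)"
    and "cs ! 0 \<le> cs ! 1"
    and "has_DS (A - {H1, H2}) (mset (ds @ cs))"
    and "size (mset (ds @ cs)) > CARD('n) + 2"
    and "minimal_free_resolution (D (A - {H1, H2})) k M gs R"
  shows "\<exists>M' gs' R' es rest h g f.
    change_of_bases M gs R M' gs' R' \<and>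
    minimal_free_resolution (D (A - {H1, H2})) k M' gs' R' \<and>
    M' 0 = ds @ cs \<and>
    \<comment> \<open>(1)\<close>
    M' 1 = map Suc cs @ es \<and> es \<noteq> [] \<and>
    (\<forall>j < length cs. h j \<in> carrier_vec CARD('n)) \<and>
    (\<forall>j \<in> {2..<length cs}. g j \<noteq> 0) \<and>
    row (R' 1) 0 = h 0 @\<^sub>v (\<alpha>1 \<cdot>\<^sub>v unit_vec (length cs) 0) \<and>
    row (R' 1) 1 = h 1 @\<^sub>v (\<alpha>2 \<cdot>\<^sub>v unit_vec (length cs) 1) \<and>
    (\<forall>j \<in> {2..<length cs}. row (R' 1) j =
       h j @\<^sub>v (g j \<cdot>\<^sub>v unit_vec (length cs) 0 + \<alpha>2 \<cdot>\<^sub>v unit_vec (length cs) j)) \<and>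
    \<comment> \<open>(2)\<close>
    M' 2 = map Suc es @ rest \<and> M' 2 \<noteq> [] \<and>
    (\<forall>i < length es. f i \<in> carrier_vec (length cs) \<and>
       row (R' 2) i = f i @\<^sub>v (\<alpha>2 \<cdot>\<^sub>v unit_vec (length es) i)) \<and>
    (M' 2 = map Suc es \<longrightarrow> length es = length cs - 2 \<and> M' 3 = [])"
proof -
  have A: "\<forall>H\<in>A. hyperplane H" using assms(1) by (simp add: arrangement_def)
  define D12 where "D12 = D (A - {H1, H2})"
  note res = assms(14)[folded D12_def]
  obtain \<theta>s where \<theta>s: "list_all2 homogeneous_der ds \<theta>s" "range (comb \<theta>s) = D A"
    and basis: "\<And>a i. comb \<theta>s a = 0 \<Longrightarrow> i < length \<theta>s \<Longrightarrow> a i = 0"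
    using free_with_exp_basis[OF assms(2)] by blast
  have len_ds: "length ds = CARD('n)" using assms(2) by (simp add: free_with_exp_def)
  then have len: "length \<theta>s = CARD('n)" using list_all2_lengthD[OF \<theta>s(1)] by simp
  have cs: "2 < length cs" using assms(13) by (simp add: len_ds)
  then have cs_ne: "cs \<noteq> []" by auto
  from cs have cs_eq: "cs = cs ! 0 # cs ! 1 # drop 2 cs"
    by (metis Cons_nth_drop_Suc One_nat_def Suc_lessD drop0 numeral_2_eq_2 zero_less_Suc less_trans)
  obtain \<phi>1 where d1: "deletion (D (A - {H1})) \<alpha>1 \<theta>s ds \<phi>1 (cs ! 0)"
  proof (rule SPOG_deletion[OF A assms(7,4,9) \<theta>s])
    show "a i = 0" if "comb \<theta>s a = 0" "i < length \<theta>s" for a i using that by (rule basis)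
  qed (rule that)
  obtain \<phi>2 where d2: "deletion (D (A - {H2})) \<alpha>2 \<theta>s ds \<phi>2 (cs ! 1)"
  proof (rule SPOG_deletion[OF A assms(8,5,10) \<theta>s])
    show "a i = 0" if "comb \<theta>s a = 0" "i < length \<theta>s" for a i using that by (rule basis)
  qed (rule that)
  interpret d1: deletion "D (A - {H1})" \<alpha>1 \<theta>s ds \<phi>1 "cs ! 0" by (rule d1)
  interpret d2: deletion "D (A - {H2})" \<alpha>2 \<theta>s ds \<phi>2 "cs ! 1" by (rule d2)
  have hyp: "hyperplane H1" "hyperplane H2" using A assms(4,5) by auto
  have not_dvd: "\<not> \<alpha>1 dvd \<alpha>2" "\<not> \<alpha>2 dvd \<alpha>1"
    using defining_form_not_dvd[OF hyp(2) assms(7,8,6)] defining_form_not_dvd[OF hyp(1) assms(8,7)] assms(6) by auto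
  have nonzero: "\<alpha>1 \<noteq> 0" "\<alpha>2 \<noteq> 0" using not_dvd by auto
  have hypA: "\<forall>H\<in>A - {K}. hyperplane H" for K using A by blast
  \<comment> \<open>Both orders of deletion are recorded, since each hyperplane in turn is the one
    put back.\<close>
  have D12: "D12 = D (A - {H1} - {H2})" "D12 = D (A - {H2} - {H1})"
    unfolding D12_def by (rule arg_cong[of _ _ D], blast)+
  interpret two_deletions "D (A - {H1})" "D (A - {H2})" \<alpha>1 \<alpha>2 \<theta>s ds \<phi>1 \<phi>2 "cs ! 0" "cs ! 1" D12
  proof
    show "\<alpha>1 dvd p" if "\<alpha>1 dvd \<alpha>2 * p" for p
      using linear_form_prime[OF d1.linear nonzero(1) that] not_dvd by blast
    show "D (A - {H1}) \<inter> D (A - {H2}) = range (comb \<theta>s)" using D_Int_deletions[OF assms(6)] \<theta>s(2) by simp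
    show "D (A - {H1}) \<subseteq> D12" "D (A - {H2}) \<subseteq> D12" unfolding D12_def by (intro D_antimono; blast)+
    show "der.subspace D12" unfolding D12_def by (rule subspace_D)
    show "\<alpha>2 *s \<eta> \<in> D (A - {H1})" if "\<eta> \<in> D12" for \<eta>
      using D_delete_scale[OF hypA assms(8)] that D12(1) by blast
    show "\<alpha>1 *s \<eta> \<in> D (A - {H2})" if "\<eta> \<in> D12" for \<eta>
      using D_delete_scale[OF hypA assms(7)] that D12(2) by blast
    show "\<eta> \<in> D (A - {H1})" if "\<eta> \<in> D12" "\<alpha>1 *s \<eta> \<in> range (comb \<theta>s)" for \<eta>
    proof (rule D_delete_cancel[OF hypA hyp(1) assms(7,6)])
      show "\<eta> \<in> D (A - {H1} - {H2})" using that(1) D12(1) by simp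
      show "\<alpha>1 *s \<eta> \<in> D (A - {H1})" using that(2) \<theta>s(2) D_antimono[of "A - {H1}" A] by auto
    qed
    show "\<eta> \<in> D (A - {H2})" if "\<eta> \<in> D12" "\<alpha>2 *s \<eta> \<in> range (comb \<theta>s)" for \<eta>
    proof (rule D_delete_cancel[OF hypA hyp(2) assms(8) assms(6)[symmetric]])
      show "\<eta> \<in> D (A - {H2} - {H1})" using that(1) D12(2) by simp
      show "\<alpha>2 *s \<eta> \<in> D (A - {H2})" using that(2) \<theta>s(2) D_antimono[of "A - {H2}" A] by auto
    qed
  qed (use not_dvd assms(11) in auto)
  have min0: "min_gens D12 (M 0) gs" by (rule minimal_free_resolution_min_gens[OF res])
  \<comment> \<open>Ties the degrees prescribed by the generator sequence to the given resolution,
    whose own generators may come in any order.\<close>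
  have ms: "mset (ds @ cs) = mset (M 0)"
    using has_DS_unique[OF assms(12)] min0 by (simp add: D12_def)
  have len_gs: "length gs > length \<theta>s + 2"
    using mset_eq_length[OF ms] min0 assms(13) len by (auto simp: min_gens_def dest: list_all2_lengthD)
  define ys bs where "ys = \<theta>s @ [\<phi>1, \<phi>2]" and "bs = ds @ [cs ! 0, cs ! 1]"
  have bs: "bs @ drop 2 cs = ds @ cs" using cs_eq by (simp add: bs_def)
  have ys: "list_all2 homogeneous_der bs ys"
    unfolding ys_def bs_def using d1.hom_\<theta>s d1.hom_\<phi> d2.hom_\<phi> by (intro list_all2_appendI) auto
  have "set \<theta>s \<subseteq> D12"
    using set_subset_der_comb_image[of \<theta>s] d1.comb_in_N sub1 by (auto simp: der_comb_eq_comb)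
  then have ysD: "set ys \<subseteq> D12"
    using d1.\<phi>_in_N d2.\<phi>_in_N sub1 sub2 by (auto simp: ys_def)
  obtain gs1 R1 where res1: "minimal_free_resolution D12 k (M(0 := bs @ drop 2 cs)) gs1 R1"
    and cb1: "change_of_bases M gs R (M(0 := bs @ drop 2 cs)) gs1 R1"
    and gs1: "\<And>j. j < length ys \<Longrightarrow> gs1 ! j = ys ! j"
  proof (rule change_generators[OF res ys ysD])
    show "mset (bs @ drop 2 cs) = mset (M 0)" using ms by (simp add: bs)
    fix c v assume v: "\<And>k. k < length gs \<Longrightarrow> const_term (vec_index v k) = 0"
      and eq: "(\<Sum>j<length ys. const (c j) *s ys ! j) = der_comb gs v"
    show "\<forall>j<length ys. c j = 0"
      using generators_independent[OF min0 len_gs v eq[unfolded ys_def der_comb_eq_comb]] by (simp add: ys_def)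
  qed (rule that)
  define M1 where "M1 = M(0 := ds @ cs)"
  note res1 = res1[unfolded bs, folded M1_def] and cb1 = cb1[unfolded bs, folded M1_def]
  have M10: "M1 0 = ds @ cs" by (simp add: M1_def)
  have min1: "min_gens D12 (ds @ cs) gs1" using minimal_free_resolution_min_gens[OF res1] M10 by simp
  then have hom1: "list_all2 homogeneous_der (ds @ cs) gs1" by (simp add: min_gens_def)
  have len1: "length gs1 = length \<theta>s + length cs" using list_all2_lengthD[OF hom1] len len_ds by simp
  define \<eta>s where "\<eta>s = drop (length \<theta>s) gs1"
  have \<eta>s_nth: "\<eta>s ! j = gs1 ! (length \<theta>s + j)" if "j < length cs" for j using that len1 by (simp add: \<eta>s_def)
  have "take (length \<theta>s) gs1 = \<theta>s"
    using gs1 len1 by (intro nth_equalityI) (auto simp: ys_def nth_append)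
  then have gs1_eq: "gs1 = \<theta>s @ \<eta>s" by (metis append_take_drop_id \<eta>s_def)
  have hom_\<eta>: "homogeneous_der (cs ! j) (\<eta>s ! j)" if "j < length cs" for j
    using list_all2_nthD2[OF hom1, of "length \<theta>s + j"] that len1 len len_ds
    by (simp add: \<eta>s_nth nth_append)
  have \<eta>D: "\<eta>s ! j \<in> D12" if "j < length cs" for j
    using min1 set_subset_der_comb_image[of gs1] nth_mem[of "length \<theta>s + j" gs1] that len1
    by (auto simp: \<eta>s_nth min_gens_def simp del: nth_mem)
  \<comment> \<open>Multiplying by \<open>\<alpha>2\<close> moves each generator into the first
    deletion, where homogeneous coordinates exist; these become the entries of the syzygies.\<close>
  have "\<exists>x y. \<alpha>2 *s \<eta>s ! j = comb \<theta>s x + y *s \<phi>1 \<and>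
      (\<forall>i<length \<theta>s. hom_shift (Suc (cs ! j)) (ds ! i) (x i)) \<and> hom_shift (Suc (cs ! j)) (cs ! 0) y"
    if "j < length cs" for j
    using d1.homogeneous_N_lift[OF scale2[OF \<eta>D[OF that]] homogeneous_der_scale[OF d2.linear hom_\<eta>[OF that]]] by metis
  then obtain a g where ag: "\<And>j. j < length cs \<Longrightarrow> \<alpha>2 *s \<eta>s ! j = comb \<theta>s (a j) + g j *s \<phi>1 \<and>
      (\<forall>i<length \<theta>s. hom_shift (Suc (cs ! j)) (ds ! i) (a j i)) \<and> hom_shift (Suc (cs ! j)) (cs ! 0) (g j)"
    by metis
  have "\<exists>x y. \<alpha>1 *s \<eta>s ! j = comb \<theta>s x + y *s \<phi>2 \<and>
      (\<forall>i<length \<theta>s. hom_shift (Suc (cs ! j)) (ds ! i) (x i)) \<and> hom_shift (Suc (cs ! j)) (cs ! 1) y"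
    if "j < length cs" for j
    using d2.homogeneous_N_lift[OF scale1[OF \<eta>D[OF that]] homogeneous_der_scale[OF d1.linear hom_\<eta>[OF that]]] by metis
  then obtain b h where bh: "\<And>j. j < length cs \<Longrightarrow> \<alpha>1 *s \<eta>s ! j = comb \<theta>s (b j) + h j *s \<phi>2 \<and>
      (\<forall>i<length \<theta>s. hom_shift (Suc (cs ! j)) (ds ! i) (b j i)) \<and> hom_shift (Suc (cs ! j)) (cs ! 1) (h j)"
    by metis
  interpret minimal_deletions "D (A - {H1})" "D (A - {H2})" \<alpha>1 \<alpha>2 \<theta>s ds \<phi>1 \<phi>2 "cs ! 0" "cs ! 1" D12 \<eta>s cs a b g h
  proof
    show "min_gens D12 (ds @ cs) (\<theta>s @ \<eta>s)" using min1 gs1_eq by simp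
    show "\<eta>s ! 0 = \<phi>1" "\<eta>s ! 1 = \<phi>2"
      using \<eta>s_nth[of 0] \<eta>s_nth[of 1] gs1[of "length \<theta>s"] gs1[of "length \<theta>s + 1"] cs cs_ne
      by (simp_all add: ys_def nth_append)
  qed (use cs ag bh in auto)
  obtain M' R' es rest H F where cb2: "change_of_bases M1 gs1 R1 M' gs1 R'"
    and res2: "minimal_free_resolution D12 k M' gs1 R'" and M'0: "M' 0 = ds @ cs"
    and M'1: "M' 1 = map Suc cs @ es" "es \<noteq> []" and H: "\<forall>j<length cs. H j \<in> carrier_vec (length \<theta>s)"
    and rows: "row (R' 1) 0 = H 0 @\<^sub>v (\<alpha>1 \<cdot>\<^sub>v unit_vec (length cs) 0)"
      "row (R' 1) 1 = H 1 @\<^sub>v (\<alpha>2 \<cdot>\<^sub>v unit_vec (length cs) 1)"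
      "\<forall>j\<in>{2..<length cs}. row (R' 1) j = H j @\<^sub>v (- g j \<cdot>\<^sub>v unit_vec (length cs) 0 + \<alpha>2 \<cdot>\<^sub>v unit_vec (length cs) j)"
    and M'2: "M' 2 = map Suc es @ rest"
      "\<forall>i<length es. F i \<in> carrier_vec (length cs) \<and> row (R' 2) i = F i @\<^sub>v (\<alpha>2 \<cdot>\<^sub>v unit_vec (length es) i)"
      "M' 2 = map Suc es \<longrightarrow> length es = length cs - 2 \<and> M' 3 = []"
    using resolution[of k M1 R1] res1 M10 unfolding gs1_eq by blast
  have carrier: "R (Suc i) \<in> carrier_mat (length (M (Suc i))) (length (M i))"
    if "minimal_free_resolution D12 k M gs R" for M gs i and R :: "nat \<Rightarrow> ('n, 'k) mpoly mat"
    using that by (auto simp: minimal_free_resolution_def graded_free_resolution_def graded_mat_def)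
  have "length gs = length (M 0)" using min0 by (auto simp: min_gens_def dest: list_all2_lengthD)
  then have cb: "change_of_bases M gs R M' gs1 R'"
    by (rule change_of_bases_trans[OF _ carrier[OF res] carrier[OF res1] carrier[OF res2] cb1 cb2])
  \<comment> \<open>The witness for the entry called \<open>g\<close> in the conclusion is the
    negative of the coordinate \<open>g j\<close>, since syzygies carry it with a minus
    sign.\<close>
  have nz: "\<forall>j\<in>{2..<length cs}. - g j \<noteq> 0" using g_nonzero by auto
  have "M' 2 \<noteq> []" using M'2(1) M'1(2) by simp
  then show ?thesis
    using cb res2[unfolded D12_def] M'0 M'1 H[unfolded len] nz rows M'2
    by (intro exI[of _ M'] exI[of _ gs1] exI[of _ R'] exI[of _ es] exI[of _ rest] exI[of _ H]
        exI[of _ "\<lambda>j. - g j"] exI[of _ F] conjI)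
qed

end
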